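(* Let $\mathcal{D}_3$ be the Ważewski dendrite replacement system of degree $3$ and let $\mathbb{G}=(G_{b},G_{r})$ be the self-similar tuple with $G_{b}=\langle\phi_3\rangle$ and $G_{r}$ the copy of the first Grigorchuk group acting on words in $\{2_E,3_E\}$. Then the group $E_{\mathcal{D}_3}\mathbb{G}$ of eventually-$\mathbb{G}$ homeomorphisms is finitely generated.
   Context: Graphs are finite directed graphs with edges colored blue ($b$) or red ($r$), without isolated vertices. For an edge $e$, $\lambda_e(1)$ and $\lambda_e(2)$ denote its initial and terminal vertices (its boundary vertices). The replacement system $\mathcal{D}_3$: the base graph $\Gamma_0$ is a star with three red edges $1_0,2_0,3_0$ directed from the center to three distinct leaves. The blue replacement graph $R_b$ is a star with edges $1_I$ (blue), $2_I$ (red), $3_I$ (blue) directed from the center to three distinct leaves, where the leaf of $1_I$ is $\lambda_{R_b}(1)$ and the leaf of $3_I$ is $\lambda_{R_b}(2)$. The red replacement graph $R_r$ is a star with edges $1_E$ (blue), $2_E$ (red), $3_E$ (red) directed from the center to three distinct leaves, where the leaf of $1_E$ is $\lambda_{R_r}(1)$ and the leaf of $3_E$ is $\lambda_{R_r}(2)$. Expanding a $k$-colored edge $e$ of a graph means removing $e$ and gluing in a copy of $R_k$, identifying $\lambda_e(i)$ with $\lambda_{R_k}(i)$ for $i=1,2$; the new edges are the words $ea$, $a\in E_{R_k}$. Graph expansions are the graphs obtained from $\Gamma_0$ by finitely many expansions. $\mathbb{L}$ is the set of all edges (words) of all graph expansions, $c(w)$ is the color of $w\in\mathbb{L}$; $\Omega$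 is the space of infinite words all of whose nonempty finite prefixes lie in $\mathbb{L}$ (topologized as a subspace of a product of discrete alphabets), and $T_w\subseteq\Omega$ is the set of sequences with prefix $w$. For $c\in\{b,r\}$, $\mathbb{L}_c$ and $\Omega_c$ are the sets of finite and infinite words that can follow a $c$-colored edge. Gluing relation: $\alpha\sim\beta$ if for all $n$ the length-$n$ prefixes of $\alpha,\beta$ are edges sharing a boundary vertex; it is an equivalence relation and the limit space is $X=\Omega/\!\sim$, with points $\llbracket\alpha\rrbracket$. The cell of $e\in\mathbb{L}$ is $\llbracket e\rrbracket=\{\llbracket\alpha\rrbracket:\alpha\in T_e\}$ and $\partial e$ is its topological boundary in $X$. Each point of $\partial e$ corresponds to a unique boundary vertex $v$ of $e$ (all but finitely many prefixes of each of its addresses are incident on $v$) and is identified with it. Automorphisms. $\mathrm{Aut}(\Omega_c)$ is the group of homeomorphisms of $\Omega_c$ induced by color-preserving automorphisms of the rooted tree with vertices $\mathbb{L}_c$ and edges $w-wx$; $\hat\phi$ denotes the bijection of $\mathbb{L}_c$ induced by $\phi$, and the state $\phi|w\in \mathrm{Aut}(\Omega_{c(w)})$ is given by $\phi(w\alpha)=\hat\phi(w)(\phi|w)(\alpha)$. The element $\phi_3\in\mathrm{Aut}(\Omega_b)$ swaps the first letters $1_I$ and $3_I$, fixes the first letter $2_I$, and has trivial states at all nonempty words. The group $G_r\le\mathrm{Aut}(\Omega_r)$ is generated by $a,b,c,d$, where $a(2_E\alpha)=3_E\alpha$, $a(3_E\alpha)=2_E\alpha$; $b(2_E\alpha)=2_E\,a(\alpha)$,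 $b(3_E\alpha)=3_E\,c(\alpha)$; $c(2_E\alpha)=2_E\,a(\alpha)$, $c(3_E\alpha)=3_E\,d(\alpha)$; $d(2_E\alpha)=2_E\alpha$, $d(3_E\alpha)=3_E\,b(\alpha)$; and all of $a,b,c,d$ fix every sequence starting with $1_E$. The tuple $\mathbb{G}=(\langle\phi_3\rangle,G_r)$ is self-similar, i.e. states at $w$ of its elements lie in the entry indexed by $c(w)$, and its elements preserve the gluing relation $\sim_c$ on $\Omega_c$ obtained by taking a single $c$-colored edge with distinct endpoints as base graph. Diagrams and the group. A $\pi$-isomorphism $\mathfrak{f}\colon D\to D'$ consists of bijections $\mathfrak{f}_V$ of vertices and $\mathfrak{f}_E$ of edges and permutations $\pi_e\in\mathrm{Sym}(2)$ ($e\in E_D$) with $\mathfrak{f}_V(\lambda_e(i))=\lambda_{\mathfrak{f}_E(e)}(\pi_e(i))$. For $v,w\in\mathbb{L}$ of the same color $c$, a cell isomorphism $\llbracket v\rrbracket\to\llbracket w\rrbracket$ is a well-defined map $\llbracket v\alpha\rrbracket\mapsto\llbracket w\phi(\alpha)\rrbracket$ with $\phi\in\mathrm{Aut}(\Omega_c)$ preserving $\sim_c$, which restricts to a bijection $\partial v\to\partial w$. A diagram $(D,D',\mathfrak{f},l)$ consists of graph expansions $D,D'$, a $\pi$-isomorphism $\mathfrak{f}\colon D\to D'$ and labels $l_e\in G_{c(e)}$ ($e\in E_D$) such that for every $e\in E_D$ the map $\llbracket e\alpha\rrbracket\mapsto\llbracket\mathfrak{f}_E(e)l_e(\alpha)\rrbracket$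 is a cell isomorphism $\llbracket e\rrbracket\to\llbracket\mathfrak{f}_E(e)\rrbracket$ that agrees with $\lambda_{\mathfrak{f}_E(e)}\circ\pi_e\circ\lambda_e^{-1}$ on $\partial e$. A diagram acts on $\Omega$ by $e\alpha\mapsto\mathfrak{f}_E(e)l_e(\alpha)$ ($e\in E_D$) and thereby induces a homeomorphism of $X$; $E_{\mathcal{D}_3}\mathbb{G}$ is the group of all homeomorphisms of $X$ so obtained. *)

theory Defs
  imports
    "HOL-Analysis.Analysis"
    "HOL-Algebra.Bij"
    "HOL-Algebra.Generated_Groups"
    "HOL-Library.Omega_Words_Fun"
begin

section \<open>Colored directed graphs and the dendrite replacement system of degree 3\<close>

datatype color = Blue | Red

text \<open>The index set {1,2} of the boundary vertices of an edge: 1 is the initial, 2 the terminal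
  vertex. The group Sym(2) is rendered by the bijections of this type.\<close>

datatype side = Initial | Terminal

record ('v, 'e) cgraph =
  verts :: "'v set"
  edges :: "'e set"
  ecolor :: "'e \<Rightarrow> color"
  bdry :: "'e \<Rightarrow> side \<Rightarrow> 'v"

datatype idx = First | Second | Third

text \<open>\<open>Z i\<close>, \<open>I i\<close>, \<open>E i\<close> are the edges of the base graph, of the blue and of the red replacement
  graph, respectively.\<close>

datatype letter = Z (index: idx) | I (index: idx) | E (index: idx)

type_synonym fword = "letter list"
type_synonym iword = "nat \<Rightarrow> letter"

datatype star_vertex = Centre | Leaf idx

definition star_bdry :: "idx \<Rightarrow> side \<Rightarrow> star_vertex" where
  "star_bdry i s = (case s of Initial \<Rightarrow> Centre | Terminal \<Rightarrow> Leaf i)"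

definition star :: "(idx \<Rightarrow> letter) \<Rightarrow> (idx \<Rightarrow> color) \<Rightarrow> (star_vertex, letter) cgraph" where
  "star e k =
    \<lparr>verts = UNIV, edges = range e,
     ecolor = (\<lambda>x. k (index x)), bdry = (\<lambda>x. star_bdry (index x))\<rparr>"

definition replacement :: "color \<Rightarrow> (star_vertex, letter) cgraph" where
  "replacement c =
    (case c of
      Blue \<Rightarrow> star I (\<lambda>i. case i of First \<Rightarrow> Blue | Second \<Rightarrow> Red | Third \<Rightarrow> Blue)
    | Red \<Rightarrow> star E (\<lambda>i. case i of First \<Rightarrow> Blue | Second \<Rightarrow> Red | Third \<Rightarrow> Red))"

text \<open>The boundary vertices of a replacement graph; they are the same leaves for both colors.\<close>

definition rep_bdry :: "side \<Rightarrow> star_vertex" where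
  "rep_bdry s = (case s of Initial \<Rightarrow> Leaf First | Terminal \<Rightarrow> Leaf Third)"

text \<open>Vertices of expansions: those of the base graph, and for each expanded edge \<open>w\<close> the
  non-boundary vertices of the copy of the replacement graph glued in for \<open>w\<close>.\<close>

datatype 'v vertex = BaseV 'v | NewV fword star_vertex

definition base_graph :: "(star_vertex vertex, fword) cgraph" where
  "base_graph =
    \<lparr>verts = range BaseV, edges = {[Z i] | i. True},
     ecolor = (\<lambda>_. Red), bdry = (\<lambda>w s. BaseV (star_bdry (index (hd w)) s))\<rparr>"

text \<open>The single \<open>c\<close>-colored edge with distinct endpoints. The edge is named by the empty word, so
  that the edges of the expansions are exactly the words which can follow a \<open>c\<close>-colored edge.\<close>

definition edge_graph :: "color \<Rightarrow> (side vertex, fword) cgraph" where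
  "edge_graph c =
    \<lparr>verts = range BaseV, edges = {[]}, ecolor = (\<lambda>_. c), bdry = (\<lambda>_ s. BaseV s)\<rparr>"

definition glue ::
  "('v vertex, fword) cgraph \<Rightarrow> fword \<Rightarrow> star_vertex \<Rightarrow> 'v vertex" where
  "glue G w u =
    (if u = rep_bdry Initial then bdry G w Initial
     else if u = rep_bdry Terminal then bdry G w Terminal
     else NewV w u)"

definition expand ::
  "('v vertex, fword) cgraph \<Rightarrow> fword \<Rightarrow> ('v vertex, fword) cgraph" where
  "expand G w =
    (let R = replacement (ecolor G w); old = edges G - {w} in
     \<lparr>verts = verts G \<union> glue G w ` verts R,
      edges = old \<union> (\<lambda>x. w @ [x]) ` edges R,
      ecolor = (\<lambda>u. if u \<in> old then ecolor G u else ecolor R (last u)),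
      bdry = (\<lambda>u s. if u \<in> old then bdry G u s else glue G w (bdry R (last u) s))\<rparr>)"

inductive_set expansions ::
  "('v vertex, fword) cgraph \<Rightarrow> ('v vertex, fword) cgraph set"
  for B :: "('v vertex, fword) cgraph" where
  base: "B \<in> expansions B"
| step: "G \<in> expansions B \<Longrightarrow> w \<in> edges G \<Longrightarrow> expand G w \<in> expansions B"


section \<open>Languages, infinite words and the gluing relation\<close>

definition lang :: "('v vertex, fword) cgraph \<Rightarrow> fword set" where
  "lang B = (\<Union>G\<in>expansions B. edges G)"

definition word_color :: "('v vertex, fword) cgraph \<Rightarrow> fword \<Rightarrow> color" where
  "word_color B w = (THE c. \<exists>G\<in>expansions B. w \<in> edges G \<and> ecolor G w = c)"

definition word_bdry :: "('v vertex, fword) cgraph \<Rightarrow> fword \<Rightarrow> side \<Rightarrow> 'v vertex" where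
  "word_bdry B w = (THE b. \<exists>G\<in>expansions B. w \<in> edges G \<and> bdry G w = b)"

definition Omega :: "('v vertex, fword) cgraph \<Rightarrow> iword set" where
  "Omega B = {\<alpha>. \<forall>n>0. prefix n \<alpha> \<in> lang B}"

definition incident :: "('v vertex, fword) cgraph \<Rightarrow> fword \<Rightarrow> 'v vertex \<Rightarrow> bool" where
  "incident B w v \<longleftrightarrow> v \<in> range (word_bdry B w)"

definition gluing :: "('v vertex, fword) cgraph \<Rightarrow> (iword \<times> iword) set" where
  "gluing B =
    {(\<alpha>, \<beta>). \<alpha> \<in> Omega B \<and> \<beta> \<in> Omega B \<and>
      (\<forall>n>0. \<exists>v. incident B (prefix n \<alpha>) v \<and> incident B (prefix n \<beta>) v)}"

definition Omega_top :: "('v vertex, fword) cgraph \<Rightarrow> iword topology" where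
  "Omega_top B =
    subtopology (product_topology (\<lambda>_. discrete_topology UNIV) UNIV) (Omega B)"

abbreviation "LL \<equiv> lang base_graph"
abbreviation "OM \<equiv> Omega base_graph"
abbreviation "color_of \<equiv> word_color base_graph"
abbreviation "lam \<equiv> word_bdry base_graph"

abbreviation LL_c :: "color \<Rightarrow> fword set" where "LL_c c \<equiv> lang (edge_graph c)"
abbreviation OM_c :: "color \<Rightarrow> iword set" where "OM_c c \<equiv> Omega (edge_graph c)"


section \<open>The limit space\<close>

definition cls :: "iword \<Rightarrow> iword set" where
  "cls \<alpha> = gluing base_graph `` {\<alpha>}"

definition limit_space :: "iword set set" where
  "limit_space = OM // gluing base_graph"

definition limit_top :: "iword set topology" where
  "limit_top =
    topology (\<lambda>U. U \<subseteq> limit_space \<and> openin (Omega_top base_graph) {\<alpha> \<in> OM. cls \<alpha> \<in> U})"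

definition cell :: "fword \<Rightarrow> iword set set" where
  "cell e = cls ` {\<alpha> \<in> OM. prefix (length e) \<alpha> = e}"

definition cell_bd :: "fword \<Rightarrow> iword set set" where
  "cell_bd e = limit_top frontier_of cell e"

text \<open>The boundary vertex of \<open>e\<close> identified with the point \<open>p\<close> of the boundary of its cell.
  The elements of \<open>p\<close> are the addresses of \<open>p\<close>.\<close>

definition vertex_at :: "fword \<Rightarrow> iword set \<Rightarrow> star_vertex vertex" where
  "vertex_at e p =
    (THE v. incident base_graph e v \<and>
      (\<forall>\<alpha>\<in>p. \<exists>N. \<forall>n\<ge>N. incident base_graph (prefix n \<alpha>) v))"


section \<open>Automorphisms and the self-similar tuple\<close>

definition tree_adj :: "fword \<Rightarrow> fword \<Rightarrow> bool" where
  "tree_adj u v \<longleftrightarrow> (\<exists>x. v = u @ [x] \<or> u = v @ [x])"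

definition tree_aut :: "color \<Rightarrow> (fword \<Rightarrow> fword) \<Rightarrow> bool" where
  "tree_aut c \<psi> \<longleftrightarrow>
    bij_betw \<psi> (LL_c c) (LL_c c) \<and> \<psi> [] = [] \<and>
    (\<forall>u\<in>LL_c c. \<forall>v\<in>LL_c c. tree_adj (\<psi> u) (\<psi> v) \<longleftrightarrow> tree_adj u v) \<and>
    (\<forall>u\<in>LL_c c. word_color (edge_graph c) (\<psi> u) = word_color (edge_graph c) u)"

definition Aut_Omega :: "color \<Rightarrow> (iword \<Rightarrow> iword) set" where
  "Aut_Omega c =
    {\<phi> \<in> Bij (OM_c c). homeomorphic_map (Omega_top (edge_graph c)) (Omega_top (edge_graph c)) \<phi> \<and>
      (\<exists>\<psi>. tree_aut c \<psi> \<and> (\<forall>\<alpha>\<in>OM_c c. \<forall>n. prefix n (\<phi> \<alpha>) = \<psi> (prefix n \<alpha>)))}"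

definition preserves_gluing :: "color \<Rightarrow> (iword \<Rightarrow> iword) \<Rightarrow> bool" where
  "preserves_gluing c \<phi> \<longleftrightarrow>
    (\<forall>\<alpha>\<in>OM_c c. \<forall>\<beta>\<in>OM_c c.
      (\<phi> \<alpha>, \<phi> \<beta>) \<in> gluing (edge_graph c) \<longleftrightarrow> (\<alpha>, \<beta>) \<in> gluing (edge_graph c))"

text \<open>The transformation of infinite words induced by a length- and prefix-preserving map \<open>f\<close>
  of finite words.\<close>

definition induced :: "(fword \<Rightarrow> fword) \<Rightarrow> iword \<Rightarrow> iword" where
  "induced f \<alpha> = (\<lambda>n. f (prefix (Suc n) \<alpha>) ! n)"

fun wphi3 :: "fword \<Rightarrow> fword" where
  "wphi3 (I First # w) = I Third # w"
| "wphi3 (I Third # w) = I First # w"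
| "wphi3 w = w"

fun wa :: "fword \<Rightarrow> fword" where
  "wa (E Second # w) = E Third # w"
| "wa (E Third # w) = E Second # w"
| "wa w = w"

fun wb :: "fword \<Rightarrow> fword" and wc :: "fword \<Rightarrow> fword" and wd :: "fword \<Rightarrow> fword" where
  "wb (E Second # w) = E Second # wa w"
| "wb (E Third # w) = E Third # wc w"
| "wb w = w"
| "wc (E Second # w) = E Second # wa w"
| "wc (E Third # w) = E Third # wd w"
| "wc w = w"
| "wd (E Second # w) = E Second # w"
| "wd (E Third # w) = E Third # wb w"
| "wd w = w"

definition phi3 :: "iword \<Rightarrow> iword" where "phi3 = restrict (induced wphi3) (OM_c Blue)"
definition gen_a :: "iword \<Rightarrow> iword" where "gen_a = restrict (induced wa) (OM_c Red)"
definition gen_b :: "iword \<Rightarrow> iword" where "gen_b = restrict (induced wb) (OM_c Red)"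
definition gen_c :: "iword \<Rightarrow> iword" where "gen_c = restrict (induced wc) (OM_c Red)"
definition gen_d :: "iword \<Rightarrow> iword" where "gen_d = restrict (induced wd) (OM_c Red)"

definition Aut_group :: "color \<Rightarrow> (iword \<Rightarrow> iword) monoid" where
  "Aut_group c = (BijGroup (OM_c c))\<lparr>carrier := Aut_Omega c\<rparr>"

definition GG :: "color \<Rightarrow> (iword \<Rightarrow> iword) set" where
  "GG c =
    (case c of
      Blue \<Rightarrow> generate (Aut_group Blue) {phi3}
    | Red \<Rightarrow> generate (Aut_group Red) {gen_a, gen_b, gen_c, gen_d})"


section \<open>Diagrams and the group\<close>

definition pi_isomorphism ::
  "('v, 'e) cgraph \<Rightarrow> ('v, 'e) cgraph \<Rightarrow> ('v \<Rightarrow> 'v) \<Rightarrow> ('e \<Rightarrow> 'e) \<Rightarrow> ('e \<Rightarrow> side \<Rightarrow> side) \<Rightarrow> bool" where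
  "pi_isomorphism D D' fV fE \<pi> \<longleftrightarrow>
    bij_betw fV (verts D) (verts D') \<and> bij_betw fE (edges D) (edges D') \<and>
    (\<forall>e\<in>edges D. bij (\<pi> e) \<and> (\<forall>s. fV (bdry D e s) = bdry D' (fE e) (\<pi> e s)))"

text \<open>\<open>F\<close> is the cell isomorphism from the cell of \<open>v\<close> to the cell of \<open>w\<close> determined by \<open>\<phi>\<close>; only the
  values of \<open>F\<close> on the cell of \<open>v\<close> matter, and its existence expresses well-definedness.\<close>

definition cell_isomorphism ::
  "fword \<Rightarrow> fword \<Rightarrow> (iword \<Rightarrow> iword) \<Rightarrow> (iword set \<Rightarrow> iword set) \<Rightarrow> bool" where
  "cell_isomorphism v w \<phi> F \<longleftrightarrow>
    v \<in> LL \<and> w \<in> LL \<and> color_of v = color_of w \<and>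
    \<phi> \<in> Aut_Omega (color_of v) \<and> preserves_gluing (color_of v) \<phi> \<and>
    (\<forall>\<alpha>\<in>OM_c (color_of v). F (cls (v \<frown> \<alpha>)) = cls (w \<frown> \<phi> \<alpha>)) \<and>
    bij_betw F (cell_bd v) (cell_bd w)"

definition diagram ::
  "(star_vertex vertex, fword) cgraph \<Rightarrow> (star_vertex vertex, fword) cgraph \<Rightarrow>
   (star_vertex vertex \<Rightarrow> star_vertex vertex) \<Rightarrow> (fword \<Rightarrow> fword) \<Rightarrow> (fword \<Rightarrow> side \<Rightarrow> side) \<Rightarrow>
   (fword \<Rightarrow> iword \<Rightarrow> iword) \<Rightarrow> bool" where
  "diagram D D' fV fE \<pi> l \<longleftrightarrow>
    D \<in> expansions base_graph \<and> D' \<in> expansions base_graph \<and>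
    pi_isomorphism D D' fV fE \<pi> \<and>
    (\<forall>e\<in>edges D. l e \<in> GG (color_of e)) \<and>
    (\<forall>e\<in>edges D. \<exists>F. cell_isomorphism e (fE e) (l e) F \<and>
      (\<forall>p\<in>cell_bd e.
        vertex_at (fE e) (F p) = lam (fE e) (\<pi> e (inv_into UNIV (lam e) (vertex_at e p)))))"

definition EG :: "(iword set \<Rightarrow> iword set) monoid" where
  "EG = (BijGroup limit_space)\<lparr>carrier :=
    {h \<in> Bij limit_space. homeomorphic_map limit_top limit_top h \<and>
      (\<exists>D D' fV fE \<pi> l. diagram D D' fV fE \<pi> l \<and>
        (\<forall>e\<in>edges D. \<forall>\<alpha>\<in>OM_c (color_of e). h (cls (e \<frown> \<alpha>)) = cls (fE e \<frown> l e \<alpha>)))}\<rparr>"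

definition finitely_generated :: "('a, 'b) monoid_scheme \<Rightarrow> bool" where
  "finitely_generated G \<longleftrightarrow> (\<exists>S. finite S \<and> S \<subseteq> carrier G \<and> generate G S = carrier G)"


section \<open>Consistency of the definitions\<close>

lemma openin_limit_top:
  "openin limit_top U \<longleftrightarrow>
    U \<subseteq> limit_space \<and> openin (Omega_top base_graph) {\<alpha> \<in> OM. cls \<alpha> \<in> U}"
proof -
  let ?O = "\<lambda>U. openin (Omega_top base_graph) {\<alpha> \<in> OM. cls \<alpha> \<in> U}"
  have i: "?O (S \<inter> T)" if "?O S" "?O T" for S T
  proof -
    have "{\<alpha> \<in> OM. cls \<alpha> \<in> S \<inter> T} = {\<alpha> \<in> OM. cls \<alpha> \<in> S} \<inter> {\<alpha> \<in> OM. cls \<alpha> \<in> T}" by auto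
    with that show ?thesis by (simp add: openin_Int)
  qed
  have u: "?O (\<Union>K)" if "\<forall>S\<in>K. ?O S" for K
  proof -
    have "{\<alpha> \<in> OM. cls \<alpha> \<in> \<Union>K} = (\<Union>S\<in>K. {\<alpha> \<in> OM. cls \<alpha> \<in> S})" by auto
    moreover have "openin (Omega_top base_graph) (\<Union>S\<in>K. {\<alpha> \<in> OM. cls \<alpha> \<in> S})"
      by (rule openin_Union) (use that in auto)
    ultimately show ?thesis by (simp only:)
  qed
  have "istopology (\<lambda>U. U \<subseteq> limit_space \<and> ?O U)"
    unfolding istopology_def using i u by auto
  then show ?thesis
    by (simp add: limit_top_def topology_inverse')
qed

lemma topspace_Omega_top [simp]: "topspace (Omega_top B) = Omega B"
  by (simp add: Omega_top_def)

lemma cls_in_limit_space: "\<alpha> \<in> OM \<Longrightarrow> cls \<alpha> \<in> limit_space"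
  by (simp add: cls_def limit_space_def quotientI)

lemma limit_space_eq: "limit_space = cls ` OM"
  by (auto simp: limit_space_def quotient_def cls_def)

lemma topspace_limit_top [simp]: "topspace limit_top = limit_space"
proof -
  have "{\<alpha> \<in> OM. cls \<alpha> \<in> limit_space} = OM"
    using cls_in_limit_space by auto
  then have "openin limit_top limit_space"
    using openin_topspace[of "Omega_top base_graph"] by (simp add: openin_limit_top)
  then show ?thesis
    by (meson openin_limit_top openin_subset openin_topspace subset_antisym)
qed

lemma quotient_map_cls: "quotient_map (Omega_top base_graph) limit_top cls"
  by (simp add: quotient_map_def openin_limit_top limit_space_eq)

lemma induced_Cons:
  assumes "\<And>w. f (x # w) = y # g w"
  shows "induced f ([x] \<frown> \<alpha>) = [y] \<frown> induced g \<alpha>"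
proof
  fix n
  have "prefix (Suc n) ([x] \<frown> \<alpha>) = x # prefix n \<alpha>"
    by (rule nth_equalityI) (auto simp: conc_def nth_Cons' subsequence_def simp del: upt_Suc)
  then have *: "induced f ([x] \<frown> \<alpha>) n = (y # g (prefix n \<alpha>)) ! n"
    by (simp only: induced_def assms)
  show "induced f ([x] \<frown> \<alpha>) n = ([y] \<frown> induced g \<alpha>) n"
    unfolding * by (cases n) (simp_all only: induced_def conc_def nth_Cons_0 nth_Cons_Suc, simp_all)
qed

lemma induced_id [simp]: "induced (\<lambda>w. w) \<alpha> = \<alpha>"
proof
  show "induced (\<lambda>w. w) \<alpha> n = \<alpha> n" for n
    unfolding induced_def subsequence_def by (simp del: upt_Suc)
qed

lemma induced_Cons':
  assumes "\<And>w. f (x # w) = y # w"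
  shows "induced f ([x] \<frown> \<alpha>) = [y] \<frown> \<alpha>"
  using induced_Cons[of f x y "\<lambda>w. w" \<alpha>] assms by simp

lemma generator_recursion:
  "induced wphi3 ([I First] \<frown> \<alpha>) = [I Third] \<frown> \<alpha>"
  "induced wphi3 ([I Second] \<frown> \<alpha>) = [I Second] \<frown> \<alpha>"
  "induced wphi3 ([I Third] \<frown> \<alpha>) = [I First] \<frown> \<alpha>"
  "induced wa ([E First] \<frown> \<alpha>) = [E First] \<frown> \<alpha>"
  "induced wa ([E Second] \<frown> \<alpha>) = [E Third] \<frown> \<alpha>"
  "induced wa ([E Third] \<frown> \<alpha>) = [E Second] \<frown> \<alpha>"
  "induced wb ([E First] \<frown> \<alpha>) = [E First] \<frown> \<alpha>"
  "induced wb ([E Second] \<frown> \<alpha>) = [E Second] \<frown> induced wa \<alpha>"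
  "induced wb ([E Third] \<frown> \<alpha>) = [E Third] \<frown> induced wc \<alpha>"
  "induced wc ([E First] \<frown> \<alpha>) = [E First] \<frown> \<alpha>"
  "induced wc ([E Second] \<frown> \<alpha>) = [E Second] \<frown> induced wa \<alpha>"
  "induced wc ([E Third] \<frown> \<alpha>) = [E Third] \<frown> induced wd \<alpha>"
  "induced wd ([E First] \<frown> \<alpha>) = [E First] \<frown> \<alpha>"
  "induced wd ([E Second] \<frown> \<alpha>) = [E Second] \<frown> \<alpha>"
  "induced wd ([E Third] \<frown> \<alpha>) = [E Third] \<frown> induced wb \<alpha>"
  by ((rule induced_Cons', simp; fail) | (rule induced_Cons, simp; fail))+

text \<open>Color and boundary vertices of a word do not depend on the expansion.\<close>

lemma expansions_consistent:
  fixes B :: "('v vertex, fword) cgraph"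
  assumes len: "\<And>w. w \<in> edges B \<Longrightarrow> length w = m"
    and G: "G \<in> expansions B" "w \<in> edges G"
    and H: "H \<in> expansions B" "w \<in> edges H"
  shows "ecolor G w = ecolor H w \<and> bdry G w = bdry H w"
proof -
  have min: "length u \<ge> m" if "G \<in> expansions B" "u \<in> edges G" for G u
    using that by (induction arbitrary: u) (auto simp: len expand_def Let_def le_SucI)
  define X where "X = (\<lambda>(w, y). (expand \<lparr>verts = {}, edges = {w}, ecolor = (\<lambda>_. fst y), bdry = (\<lambda>_. snd y)\<rparr> w)
    :: ('v vertex, fword) cgraph)"
  define r where "r = rec_nat (\<lambda>w. (ecolor B w, bdry B w))
     (\<lambda>n f w. (ecolor (X (butlast w, f (butlast w))) w, bdry (X (butlast w, f (butlast w))) w))"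
  have r0: "r 0 w = (ecolor B w, bdry B w)" for w by (simp add: r_def)
  have rS: "r (Suc n) w = (ecolor (X (butlast w, r n (butlast w))) w,
      bdry (X (butlast w, r n (butlast w))) w)" for n w by (simp add: r_def)
  have key: "(ecolor G u, bdry G u) = r (length u - m) u"
    if "G \<in> expansions B" "u \<in> edges G" for G u
    using that
  proof (induction arbitrary: u)
    case base
    then show ?case by (simp add: len r0)
  next
    case (step G w)
    show ?case
    proof (cases "u \<in> edges G - {w}")
      case True
      then show ?thesis using step.IH[of u] by (simp add: expand_def Let_def)
    next
      case False
      then obtain x where u: "u = w @ [x]"
        using step.prems by (auto simp: expand_def Let_def)
      have "m \<le> length w" using min step.hyps by blast
      then have l: "length u - m = Suc (length w - m)" by (simp add: u)
      have rw: "r (length w - m) w = (ecolor G w, bdry G w)" using step.IH[OF step.hyps(2)] by simp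
      show ?thesis unfolding l rS
        using False by (simp add: rw u X_def expand_def Let_def glue_def fun_eq_iff)
    qed
  qed
  show ?thesis using key[OF G] key[OF H] by (metis prod.inject)
qed

lemma length_base_graph: "w \<in> edges base_graph \<Longrightarrow> length w = 1"
  by (auto simp: base_graph_def)

lemma length_edge_graph: "w \<in> edges (edge_graph c) \<Longrightarrow> length w = 0"
  by (simp add: edge_graph_def)

lemma word_color_bdry_base:
  assumes "G \<in> expansions base_graph" "w \<in> edges G"
  shows "color_of w = ecolor G w" "lam w = bdry G w"
proof -
  have *: "ecolor H w = ecolor G w \<and> bdry H w = bdry G w"
    if "H \<in> expansions base_graph" "w \<in> edges H" for H
    using expansions_consistent[OF length_base_graph that assms] .
  show "color_of w = ecolor G w" "lam w = bdry G w"
    unfolding word_color_def word_bdry_def by (rule the_equality; use assms * in blast)+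
qed

lemma word_color_bdry_edge:
  assumes "G \<in> expansions (edge_graph c)" "w \<in> edges G"
  shows "word_color (edge_graph c) w = ecolor G w" "word_bdry (edge_graph c) w = bdry G w"
proof -
  have *: "ecolor H w = ecolor G w \<and> bdry H w = bdry G w"
    if "H \<in> expansions (edge_graph c)" "w \<in> edges H" for H
    using expansions_consistent[OF length_edge_graph that assms] .
  show "word_color (edge_graph c) w = ecolor G w" "word_bdry (edge_graph c) w = bdry G w"
    unfolding word_color_def word_bdry_def by (rule the_equality; use assms * in blast)+
qed

lemma lang_snoc:
  fixes B :: "('v vertex, fword) cgraph"
  assumes len: "\<And>w. w \<in> edges B \<Longrightarrow> length w = m" and m: "m \<le> length w"
  shows "w @ [x] \<in> lang B \<longleftrightarrow> w \<in> lang B \<and> x \<in> edges (replacement (word_color B w))"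
    and "w @ [x] \<in> lang B \<Longrightarrow>
      word_color B (w @ [x]) = ecolor (replacement (word_color B w)) x"
proof -
  have col: "word_color B u = ecolor G u" if "G \<in> expansions B" "u \<in> edges G" for G u
    unfolding word_color_def
    by (rule the_equality) (use that expansions_consistent[OF len] in blast)+
  have down: "w \<in> lang B \<and> x \<in> edges (replacement (word_color B w)) \<and>
      ecolor G (w @ [x]) = ecolor (replacement (word_color B w)) x"
    if "G \<in> expansions B" "w @ [x] \<in> edges G" for G
    using that
  proof induction
    case base
    then show ?case using len m by force
  next
    case (step G u)
    show ?case
    proof (cases "w @ [x] \<in> edges G - {u}")
      case True
      then show ?thesis using step.IH by (simp add: expand_def Let_def)
    next
      case False
      with step.prems have u: "u = w" "x \<in> edges (replacement (ecolor G w))"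
        by (auto simp: expand_def Let_def)
      with step.hyps have "w \<in> lang B" "word_color B w = ecolor G w"
        by (auto simp: lang_def col)
      then show ?thesis using False u by (simp add: expand_def Let_def)
    qed
  qed
  show "w @ [x] \<in> lang B \<longleftrightarrow> w \<in> lang B \<and> x \<in> edges (replacement (word_color B w))"
  proof
    assume "w @ [x] \<in> lang B"
    then show "w \<in> lang B \<and> x \<in> edges (replacement (word_color B w))"
      using down by (auto simp: lang_def)
  next
    assume a: "w \<in> lang B \<and> x \<in> edges (replacement (word_color B w))"
    then obtain G where G: "G \<in> expansions B" "w \<in> edges G" by (auto simp: lang_def)
    then have "w @ [x] \<in> edges (expand G w)"
      using a by (simp add: expand_def Let_def col)
    then show "w @ [x] \<in> lang B"
      using expansions.step[OF G] by (auto simp: lang_def)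
  qed
  show "word_color B (w @ [x]) = ecolor (replacement (word_color B w)) x" if wx: "w @ [x] \<in> lang B"
  proof -
    obtain G where "G \<in> expansions B" "w @ [x] \<in> edges G" using wx by (auto simp: lang_def)
    then show ?thesis using down col by metis
  qed
qed

lemma length_LL: "e \<in> LL \<Longrightarrow> 1 \<le> length e"
proof -
  have "1 \<le> length e" if "G \<in> expansions base_graph" "e \<in> edges G" for G
    using that
    by (induction arbitrary: e) (auto simp: base_graph_def expand_def Let_def)
  then show "e \<in> LL \<Longrightarrow> 1 \<le> length e" by (auto simp: lang_def)
qed

text \<open>The edges of the expansions of a single \<open>c\<close>-colored edge are the words which can follow a
  \<open>c\<close>-colored edge.\<close>

lemma LL_c_follow:
  assumes e: "e \<in> LL"
  shows "e @ w \<in> LL \<longleftrightarrow> w \<in> LL_c (color_of e)"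
    and "e @ w \<in> LL \<Longrightarrow> color_of (e @ w) = word_color (edge_graph (color_of e)) w"
proof -
  let ?B = "edge_graph (color_of e)"
  have "(e @ w \<in> LL \<longleftrightarrow> w \<in> lang ?B) \<and>
    (e @ w \<in> LL \<longrightarrow> color_of (e @ w) = word_color ?B w)"
  proof (induction w rule: rev_induct)
    case Nil
    have b: "?B \<in> expansions ?B" "[] \<in> edges ?B"
      by (auto intro: expansions.base simp: edge_graph_def)
    then have "[] \<in> lang ?B" by (auto simp: lang_def)
    moreover have "word_color ?B [] = color_of e"
      using word_color_bdry_edge(1)[OF b] by (simp add: edge_graph_def)
    ultimately show ?case using e by simp
  next
    case (snoc x w)
    have l: "1 \<le> length (e @ w)" using length_LL[OF e] by simp
    have 1: "(e @ w) @ [x] \<in> LL \<longleftrightarrow>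
        e @ w \<in> LL \<and> x \<in> edges (replacement (color_of (e @ w)))"
      "(e @ w) @ [x] \<in> LL \<Longrightarrow>
        color_of ((e @ w) @ [x]) = ecolor (replacement (color_of (e @ w))) x"
      using lang_snoc[OF length_base_graph l] by auto
    have 2: "w @ [x] \<in> lang ?B \<longleftrightarrow> w \<in> lang ?B \<and> x \<in> edges (replacement (word_color ?B w))"
      "w @ [x] \<in> lang ?B \<Longrightarrow>
        word_color ?B (w @ [x]) = ecolor (replacement (word_color ?B w)) x"
      using lang_snoc[of ?B 0, OF length_edge_graph[of _ "color_of e"] le0] by auto
    show ?case using 1 2 snoc.IH unfolding append_assoc by metis
  qed
  then show "e @ w \<in> LL \<longleftrightarrow> w \<in> LL_c (color_of e)"
    and "e @ w \<in> LL \<Longrightarrow> color_of (e @ w) = word_color ?B w" by auto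
qed

end

theory Submission
  imports Defs
begin

text \<open>Two different addresses are glued iff they are addresses of the same branch point: both have the
  form \<open>e x \<kappa>\<close>, where \<open>x\<close> is one of the three letters which can follow \<open>e\<close> and \<open>\<kappa>\<close> is the address of
  the initial vertex inside a cell. Hence the elements of the group are exactly the maps induced by
  the bijections of the infinite words which preserve this relation and act on all sufficiently deep
  cells by a change of prefix and a label. This gives the group axioms at once.

  For the generation, consider the involution exchanging the branch points of the empty word and of
  the first base edge, the permutations of the three base cells, and the maps supported on the first
  base cell which act there by the generators of the Grigorchuk group or by the map which turns an
  expansion of the blue edge \<open>E First\<close> into an expansion of the red edge \<open>E Second\<close>. Induction on
  the length of words shows that the group they generate moves every red cell onto the first base
  cell by a change of prefix, so it contains copies of the latter maps in all red cells. With these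
  copies an element can be changed so that neither its domain nor its range partition expands a
  blue edge. Such an element is an isomorphism of finite binary trees up to moving the root, which
  the involution and the permutations do, so only interchanges of siblings and labels remain.\<close>

section \<open>Words\<close>

text \<open>The obstacle is the blue edges. A red cell meets the rest of the space only in its
  initial vertex, so a gluing-preserving map fixing that vertex can be performed inside any red
  cell. A blue cell lies between two vertices at which other cells are attached, and its labels
  \<open>idc Blue\<close> and \<open>phi3\<close> only keep or reverse its direction.
  \<open>cell_shift\<close> arises as follows. Expanding a red edge creates a branch point p, joined
  to the initial vertex by the blue edge \<open>E First\<close>. Expanding this blue edge puts a
  branch point q between the two; expanding \<open>E Second\<close> instead puts the new branch
  point beyond p. The two trees have the same shape, with q in the role of the nearer branch point.
  The blue edge between the branch points points away from the initial vertex in one tree and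
  towards it in the other, hence the label \<open>phi3\<close>. Of the Grigorchuk group the argument
  uses its finitely many involutive generators, its self-similarity, that the cell of
  \<open>E First\<close> is fixed pointwise, and that \<open>a\<close> interchanges the siblings
  \<open>E Second\<close> and \<open>E Third\<close>. The terminal vertex of a red edge is no
  boundary point of its cell, so labels may move it.\<close>

fun lcol :: "letter \<Rightarrow> color" where
  "lcol (Z i) = Red"
| "lcol (I i) = (if i = Second then Red else Blue)"
| "lcol (E i) = (if i = First then Blue else Red)"

text \<open>The state of a word is the color of its last letter; \<open>None\<close> is the state before the first
  letter of a word of the base graph.\<close>

fun allowed :: "color option \<Rightarrow> letter \<Rightarrow> bool" where
  "allowed None (Z i) = True"
| "allowed (Some Blue) (I i) = True"
| "allowed (Some Red) (E i) = True"
| "allowed _ _ = False"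

fun valid :: "color option \<Rightarrow> fword \<Rightarrow> bool" where
  "valid s [] = True"
| "valid s (x # w) = (allowed s x \<and> valid (Some (lcol x)) w)"

definition end_state :: "color option \<Rightarrow> fword \<Rightarrow> color option" where
  "end_state s w = (if w = [] then s else Some (lcol (last w)))"

lemma end_state_simps [simp]: "end_state s [] = s" "end_state s (x # w) = end_state (Some (lcol x)) w"
  by (auto simp: end_state_def)

lemma end_state_append [simp]: "end_state s (u @ v) = end_state (end_state s u) v"
  by (auto simp: end_state_def)

lemma valid_append [simp]: "valid s (u @ v) \<longleftrightarrow> valid s u \<and> valid (end_state s u) v"
  by (induction u arbitrary: s) auto

lemma allowed_None: "allowed None x \<longleftrightarrow> (\<exists>i. x = Z i)"
  and allowed_Blue: "allowed (Some Blue) x \<longleftrightarrow> (\<exists>i. x = I i)"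
  and allowed_Red: "allowed (Some Red) x \<longleftrightarrow> (\<exists>i. x = E i)"
  by (cases x; auto)+

lemma allowed_index_inj: "allowed s x \<Longrightarrow> allowed s y \<Longrightarrow> index x = index y \<Longrightarrow> x = y"
  by (cases s; cases x; cases y; auto; metis color.exhaust allowed.simps)

lemma replacement_iff:
  "x \<in> edges (replacement c) \<longleftrightarrow> allowed (Some c) x"
  "allowed (Some c) x \<Longrightarrow> ecolor (replacement c) x = lcol x"
  "bdry (replacement c) x = star_bdry (index x)"
  "verts (replacement c) = UNIV"
  by (cases c; cases x; auto simp: replacement_def star_def split: idx.split)+

lemma edges_expand: "edges (expand G w) = (edges G - {w}) \<union> {w @ [x] |x. allowed (Some (ecolor G w)) x}"
  by (auto simp: expand_def Let_def replacement_iff)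

text \<open>An expansion adds only words one letter longer than an existing nonempty word, so words
  of length one are never new.\<close>

lemma length_base_LL:
  assumes "G \<in> expansions base_graph" "w \<in> edges G" "length w = 1" shows "\<exists>i. w = [Z i]"
  using assms
proof (induction arbitrary: w)
  case base
  then show ?case by (auto simp: base_graph_def)
next
  case (step G v)
  have "length v \<ge> 1" using length_LL step.hyps by (auto simp: lang_def)
  then show ?case using step by (auto simp: edges_expand)
qed

text \<open>Membership and color need a common induction on the last letter: the color of a word
  decides which letters may follow it, and the letter decides the next color.\<close>

lemma LL_color: "(w \<in> LL \<longleftrightarrow> w \<noteq> [] \<and> valid None w) \<and> (w \<in> LL \<longrightarrow> Some (color_of w) = end_state None w)"
proof (induction w rule: rev_induct)
  case Nil
  then show ?case using length_LL by fastforce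
next
  case (snoc x w)
  show ?case
  proof (cases "w = []")
    case True
    have 1: "[x] \<in> LL \<Longrightarrow> \<exists>i. x = Z i"
      using length_base_LL by (fastforce simp: lang_def)
    have 2: "[Z i] \<in> edges base_graph" for i by (auto simp: base_graph_def)
    then have 3: "[Z i] \<in> LL" for i using expansions.base by (auto simp: lang_def)
    have "color_of [Z i] = Red" for i
      using word_color_bdry_base(1)[OF expansions.base 2] by (simp add: base_graph_def)
    then show ?thesis using True 1 3 by (auto simp: allowed_None)
  next
    case False
    then have l: "1 \<le> length w" by (cases w) auto
    note s = lang_snoc[of base_graph 1 w, OF length_base_graph l, where x = x, unfolded replacement_iff]
    then show ?thesis
      using snoc False replacement_iff(2)[of "color_of w" x] by auto
  qed
qed

lemma LL_iff: "w \<in> LL \<longleftrightarrow> w \<noteq> [] \<and> valid None w"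
  and color_of_end_state: "w \<in> LL \<Longrightarrow> end_state None w = Some (color_of w)"
  using LL_color by auto

lemma color_of_last: "w \<in> LL \<Longrightarrow> color_of w = lcol (last w)"
  using LL_color[of w] by (auto simp: end_state_def)

lemma LL_c_color:
  "(w \<in> LL_c c \<longleftrightarrow> valid (Some c) w) \<and>
   (w \<in> LL_c c \<longrightarrow> Some (word_color (edge_graph c) w) = end_state (Some c) w)"
proof (induction w rule: rev_induct)
  case Nil
  have b: "[] \<in> edges (edge_graph c)" by (simp add: edge_graph_def)
  then have "[] \<in> LL_c c" using expansions.base by (auto simp: lang_def)
  then show ?case using word_color_bdry_edge(1)[OF expansions.base b] by (simp add: edge_graph_def)
next
  case (snoc x w)
  note s = lang_snoc[of "edge_graph c" 0 w, OF length_edge_graph[of _ c] le0, where x = x, unfolded replacement_iff]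
  then show ?case
    using snoc replacement_iff(2)[of "word_color (edge_graph c) w" x] by auto
qed

lemma LL_c_iff: "w \<in> LL_c c \<longleftrightarrow> valid (Some c) w"
  and word_color_end_state: "w \<in> LL_c c \<Longrightarrow> end_state (Some c) w = Some (word_color (edge_graph c) w)"
  using LL_c_color by auto

section \<open>Infinite words with a given initial state\<close>

definition Words :: "color option \<Rightarrow> iword set" where
  "Words s = {\<alpha>. \<forall>n. valid s (prefix n \<alpha>)}"

lemma OM_Words: "OM = Words None"
proof -
  have "valid None (prefix n \<alpha>)" if "\<forall>n>0. valid None (prefix n \<alpha>)" for \<alpha> n
    using that by (cases n) auto
  then show ?thesis by (auto simp: Omega_def Words_def LL_iff)
qed

lemma OM_c_Words: "OM_c c = Words (Some c)"
proof -
  have "valid (Some c) (prefix n \<alpha>)" if "\<forall>n>0. valid (Some c) (prefix n \<alpha>)" for \<alpha> n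
    using that by (cases n) auto
  then show ?thesis by (auto simp: Omega_def Words_def LL_c_iff)
qed

lemma valid_take: "valid s w \<Longrightarrow> valid s (take n w)"
  by (metis append_take_drop_id valid_append)

lemma Words_conc [simp]: "w \<frown> \<alpha> \<in> Words s \<longleftrightarrow> valid s w \<and> \<alpha> \<in> Words (end_state s w)"
proof
  assume a: "w \<frown> \<alpha> \<in> Words s"
  then have "valid s (prefix (length w + n) (w \<frown> \<alpha>))" for n by (simp only: Words_def mem_Collect_eq)
  then have "valid s (w @ prefix n \<alpha>)" for n by (metis prefix_conc_snd le_add1 add_diff_cancel_left')
  then show "valid s w \<and> \<alpha> \<in> Words (end_state s w)" by (auto simp: Words_def)
next
  assume a: "valid s w \<and> \<alpha> \<in> Words (end_state s w)"
  have "valid s (prefix n (w \<frown> \<alpha>))" for n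
    using a by (cases "n \<le> length w") (auto simp: Words_def valid_take)
  then show "w \<frown> \<alpha> \<in> Words s" by (simp add: Words_def)
qed

lemma Words_build [simp]: "x ## \<alpha> \<in> Words s \<longleftrightarrow> allowed s x \<and> \<alpha> \<in> Words (Some (lcol x))"
  using Words_conc[of "[x]" \<alpha> s] by simp

lemma Words_split:
  assumes "\<alpha> \<in> Words s" obtains w \<beta> where "\<alpha> = w \<frown> \<beta>" "length w = n" "valid s w" "\<beta> \<in> Words (end_state s w)"
  by (metis assms word_split Words_conc)

lemma Words_cases:
  assumes "\<alpha> \<in> Words s" obtains x \<beta> where "\<alpha> = x ## \<beta>" "allowed s x" "\<beta> \<in> Words (Some (lcol x))"
  by (metis assms build_split Words_build)

lemma LL_conc_OM: "e \<in> LL \<Longrightarrow> e \<frown> \<alpha> \<in> Words None \<longleftrightarrow> \<alpha> \<in> Words (Some (color_of e))"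
  by (simp add: LL_iff color_of_end_state)

text \<open>Two cells of infinite words with a common element are nested. Most arguments on the
  position of cells reduce to this.\<close>

lemma conc_comparable:
  assumes "u \<frown> \<alpha> = v \<frown> \<beta>" "length u \<le> length v" obtains t where "v = u @ t" "\<alpha> = t \<frown> \<beta>"
proof -
  have "u = take (length u) v"
    using assms by (metis prefix_conc_fst prefix_conc_length)
  then have v: "v = u @ drop (length u) v" by (metis append_take_drop_id)
  then have "u \<frown> \<alpha> = u \<frown> drop (length u) v \<frown> \<beta>" using assms(1) by (metis conc_conc)
  then show ?thesis using that v by (metis same_concat_eq)
qed

text \<open>Inside a blue cell this is the address of the terminal vertex. Every address of a branch
  point ends in this tail.\<close>

definition I3w :: iword where "I3w = (\<lambda>_. I Third)"

lemma I3w_unfold: "I3w = I Third ## I3w"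
proof -
  have "I3w = I3w 0 ## suffix 1 I3w" by (rule build_split)
  moreover have "I3w 0 = I Third" "suffix 1 I3w = I3w" by (simp_all add: I3w_def suffix_def)
  ultimately show ?thesis by metis
qed

text \<open>The address, inside a cell, of the initial vertex of its edge.\<close>

definition initial_address :: "color \<Rightarrow> iword" where
  "initial_address c = (case c of Blue \<Rightarrow> I First | Red \<Rightarrow> E First) ## I3w"

lemma I3w_Words [simp]: "I3w \<in> Words (Some Blue)"
proof -
  have "valid (Some Blue) (replicate n (I Third))" for n by (induction n) auto
  moreover have "prefix n I3w = replicate n (I Third)" for n
    by (simp add: I3w_def subsequence_def map_replicate_const)
  ultimately show ?thesis by (simp add: Words_def)
qed

lemma initial_address_Words [simp]: "initial_address c \<in> Words (Some c)"
  by (cases c) (simp_all add: initial_address_def)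

lemma Words_nonempty: "\<exists>\<alpha>. \<alpha> \<in> Words s"
  using initial_address_Words by (metis Words_build allowed.simps(1) option.exhaust lcol.simps(1))

lemma finite_idx: "finite (UNIV :: idx set)"
proof -
  have "(UNIV :: idx set) = {First, Second, Third}" using idx.exhaust by auto
  then show ?thesis by (metis finite.emptyI finite.insertI)
qed

lemma finite_valid_length: "finite {w. valid s w \<and> length w = n}"
proof -
  have "(UNIV :: letter set) \<subseteq> range Z \<union> range I \<union> range E" by (metis UnCI letter.exhaust rangeI subsetI)
  then have "finite (UNIV :: letter set)" using finite_idx by (meson finite_Un finite_imageI finite_subset)
  then have "finite {w::fword. set w \<subseteq> UNIV \<and> length w = n}" by (rule finite_lists_length_eq)
  then show ?thesis by (rule rev_finite_subset) auto
qed

section \<open>The gluing relation\<close>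

text \<open>The base graph (\<open>m = 1\<close>) and the single edge (\<open>m = 0\<close>) are
  treated together; \<open>m\<close> is the length of the words naming the unexpanded edges. These
  carry only vertices \<open>BaseV\<close>, are no loops, and two different ones meet exactly in
  their initial vertices. Below them, \<open>snoc\<close> describes the star glued in for
  \<open>w\<close>.\<close>

locale base_case =
  fixes B :: "('v vertex, fword) cgraph" and s :: "color option" and m :: nat
  assumes lang: "w \<in> lang B \<longleftrightarrow> valid s w \<and> m \<le> length w"
    and m1: "m \<le> 1"
    and snoc: "\<lbrakk>w \<in> lang B; allowed (end_state s w) x\<rbrakk> \<Longrightarrow> word_bdry B (w @ [x]) =
      (\<lambda>t. case t of Initial \<Rightarrow> NewV w Centre
        | Terminal \<Rightarrow> (case index x of First \<Rightarrow> word_bdry B w Initial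
            | Second \<Rightarrow> NewV w (Leaf Second) | Third \<Rightarrow> word_bdry B w Terminal))"
    and base_V: "\<lbrakk>w \<in> lang B; length w = m\<rbrakk> \<Longrightarrow> \<exists>v. word_bdry B w t = BaseV v"
    and base_loop: "\<lbrakk>w \<in> lang B; length w = m\<rbrakk> \<Longrightarrow> word_bdry B w Initial \<noteq> word_bdry B w Terminal"
    and base_share: "\<lbrakk>w \<in> lang B; length w = m; w' \<in> lang B; length w' = m; w \<noteq> w'\<rbrakk> \<Longrightarrow>
      word_bdry B w t = word_bdry B w' t' \<longleftrightarrow> t = Initial \<and> t' = Initial"
begin

abbreviation "lb \<equiv> word_bdry B"

lemma lang_appendI: "w \<in> lang B \<Longrightarrow> valid (end_state s w) u \<Longrightarrow> w @ u \<in> lang B"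
  by (auto simp: lang)

lemma lang_induct [consumes 1, case_names base snoc]:
  assumes "w \<in> lang B"
    and "\<And>w. w \<in> lang B \<Longrightarrow> length w = m \<Longrightarrow> P w"
    and "\<And>w x. w \<in> lang B \<Longrightarrow> allowed (end_state s w) x \<Longrightarrow> P w \<Longrightarrow> P (w @ [x])"
  shows "P w"
  using assms(1)
proof (induction w rule: rev_induct)
  case Nil
  then show ?case using assms(2) by (auto simp: lang)
next
  case (snoc x w)
  then show ?case using assms(2,3)[of "w @ [x]"] assms(3)[of w x]
    by (cases "length w < m") (auto simp: lang)
qed

text \<open>A child has vertices named after its parent or inherited from it, so a vertex created by
  expanding \<open>u\<close> is incident only on proper extensions of \<open>u\<close>.\<close>

lemma newV:
  assumes "w \<in> lang B" "lb w t = NewV u z" shows "\<exists>y v. w = u @ y # v"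
  using assms
proof (induction arbitrary: t rule: lang_induct)
  case (base w)
  then show ?case using base_V[of w t] by auto
next
  case (snoc w x)
  have "u = w \<or> (\<exists>t. lb w t = NewV u z)"
    using snoc.prems base_case.snoc[OF base_case_axioms snoc.hyps]
    by (auto split: side.splits idx.splits)
  then show ?case using snoc.IH by fastforce
qed

text \<open>The initial vertex of a child is the new centre, while its terminal vertex is a new leaf
  or a vertex of the parent.\<close>

lemma noloop: "w \<in> lang B \<Longrightarrow> lb w t = lb w t' \<longleftrightarrow> t = t'"
proof -
  have "w \<in> lang B \<Longrightarrow> lb w Initial \<noteq> lb w Terminal"
  proof (induction rule: lang_induct)
    case (base w)
    then show ?case by (rule base_loop)
  next
    case (snoc w x)
    have "lb w t \<noteq> NewV w Centre" for t using newV[OF snoc.hyps(1)] by fastforce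
    then show ?case using base_case.snoc[OF base_case_axioms snoc.hyps]
      by (metis (no_types, lifting) idx.exhaust idx.simps(7,8,9) side.simps(3,4) vertex.inject(2) star_vertex.distinct(1))
  qed
  then show "w \<in> lang B \<Longrightarrow> lb w t = lb w t' \<longleftrightarrow> t = t'" by (metis side.exhaust)
qed

text \<open>Apart from its boundary vertices, a cell contains only vertices whose names begin with
  its word. Hence it can meet cells outside only in the boundary vertices.\<close>

lemma locality:
  assumes "w \<in> lang B" "w @ u \<in> lang B"
  shows "lb (w @ u) t \<in> range (lb w) \<or> (\<exists>u' z. lb (w @ u) t = NewV (w @ u') z)"
  using assms(2)
proof (induction u arbitrary: t rule: rev_induct)
  case Nil
  then show ?case by simp
next
  case (snoc x u)
  have h: "w @ u \<in> lang B" "allowed (end_state s (w @ u)) x"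
    using snoc.prems assms(1) by (auto simp: lang)
  show ?case using snoc.IH[OF h(1)] base_case.snoc[OF base_case_axioms h]
    by (cases t; cases "index x") auto
qed

text \<open>The initial vertex of every child is the new centre. A boundary vertex of
  \<open>w\<close> therefore survives in a single child, the first or the third one, and is the
  terminal vertex there.\<close>

lemma corner_step:
  assumes "w \<in> lang B" "w @ x # u \<in> lang B" "lb w t = lb (w @ x # u) t'"
  shows "index x = (case t of Initial \<Rightarrow> First | Terminal \<Rightarrow> Third) \<and> lb (w @ [x]) Terminal = lb w t"
proof -
  have w: "w @ [x] \<in> lang B" "allowed (end_state s w) x"
    using assms(2) assms(1) by (auto simp: lang)
  have n: "lb w t \<noteq> NewV (w @ v) z" for v z t using newV[OF assms(1)] by fastforce
  have "lb w t \<in> range (lb (w @ [x]))"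
    using locality[OF w(1), of u t'] assms(2,3) n by (metis append_Cons append_Nil append_assoc)
  then obtain t'' where t: "lb w t = lb (w @ [x]) t''" by auto
  have "t'' = Terminal"
    using t n[of t "[]" Centre] snoc[OF assms(1) w(2)] by (cases t'') auto
  then show ?thesis
    using t n[of t "[]"] snoc[OF assms(1) w(2)] noloop[OF assms(1)]
    by (cases "index x"; cases t) auto
qed

end

text \<open>The address, inside a \<open>c\<close>-colored cell, of its boundary vertex
  \<open>t\<close>. The third child of a blue edge is blue and that of a red edge is red, which
  gives the two constant sequences.\<close>

definition corner :: "color \<Rightarrow> side \<Rightarrow> iword" where
  "corner c t = (case t of Initial \<Rightarrow> initial_address c | Terminal \<Rightarrow> (case c of Blue \<Rightarrow> I3w | Red \<Rightarrow> (\<lambda>_. E Third)))"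

lemma corner_unfold:
  "corner Blue Initial = I First ## corner Blue Terminal"
  "corner Red Initial = E First ## corner Blue Terminal"
  "corner Blue Terminal = I Third ## corner Blue Terminal"
  "corner Red Terminal = E Third ## corner Red Terminal"
proof -
  have "(\<lambda>_::nat. E Third) = (\<lambda>_. E Third) 0 ## suffix 1 (\<lambda>_. E Third)" by (rule build_split)
  then show "corner Red Terminal = E Third ## corner Red Terminal" by (simp add: corner_def suffix_def)
qed (simp_all add: corner_def initial_address_def I3w_unfold[symmetric])

text \<open>After one letter every corner turns into a \<open>Terminal\<close> corner, because a
  boundary vertex is terminal in the child containing it. This common form carries all inductions
  along corners.\<close>

lemma corner_cases:
  assumes "\<And>x. corner c t = x ## corner (lcol x) Terminal \<Longrightarrow> allowed (Some c) x \<Longrightarrow>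
    index x = (case t of Initial \<Rightarrow> First | Terminal \<Rightarrow> Third) \<Longrightarrow> thesis"
  shows thesis
proof (cases c; cases t)
  show thesis if "c = Blue" "t = Initial"
    by (rule assms[of "I First"]) (simp_all add: that corner_unfold(1))
  show thesis if "c = Blue" "t = Terminal"
    by (rule assms[of "I Third"]) (simp_all add: that corner_unfold(3)[symmetric])
  show thesis if "c = Red" "t = Initial"
    by (rule assms[of "E First"]) (simp_all add: that corner_unfold(2))
  show thesis if "c = Red" "t = Terminal"
    by (rule assms[of "E Third"]) (simp_all add: that corner_unfold(4)[symmetric])
qed

lemma prefix_build: "prefix (Suc n) (x ## \<alpha>) = x # prefix n \<alpha>"
  using prefix_conc_snd[of "[x]" "Suc n" \<alpha>] by simp

lemma corner_Words [simp]: "corner c t \<in> Words (Some c)"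
proof -
  have "valid (Some c) (prefix n (corner c t))" for n
  proof (induction n arbitrary: c t)
    case (Suc n)
    obtain x where "corner c t = x ## corner (lcol x) Terminal" "allowed (Some c) x" using corner_cases .
    then show ?case using Suc[of "lcol x" Terminal] by (simp only: prefix_build valid.simps simp_thms)
  qed simp
  then show ?thesis by (simp add: Words_def)
qed

context base_case
begin

text \<open>\<open>corner_step\<close> forces each letter in turn, so the words below
  \<open>w\<close> incident on a boundary vertex form a single branch.
  \<open>corner_incident\<close> is the converse.\<close>

lemma corner_prefix:
  assumes "w \<in> lang B" "w @ u \<in> lang B" "end_state s w = Some c" "lb w t = lb (w @ u) t'"
  shows "u = prefix (length u) (corner c t)"
  using assms
proof (induction u arbitrary: w c t)
  case (Cons x u)
  have c: "index x = (case t of Initial \<Rightarrow> First | Terminal \<Rightarrow> Third)" "lb (w @ [x]) Terminal = lb w t"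
    using corner_step[OF Cons.prems(1,2,4)] by auto
  have w: "w @ [x] \<in> lang B" "allowed (end_state s w) x"
    using Cons.prems(1,2) by (auto simp: lang)
  obtain y where y: "corner c t = y ## corner (lcol y) Terminal" "allowed (Some c) y"
    "index y = (case t of Initial \<Rightarrow> First | Terminal \<Rightarrow> Third)" using corner_cases .
  have "y = x" using allowed_index_inj y c w Cons.prems(3) by metis
  moreover have "u = prefix (length u) (corner (lcol x) Terminal)"
    by (rule Cons.IH[OF w(1)]) (use Cons.prems c in auto)
  ultimately show ?case using y(1) by (simp only: list.size prefix_build add_0_right add_Suc_right)
qed simp

lemma corner_incident:
  assumes "w \<in> lang B" "end_state s w = Some c"
  shows "\<exists>t'. lb (w @ prefix n (corner c t)) t' = lb w t"
  using assms
proof (induction n arbitrary: w c t)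
  case (Suc n)
  obtain y where y: "corner c t = y ## corner (lcol y) Terminal" "allowed (Some c) y"
    "index y = (case t of Initial \<Rightarrow> First | Terminal \<Rightarrow> Third)" using corner_cases .
  have w: "w @ [y] \<in> lang B" "end_state s (w @ [y]) = Some (lcol y)" using Suc.prems y(2) by (auto simp: lang)
  have "lb (w @ [y]) Terminal = lb w t"
    using y(2,3) Suc.prems snoc[of w y] by (cases t) auto
  then show ?case using Suc.IH[OF w, of Terminal] by (simp add: y(1) prefix_build)
qed auto

text \<open>By \<open>locality\<close> a common vertex is a boundary vertex of both children or
  created inside one of them, and the latter is impossible. The terminal vertices of different
  children are distinct, so only the common initial vertex remains.\<close>

lemma share:
  assumes px: "p @ [x] \<in> lang B" "p @ [y] \<in> lang B" "x \<noteq> y"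
    and u: "(p @ [x]) @ u \<in> lang B" "(p @ [y]) @ u' \<in> lang B"
    and v: "lb ((p @ [x]) @ u) t = v" "lb ((p @ [y]) @ u') t' = v"
  shows "v = lb (p @ [x]) Initial" "v = lb (p @ [y]) Initial"
proof -
  have one: "v \<in> range (lb (p @ [x]))"
    if h: "p @ [x] \<in> lang B" "p @ [y] \<in> lang B" "x \<noteq> y"
       "v \<in> range (lb (p @ [x])) \<or> (\<exists>u' z. v = NewV ((p @ [x]) @ u') z)"
       "v \<in> range (lb (p @ [y])) \<or> (\<exists>u' z. v = NewV ((p @ [y]) @ u') z)" for x y
    using h(4)
  proof
    assume "\<exists>u' z. v = NewV ((p @ [x]) @ u') z"
    \<comment> \<open>A vertex created inside the cell of \<open>p @ [x]\<close> would make
      \<open>p @ [y]\<close> a proper extension of \<open>p @ [x]\<close>, or the two letters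
      equal.\<close>
    then obtain u1 z1 where v: "v = NewV ((p @ [x]) @ u1) z1" by blast
    from h(5) show ?thesis
    proof
      assume "v \<in> range (lb (p @ [y]))"
      then obtain b w where "p @ [y] = ((p @ [x]) @ u1) @ b # w" using newV[OF h(2)] v by (metis rangeE)
      from arg_cong[OF this, of length] show ?thesis by simp
    qed (use v h(3) in auto)
  qed
  have "v \<in> range (lb (p @ [x]))" "v \<in> range (lb (p @ [y]))"
    using one[OF px locality[OF px(1) u(1), of t, unfolded v(1)] locality[OF px(2) u(2), of t', unfolded v(2)]]
      one[OF px(2,1) px(3)[symmetric] locality[OF px(2) u(2), of t', unfolded v(2)]
        locality[OF px(1) u(1), of t, unfolded v(1)]] by auto
  then obtain a b where ab: "v = lb (p @ [x]) a" "v = lb (p @ [y]) b" by (metis rangeE)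
  have "a = Initial \<and> b = Initial"
  proof (cases "m \<le> length p")
    case True
    then have p: "p \<in> lang B" "allowed (end_state s p) x" "allowed (end_state s p) y"
      using px by (auto simp: lang)
    have n: "lb p t \<noteq> NewV p z" for z t using newV[OF p(1)] by fastforce
    have "index x \<noteq> index y" using allowed_index_inj p px by blast
    then show ?thesis
      using ab snoc[OF p(1,2)] snoc[OF p(1,3)] n noloop[OF p(1)] n[symmetric]
      by (cases a; cases b; cases "index x"; cases "index y") auto
  next
    case False
    then have "length (p @ [x]) = m" "length (p @ [y]) = m" using m1 by auto
    then show ?thesis using base_share[of "p @ [x]" "p @ [y]" a b] px ab by auto
  qed
  then show "v = lb (p @ [x]) Initial" "v = lb (p @ [y]) Initial" using ab by auto
qed

lemma initial_share:
  assumes "p @ [x] \<in> lang B" "p @ [y] \<in> lang B"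
  shows "lb (p @ [x]) Initial = lb (p @ [y]) Initial"
proof (cases "m \<le> length p")
  case True
  then show ?thesis using assms snoc[of p x] snoc[of p y] by (auto simp: lang)
next
  case False
  then have "length (p @ [x]) = m" "length (p @ [y]) = m" using m1 by auto
  then show ?thesis using base_share[of "p @ [x]" "p @ [y]" Initial Initial] assms by (cases "x = y") auto
qed

text \<open>A sequence is determined by arbitrarily late prefixes, so incidence from some
  \<open>k\<close> on suffices: letter \<open>n\<close> is read off from the prefix of length
  \<open>n + k + 1\<close>.\<close>

lemma corner_all:
  assumes w: "w \<in> lang B" "end_state s w = Some c" and \<alpha>: "\<alpha> \<in> Words (Some c)"
    and inc: "\<And>n. n \<ge> k \<Longrightarrow> \<exists>t'. lb (w @ prefix n \<alpha>) t' = lb w t"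
  shows "\<alpha> = corner c t"
proof
  fix n
  have "w @ prefix (n + k + 1) \<alpha> \<in> lang B"
    by (rule lang_appendI[OF w(1)]) (use \<alpha> w in \<open>simp add: Words_def del: subseq_to_Suc\<close>)
  then have "prefix (n + k + 1) \<alpha> = prefix (n + k + 1) (corner c t)"
    using corner_prefix[OF w(1) _ w(2)] inc[of "n + k + 1"] by (metis subsequence_length le_add2 diff_zero add.assoc add.commute)
  then show "\<alpha> n = corner c t n"
    by (metis add_lessD1 less_add_one subsequence_nth add_0 diff_zero add.assoc less_add_Suc1 Suc_eq_plus1)
qed

end

lemma first_difference:
  assumes "\<alpha> \<noteq> (\<beta> :: 'a word)"
  obtains p x y \<alpha>' \<beta>' where "\<alpha> = p \<frown> x ## \<alpha>'" "\<beta> = p \<frown> y ## \<beta>'" "x \<noteq> y"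
proof -
  define k where "k = (LEAST k. \<alpha> k \<noteq> \<beta> k)"
  have k: "\<alpha> k \<noteq> \<beta> k" unfolding k_def by (rule LeastI_ex) (use assms in auto)
  have "\<alpha> j = \<beta> j" if "j < k" for j using not_less_Least that unfolding k_def by blast
  then have "prefix k \<alpha> = prefix k \<beta>" by (simp add: subsequence_def)
  moreover have "\<alpha> = prefix k \<alpha> \<frown> \<alpha> k ## suffix (Suc k) \<alpha>" "\<beta> = prefix k \<beta> \<frown> \<beta> k ## suffix (Suc k) \<beta>"
    using prefix_suffix by auto
  ultimately show ?thesis using that k by metis
qed

lemma first_difference_list:
  assumes "\<And>t. u \<noteq> v @ t" "\<And>t. v \<noteq> u @ t"
  obtains p x y u' v' where "u = p @ x # u'" "v = p @ y # v'" "x \<noteq> y"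
  using assms
proof (induction u arbitrary: v thesis)
  case Nil
  then show ?case by auto
next
  case (Cons a u)
  obtain b w where v: "v = b # w" using Cons.prems(2)[of "a # u"] by (cases v) auto
  show ?case
  proof (cases "a = b")
    case True
    show ?thesis
    proof (rule Cons.IH[of w])
      show "thesis" if "u = p @ x # u'" "w = p @ y # v'" "x \<noteq> y" for p x u' y v'
        using Cons.prems(1)[of "b # p"] that v True by auto
    qed (use Cons.prems v True in auto)
  next
    case False
    then show ?thesis using Cons.prems(1)[of "[]"] v by auto
  qed
qed

text \<open>Two addresses of the same vertex \<open>NewV e Centre\<close> (or, for \<open>e = []\<close>, of the centre of the base
  graph) begin with \<open>e\<close>.\<close>

definition same_vertex :: "iword \<Rightarrow> iword \<Rightarrow> bool" where
  "same_vertex \<alpha> \<beta> \<longleftrightarrow> (\<exists>e x y. \<alpha> = e \<frown> x ## initial_address (lcol x) \<and> \<beta> = e \<frown> y ## initial_address (lcol y))"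

context base_case
begin

lemma Omega_Words: "Omega B = Words s"
proof -
  have "valid s (prefix n \<alpha>)" if "\<forall>n>0. valid s (prefix n \<alpha>)" for \<alpha> n
    using that by (cases n) auto
  then show ?thesis using m1 by (auto simp: Omega_def Words_def lang)
qed

text \<open>From the first different letter on, \<open>share\<close> leaves the common initial
  vertex of the two children as the only possible shared vertex. All prefixes are incident on it, so
  both tails are its addresses.\<close>

lemma gluing_first_difference:
  assumes g: "(p \<frown> x ## \<alpha>, p \<frown> y ## \<beta>) \<in> gluing B" and xy: "x \<noteq> y"
    and Words: "p \<frown> x ## \<alpha> \<in> Words s" "p \<frown> y ## \<beta> \<in> Words s"
  shows "\<alpha> = initial_address (lcol x)" "\<beta> = initial_address (lcol y)"
proof -
  have px: "p @ [x] \<in> lang B" "p @ [y] \<in> lang B"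
    using Words m1 by (auto simp: lang)
  have "\<exists>t. lb ((p @ [x]) @ prefix n \<alpha>) t = lb (p @ [x]) Initial"
      "\<exists>t. lb ((p @ [y]) @ prefix n \<beta>) t = lb (p @ [y]) Initial" for n
  proof -
    let ?k = "Suc (length p + n)"
    have pre: "prefix ?k (p \<frown> x ## \<alpha>) = (p @ [x]) @ prefix n \<alpha>"
      "prefix ?k (p \<frown> y ## \<beta>) = (p @ [y]) @ prefix n \<beta>"
      using prefix_conc_snd[of "p @ [x]" ?k \<alpha>] prefix_conc_snd[of "p @ [y]" ?k \<beta>] by auto
    have L: "(p @ [x]) @ prefix n \<alpha> \<in> lang B" "(p @ [y]) @ prefix n \<beta> \<in> lang B"
    proof -
      have "\<alpha> \<in> Words (Some (lcol x))" "\<beta> \<in> Words (Some (lcol y))" using Words by auto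
      then have "valid (Some (lcol x)) (prefix n \<alpha>)" "valid (Some (lcol y)) (prefix n \<beta>)" by (auto simp: Words_def)
      then show "(p @ [x]) @ prefix n \<alpha> \<in> lang B" "(p @ [y]) @ prefix n \<beta> \<in> lang B"
        using lang_appendI[OF px(1)] lang_appendI[OF px(2)] by (simp_all only: end_state_append end_state_simps)
    qed
    have "\<exists>v. incident B (prefix ?k (p \<frown> x ## \<alpha>)) v \<and> incident B (prefix ?k (p \<frown> y ## \<beta>)) v"
      using g unfolding gluing_def by blast
    then obtain t t' where "lb ((p @ [x]) @ prefix n \<alpha>) t = lb ((p @ [y]) @ prefix n \<beta>) t'"
      unfolding pre incident_def by auto
    with share[OF px xy L refl] show
      "\<exists>t. lb ((p @ [x]) @ prefix n \<alpha>) t = lb (p @ [x]) Initial"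
      "\<exists>t. lb ((p @ [y]) @ prefix n \<beta>) t = lb (p @ [y]) Initial" by metis+
  qed
  then show "\<alpha> = initial_address (lcol x)" "\<beta> = initial_address (lcol y)"
    using corner_all[OF px(1), of "lcol x" \<alpha> 0 Initial] corner_all[OF px(2), of "lcol y" \<beta> 0 Initial] Words
    by (simp_all add: corner_def)
qed

lemma gluing_corner:
  assumes "e \<frown> x ## initial_address (lcol x) \<in> Words s" "e \<frown> y ## initial_address (lcol y) \<in> Words s"
  shows "(e \<frown> x ## initial_address (lcol x), e \<frown> y ## initial_address (lcol y)) \<in> gluing B"
proof -
  have px: "e @ [x] \<in> lang B" "e @ [y] \<in> lang B" using assms m1 by (auto simp: lang)
  have "\<exists>v. incident B (prefix n (e \<frown> x ## initial_address (lcol x))) v \<and> incident B (prefix n (e \<frown> y ## initial_address (lcol y))) v" for n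
  proof (cases "n \<le> length e")
    case True
    then show ?thesis by (auto simp: incident_def)
  next
    case False
    then obtain k where n: "n = Suc (length e + k)" by (metis add_Suc_right less_imp_Suc_add not_le)
    have pre: "prefix n (e \<frown> x ## \<alpha>) = (e @ [x]) @ prefix k \<alpha>" for x \<alpha>
      using prefix_conc_snd[of "e @ [x]" n \<alpha>] n by auto
    show ?thesis
      using corner_incident[OF px(1), where c = "lcol x" and n = k and t = Initial]
        corner_incident[OF px(2), where c = "lcol y" and n = k and t = Initial]
        initial_share[OF px] unfolding pre by (auto simp: incident_def corner_def) (metis rangeI)
  qed
  then show ?thesis using assms by (simp add: gluing_def Omega_Words)
qed

lemma gluing_iff: "(\<alpha>, \<beta>) \<in> gluing B \<longleftrightarrow> \<alpha> \<in> Words s \<and> \<beta> \<in> Words s \<and> (\<alpha> = \<beta> \<or> same_vertex \<alpha> \<beta>)"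
proof -
  show ?thesis
  proof
    assume g: "(\<alpha>, \<beta>) \<in> gluing B"
    then have O: "\<alpha> \<in> Words s" "\<beta> \<in> Words s" by (auto simp: gluing_def Omega_Words)
    moreover have "same_vertex \<alpha> \<beta>" if "\<alpha> \<noteq> \<beta>"
      using first_difference[OF that] gluing_first_difference g O unfolding same_vertex_def by metis
    ultimately show "\<alpha> \<in> Words s \<and> \<beta> \<in> Words s \<and> (\<alpha> = \<beta> \<or> same_vertex \<alpha> \<beta>)" by blast
  next
    assume a: "\<alpha> \<in> Words s \<and> \<beta> \<in> Words s \<and> (\<alpha> = \<beta> \<or> same_vertex \<alpha> \<beta>)"
    have "(\<alpha>, \<alpha>) \<in> gluing B" if "\<alpha> \<in> Words s" for \<alpha>
      using that by (auto simp: gluing_def Omega_Words incident_def)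
    then show "(\<alpha>, \<beta>) \<in> gluing B" using a gluing_corner by (auto simp: same_vertex_def)
  qed
qed

text \<open>This translates equality of boundary vertices of incomparable edges into gluing of their
  corner addresses. It is what later turns a gluing-preserving map into a bijection of the vertices
  of two expansions.\<close>

lemma share_iff:
  assumes e: "e \<in> lang B" "e' \<in> lang B" "\<And>u. e \<noteq> e' @ u" "\<And>u. e' \<noteq> e @ u"
    and c: "end_state s e = Some c" "end_state s e' = Some c'"
  shows "lb e t = lb e' t' \<longleftrightarrow> (e \<frown> corner c t, e' \<frown> corner c' t') \<in> gluing B"
proof -
  obtain p x y u v where p: "e = p @ x # u" "e' = p @ y # v" "x \<noteq> y"
    using first_difference_list e(3,4) by metis
  then have p': "e = (p @ [x]) @ u" "e' = (p @ [y]) @ v" by auto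
  have px: "p @ [x] \<in> lang B" "p @ [y] \<in> lang B" using e p m1 by (auto simp: lang)
  have Words: "e \<frown> corner c t \<in> Words s" "e' \<frown> corner c' t' \<in> Words s" using c e by (auto simp: lang)
  have one: "lb e t = lb (p @ [x]) Initial \<longleftrightarrow> u \<frown> corner c t = initial_address (lcol x)"
    if "e = (p @ [x]) @ u" "p @ [x] \<in> lang B" "e \<in> lang B" "end_state s e = Some c" for e x u c t
  proof
    assume a: "lb e t = lb (p @ [x]) Initial"
    have "u \<frown> corner c t = corner (lcol x) Initial"
    proof (rule corner_all[OF that(2), of _ _ "length u"])
      show "end_state s (p @ [x]) = Some (lcol x)" by simp
      show "u \<frown> corner c t \<in> Words (Some (lcol x))" using that by (auto simp: lang)
      show "\<exists>t'. lb ((p @ [x]) @ prefix n (u \<frown> corner c t)) t' = lb (p @ [x]) Initial" if "length u \<le> n" for n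
        using corner_incident[OF \<open>e \<in> lang B\<close> \<open>end_state s e = Some c\<close>, where n = "n - length u" and t = t] a that
        by (simp add: \<open>e = (p @ [x]) @ u\<close>)
    qed
    then show "u \<frown> corner c t = initial_address (lcol x)" by (simp add: corner_def)
  next
    assume a: "u \<frown> corner c t = initial_address (lcol x)"
    have k: "initial_address (lcol x) = corner (lcol x) Initial" by (simp add: corner_def)
    have "prefix (length u) (initial_address (lcol x)) = u" "prefix (Suc (length u)) (initial_address (lcol x)) = u @ prefix 1 (corner c t)"
      unfolding a[symmetric] by auto
    \<comment> \<open>The edge \<open>e\<close> meets the vertex at some side \<open>t0\<close>. One
      further letter of the address shows \<open>t0 = t\<close>, since the corners of the two sides
      begin with letters of different index.\<close>
    then have "\<exists>t'. lb e t' = lb (p @ [x]) Initial"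
      "\<exists>t'. lb (e @ prefix 1 (corner c t)) t' = lb (p @ [x]) Initial"
      using corner_incident[OF that(2), where c = "lcol x" and n = "length u" and t = Initial]
        corner_incident[OF that(2), where c = "lcol x" and n = "Suc (length u)" and t = Initial] that(1) k by auto
    then obtain t0 t1 where t: "lb e t0 = lb (p @ [x]) Initial"
      "lb (e @ prefix 1 (corner c t)) t1 = lb e t0" by auto
    have "e @ prefix 1 (corner c t) \<in> lang B"
      by (rule lang_appendI[OF that(3)]) (use corner_Words[of c t] that(4) in \<open>simp only: Words_def, blast\<close>)
    then have "prefix 1 (corner c t) = prefix 1 (corner c t0)"
      using corner_prefix[OF that(3) _ that(4), of "prefix 1 (corner c t)" t0 t1] t(2) by simp
    then have "t = t0"
      using corner_cases[of c t] corner_cases[of c t0]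
      by (cases t; cases t0) (metis One_nat_def idx.distinct list.inject prefix_build side.simps(3,4))+
    then show "lb e t = lb (p @ [x]) Initial" using t by simp
  qed
  show ?thesis
  proof
    assume a: "lb e t = lb e' t'"
    have "lb e t = lb (p @ [x]) Initial" "lb e t = lb (p @ [y]) Initial"
      using share[OF px p(3), of u v t "lb e t" t'] e p' a by auto
    then have "u \<frown> corner c t = initial_address (lcol x)" "v \<frown> corner c' t' = initial_address (lcol y)"
      using one[OF p'(1) px(1) e(1) c(1)] one[OF p'(2) px(2) e(2) c(2)] a by auto
    then have "e \<frown> corner c t = p \<frown> x ## initial_address (lcol x)" "e' \<frown> corner c' t' = p \<frown> y ## initial_address (lcol y)"
      by (simp_all add: p flip: conc_conc)
    then show "(e \<frown> corner c t, e' \<frown> corner c' t') \<in> gluing B" using Words gluing_corner by metis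
  next
    assume g: "(e \<frown> corner c t, e' \<frown> corner c' t') \<in> gluing B"
    have eq: "e \<frown> corner c t = p \<frown> x ## u \<frown> corner c t" "e' \<frown> corner c' t' = p \<frown> y ## v \<frown> corner c' t'"
      by (simp_all add: p flip: conc_conc)
    have "u \<frown> corner c t = initial_address (lcol x)" "v \<frown> corner c' t' = initial_address (lcol y)"
      using gluing_first_difference[of p x _ y, OF _ p(3)] g Words unfolding eq by auto
    then show "lb e t = lb e' t'"
      using one[OF p'(1) px(1) e(1) c(1)] one[OF p'(2) px(2) e(2) c(2)] initial_share[OF px] by metis
  qed
qed

end

section \<open>The base graph and the single edge as instances\<close>

lemma word_bdry_snoc:
  fixes B :: "('v vertex, fword) cgraph"
  assumes len: "\<And>w. w \<in> edges B \<Longrightarrow> length w = m" and "m \<le> length w" "w @ [x] \<in> lang B"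
  shows "word_bdry B (w @ [x]) =
      (\<lambda>t. case t of Initial \<Rightarrow> NewV w Centre
        | Terminal \<Rightarrow> (case index x of First \<Rightarrow> word_bdry B w Initial
            | Second \<Rightarrow> NewV w (Leaf Second) | Third \<Rightarrow> word_bdry B w Terminal))"
proof -
  have bd: "word_bdry B u = bdry G u" "word_color B u = ecolor G u" if "G \<in> expansions B" "u \<in> edges G" for G u
    unfolding word_bdry_def word_color_def
    by (rule the_equality; use that expansions_consistent[OF len] in blast)+
  have w: "w \<in> lang B" "allowed (Some (word_color B w)) x"
    using lang_snoc(1)[OF len assms(2)] assms(3) by (auto simp: replacement_iff)
  then obtain G where G: "G \<in> expansions B" "w \<in> edges G" by (auto simp: lang_def)
  have e: "w @ [x] \<in> edges (expand G w)" using w bd(2)[OF G] by (auto simp: edges_expand)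
  show ?thesis
  proof (cases "w @ [x] \<in> edges G")
    case True
    have "w @ [x] \<noteq> w" by simp
    then have l: "w @ [x] \<in> edges G - {w}" using True by blast
    \<comment> \<open>This case is void: an edge and a proper extension of it never lie in the same
      expansion.\<close>
    have "\<not> (G \<in> expansions B \<and> w \<in> edges G \<and> w @ u \<in> edges G \<and> u \<noteq> [])" for G u
    proof
      assume a: "G \<in> expansions B \<and> w \<in> edges G \<and> w @ u \<in> edges G \<and> u \<noteq> []"
      have "G \<in> expansions B \<Longrightarrow> w \<in> edges G \<Longrightarrow> w @ u \<in> edges G \<Longrightarrow> u \<noteq> [] \<Longrightarrow> False" for w u
      proof (induction arbitrary: w u rule: expansions.induct)
        case base
        then show ?case using len[of w] len[of "w @ u"] by simp
      next
        case (step G v)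
        then show ?case
          by (auto simp: edges_expand append_eq_append_conv2 append_eq_Cons_conv Cons_eq_append_conv) blast+
      qed
      with a show False by blast
    qed
    then show ?thesis using G True by blast
  next
    case False
    show ?thesis unfolding bd(1)[OF expansions.step[OF G] e] bd(1)[OF G]
      using False by (auto simp: expand_def Let_def replacement_iff glue_def star_bdry_def rep_bdry_def fun_eq_iff
          split: side.splits idx.splits)
  qed
qed

interpretation base: base_case base_graph None 1
proof
  have m: "w \<in> edges base_graph" if "w \<in> LL" "length w = 1" for w
    using that length_base_LL by (auto simp: lang_def base_graph_def)
  have bd: "lam w t = BaseV (star_bdry (index (hd w)) t)" if "w \<in> LL" "length w = 1" for w t
    using word_color_bdry_base(2)[OF expansions.base m[OF that]] by (simp add: base_graph_def)
  have Z: "\<exists>i. w = [Z i]" if "w \<in> LL" "length w = 1" for w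
    using m[OF that] by (auto simp: base_graph_def)
  show L: "w \<in> LL \<longleftrightarrow> valid None w \<and> 1 \<le> length w" for w by (cases w) (auto simp: LL_iff)
  show "lam (w @ [x]) = (\<lambda>t. case t of Initial \<Rightarrow> NewV w Centre
        | Terminal \<Rightarrow> (case index x of First \<Rightarrow> lam w Initial
            | Second \<Rightarrow> NewV w (Leaf Second) | Third \<Rightarrow> lam w Terminal))"
    if "w \<in> LL" "allowed (end_state None w) x" for w x
    by (rule word_bdry_snoc[OF length_base_graph]) (use that in \<open>auto simp: L\<close>)
  show "\<exists>v. lam w t = BaseV v" if "w \<in> LL" "length w = 1" for w t using bd[OF that] by simp
  show "lam w Initial \<noteq> lam w Terminal" if "w \<in> LL" "length w = 1" for w
    using bd[OF that] by (simp add: star_bdry_def)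
  show "lam w t = lam w' t' \<longleftrightarrow> t = Initial \<and> t' = Initial"
    if "w \<in> LL" "length w = 1" "w' \<in> LL" "length w' = 1" "w \<noteq> w'" for w w' t t'
    using bd[OF that(1,2)] bd[OF that(3,4)] Z[OF that(1,2)] Z[OF that(3,4)] that(5)
    by (cases t; cases t') (auto simp: star_bdry_def)
qed simp

interpretation edge: base_case "edge_graph c" "Some c" 0 for c
proof
  have bd: "word_bdry (edge_graph c) [] t = BaseV t" for t
    using word_color_bdry_edge(2)[OF expansions.base, of "[]" c] by (simp add: edge_graph_def)
  show L: "w \<in> LL_c c \<longleftrightarrow> valid (Some c) w \<and> 0 \<le> length w" for w by (simp add: LL_c_iff)
  show "word_bdry (edge_graph c) (w @ [x]) = (\<lambda>t. case t of Initial \<Rightarrow> NewV w Centre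
        | Terminal \<Rightarrow> (case index x of First \<Rightarrow> word_bdry (edge_graph c) w Initial
            | Second \<Rightarrow> NewV w (Leaf Second) | Third \<Rightarrow> word_bdry (edge_graph c) w Terminal))"
    if "w \<in> LL_c c" "allowed (end_state (Some c) w) x" for w x
    by (rule word_bdry_snoc[OF length_edge_graph]) (use that in \<open>auto simp: L\<close>)
  show "\<exists>v. word_bdry (edge_graph c) w t = BaseV v" if "w \<in> LL_c c" "length w = 0" for w t
    using bd that by simp
  show "word_bdry (edge_graph c) w Initial \<noteq> word_bdry (edge_graph c) w Terminal"
    if "w \<in> LL_c c" "length w = 0" for w using bd that by simp
qed auto

section \<open>The self-similar tuple\<close>

lemma openin_cylinder: "openin (Omega_top B) {\<beta> \<in> Omega B. prefix m \<beta> = u}"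
proof (cases "length u = m")
  case True
  let ?C = "\<Pi>\<^sub>E i\<in>UNIV. (if i < m then {u ! i} else (UNIV::letter set))"
  have o: "openin (product_topology (\<lambda>_. discrete_topology (UNIV::letter set)) (UNIV::nat set)) ?C"
  proof (rule product_topology_basis)
    show "finite {i. (if i < m then {u ! i} else UNIV) \<noteq> topspace (discrete_topology (UNIV :: letter set))}"
      by (rule finite_subset[of _ "{..<m}"]) auto
  qed simp
  have "prefix m \<beta> = u \<longleftrightarrow> \<beta> \<in> ?C" for \<beta>
    using True by (auto simp: list_eq_iff_nth_eq PiE_iff split: if_splits)
  then have eq: "{\<beta> \<in> Omega B. prefix m \<beta> = u} = Omega B \<inter> ?C" by blast
  show ?thesis unfolding Omega_top_def eq using o by (rule openin_subtopology_Int2)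
next
  case False
  then have e: "{\<beta> \<in> Omega B. prefix m \<beta> = u} = {}" by auto
  show ?thesis unfolding e by (rule openin_empty)
qed

lemma openin_Omega_top:
  assumes "U \<subseteq> Omega B"
    and "\<And>\<alpha>. \<alpha> \<in> U \<Longrightarrow> \<exists>m. \<forall>\<beta>\<in>Omega B. prefix m \<beta> = prefix m \<alpha> \<longrightarrow> \<beta> \<in> U"
  shows "openin (Omega_top B) U"
proof (subst openin_subopen, intro ballI)
  fix \<alpha> assume a: "\<alpha> \<in> U"
  then obtain m where m: "\<forall>\<beta>\<in>Omega B. prefix m \<beta> = prefix m \<alpha> \<longrightarrow> \<beta> \<in> U" using assms(2) by blast
  have "openin (Omega_top B) {\<beta> \<in> Omega B. prefix m \<beta> = prefix m \<alpha>}" by (rule openin_cylinder)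
  moreover have "\<alpha> \<in> {\<beta> \<in> Omega B. prefix m \<beta> = prefix m \<alpha>}" using a assms(1) by blast
  moreover have "{\<beta> \<in> Omega B. prefix m \<beta> = prefix m \<alpha>} \<subseteq> U" using m by blast
  ultimately show "\<exists>T. openin (Omega_top B) T \<and> \<alpha> \<in> T \<and> T \<subseteq> U" by blast
qed

lemma continuous_map_Omega_top:
  assumes img: "\<And>\<alpha>. \<alpha> \<in> Omega B \<Longrightarrow> \<Phi> \<alpha> \<in> Omega B'"
    and acts_on_cell: "\<And>n. \<exists>m. \<forall>\<alpha>\<in>Omega B. \<forall>\<beta>\<in>Omega B. prefix m \<alpha> = prefix m \<beta> \<longrightarrow> \<Phi> \<alpha> n = \<Phi> \<beta> n"
  shows "continuous_map (Omega_top B) (Omega_top B') \<Phi>"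
proof -
  have "continuous_map (Omega_top B) (discrete_topology UNIV) (\<lambda>\<alpha>. \<Phi> \<alpha> n)" for n
    unfolding continuous_map_def
  proof (intro conjI allI impI)
    fix U :: "letter set"
    obtain m where m: "\<forall>\<alpha>\<in>Omega B. \<forall>\<beta>\<in>Omega B. prefix m \<alpha> = prefix m \<beta> \<longrightarrow> \<Phi> \<alpha> n = \<Phi> \<beta> n"
      using acts_on_cell by blast
    show "openin (Omega_top B) {x \<in> topspace (Omega_top B). \<Phi> x n \<in> U}"
    proof (rule openin_Omega_top)
      show "\<exists>m. \<forall>\<beta>\<in>Omega B. prefix m \<beta> = prefix m \<alpha> \<longrightarrow> \<beta> \<in> {x \<in> topspace (Omega_top B). \<Phi> x n \<in> U}"
        if "\<alpha> \<in> {x \<in> topspace (Omega_top B). \<Phi> x n \<in> U}" for \<alpha>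
      proof (intro exI[of _ m] ballI impI)
        fix \<beta> assume b: "\<beta> \<in> Omega B" "prefix m \<beta> = prefix m \<alpha>"
        have a: "\<alpha> \<in> Omega B" "\<Phi> \<alpha> n \<in> U" using that by (simp_all only: mem_Collect_eq topspace_Omega_top)
        have "\<Phi> \<beta> n = \<Phi> \<alpha> n" using m a(1) b by blast
        then show "\<beta> \<in> {x \<in> topspace (Omega_top B). \<Phi> x n \<in> U}" using a b by (simp only: mem_Collect_eq topspace_Omega_top)
      qed
    qed (simp add: Collect_restrict)
  qed simp
  then have "continuous_map (Omega_top B) (product_topology (\<lambda>_. discrete_topology UNIV) UNIV) \<Phi>"
    by (subst continuous_map_componentwise_UNIV) auto
  then show ?thesis
    using img unfolding Omega_top_def[of B'] by (simp add: continuous_map_in_subtopology image_subset_iff)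
qed

text \<open>All generators are prefix-preserving involutions, so a single argument makes each a
  homeomorphism and its own inverse. The equations are required for all words, valid or not, in
  which form they follow from the recursion of the generators.\<close>

definition tree_inv :: "color \<Rightarrow> (fword \<Rightarrow> fword) \<Rightarrow> bool" where
  "tree_inv c f \<longleftrightarrow> (\<forall>w n. length (f w) = length w \<and> f (take n w) = take n (f w) \<and> f (f w) = w) \<and>
    (\<forall>w. valid (Some c) w \<longrightarrow> valid (Some c) (f w) \<and> end_state (Some c) (f w) = end_state (Some c) w)"

definition tree_act :: "color \<Rightarrow> (fword \<Rightarrow> fword) \<Rightarrow> iword \<Rightarrow> iword" where
  "tree_act c f = restrict (induced f) (OM_c c)"

lemma tree_inv_prefix:
  assumes "tree_inv c f" shows "prefix n (induced f \<alpha>) = f (prefix n \<alpha>)"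
proof (rule nth_equalityI)
  show "length (prefix n (induced f \<alpha>)) = length (f (prefix n \<alpha>))"
    using assms by (simp add: tree_inv_def)
  fix k assume k: "k < length (prefix n (induced f \<alpha>))"
  then have "prefix (Suc k) \<alpha> = take (Suc k) (prefix n \<alpha>)" by simp
  then have "f (prefix (Suc k) \<alpha>) = take (Suc k) (f (prefix n \<alpha>))"
    using assms unfolding tree_inv_def by metis
  then show "prefix n (induced f \<alpha>) ! k = f (prefix n \<alpha>) ! k"
    using k by (simp add: induced_def)
qed

lemma prefix_ext: "(\<And>n. prefix n \<alpha> = prefix n \<beta>) \<Longrightarrow> \<alpha> = (\<beta> :: 'a word)"
  by (metis ext lessI subsequence_nth add_0 diff_zero)

lemma tree_inv_tree_act:
  assumes "tree_inv c f"
  shows "tree_act c f \<in> Aut_Omega c" "compose (OM_c c) (tree_act c f) (tree_act c f) = (\<lambda>\<alpha>\<in>OM_c c. \<alpha>)"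
proof -
  let ?g = "tree_act c f"
  note pre = tree_inv_prefix[OF assms]
  have img: "?g \<alpha> \<in> OM_c c" if "\<alpha> \<in> OM_c c" for \<alpha>
    using that assms by (auto simp: tree_act_def OM_c_Words Words_def pre tree_inv_def)
  have inv: "?g (?g \<alpha>) = \<alpha>" if "\<alpha> \<in> OM_c c" for \<alpha>
  proof -
    have "prefix n (induced f (induced f \<alpha>)) = prefix n \<alpha>" for n
      using assms by (simp add: pre tree_inv_def)
    then show ?thesis using img[OF that] that prefix_ext by (metis restrict_apply' tree_act_def)
  qed
  have bij: "bij_betw ?g (OM_c c) (OM_c c)"
    by (rule bij_betw_byWitness[where f' = ?g]) (use img inv in auto)
  have cont: "continuous_map (Omega_top (edge_graph c)) (Omega_top (edge_graph c)) ?g"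
  proof (rule continuous_map_Omega_top)
    show "\<exists>m. \<forall>\<alpha>\<in>OM_c c. \<forall>\<beta>\<in>OM_c c. prefix m \<alpha> = prefix m \<beta> \<longrightarrow> ?g \<alpha> n = ?g \<beta> n" for n
      by (intro exI[of _ "Suc n"]) (auto simp: tree_act_def induced_def simp del: subseq_to_Suc)
  qed (rule img)
  have "homeomorphic_maps (Omega_top (edge_graph c)) (Omega_top (edge_graph c)) ?g ?g"
    using cont inv by (simp add: homeomorphic_maps_def)
  then have hom: "homeomorphic_map (Omega_top (edge_graph c)) (Omega_top (edge_graph c)) ?g"
    using homeomorphic_map_maps by blast
  have "tree_aut c f"
    unfolding tree_aut_def
  proof (intro conjI ballI)
    show "bij_betw f (LL_c c) (LL_c c)"
      by (rule bij_betw_byWitness[where f' = f]) (use assms in \<open>auto simp: tree_inv_def LL_c_iff\<close>)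
    show "f [] = []" using assms unfolding tree_inv_def by (metis length_0_conv)
    have one: "\<exists>x. f v = f u @ [x]" if "v = u @ [x]" for u v x
    proof -
      have "length (f v) = Suc (length u)" "take (length u) (f v) = f u"
        using assms that unfolding tree_inv_def by (metis length_append_singleton, metis append_eq_conv_conj)
      then show ?thesis by (metis lessI take_Suc_conv_app_nth take_all le_refl)
    qed
    have adj: "tree_adj (f u) (f v)" if "tree_adj u v" for u v
      using that one unfolding tree_adj_def by metis
    show "tree_adj (f u) (f v) \<longleftrightarrow> tree_adj u v" for u v
      using adj[of u v] adj[of "f u" "f v"] assms by (auto simp: tree_inv_def)
    show "word_color (edge_graph c) (f u) = word_color (edge_graph c) u" if "u \<in> LL_c c" for u
    proof -
      have "f u \<in> LL_c c" "end_state (Some c) (f u) = end_state (Some c) u"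
        using assms that by (auto simp: tree_inv_def LL_c_iff)
      then show ?thesis using word_color_end_state that by (metis option.inject)
    qed
  qed
  moreover have "prefix n (?g \<alpha>) = f (prefix n \<alpha>)" if "\<alpha> \<in> OM_c c" for \<alpha> n
    using that by (simp add: tree_act_def pre)
  moreover have "?g \<in> Bij (OM_c c)" using bij by (simp add: Bij_def tree_act_def)
  ultimately show "?g \<in> Aut_Omega c" using hom unfolding Aut_Omega_def by blast
  show "compose (OM_c c) ?g ?g = (\<lambda>\<alpha>\<in>OM_c c. \<alpha>)"
    using inv by (auto simp: compose_def restrict_def)
qed

lemma tree_inv_phi3: "tree_inv Blue wphi3"
proof -
  have 1: "wphi3 (take n w) = take n (wphi3 w)" for w n
    by (cases w rule: wphi3.cases; cases n) auto
  have 2: "valid (Some Blue) w \<longrightarrow> valid (Some Blue) (wphi3 w) \<and> end_state (Some Blue) (wphi3 w) = end_state (Some Blue) w" for w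
    by (cases w rule: wphi3.cases) auto
  have 3: "length (wphi3 w) = length w" "wphi3 (wphi3 w) = w" for w
    by (cases w rule: wphi3.cases; simp)+
  show ?thesis using 1 2 3 by (simp add: tree_inv_def)
qed

lemma tree_inv_a: "tree_inv Red wa"
proof -
  have 1: "wa (take n w) = take n (wa w)" for w n
    by (cases w rule: wa.cases; cases n) auto
  have 2: "valid (Some Red) w \<longrightarrow> valid (Some Red) (wa w) \<and> end_state (Some Red) (wa w) = end_state (Some Red) w" for w
    by (cases w rule: wa.cases) auto
  have 3: "length (wa w) = length w" "wa (wa w) = w" for w
    by (cases w rule: wa.cases; simp)+
  show ?thesis using 1 2 3 by (simp add: tree_inv_def)
qed

text \<open>At \<open>E Third\<close> the maps \<open>b\<close>, \<open>c\<close>, \<open>d\<close>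
  pass to each other in a cycle, hence the simultaneous inductions.\<close>

lemma tree_inv_bcd: "tree_inv Red wb" "tree_inv Red wc" "tree_inv Red wd"
proof -
  have a: "length (wa w) = length w \<and> wa (take n w) = take n (wa w) \<and> wa (wa w) = w"
     "valid (Some Red) w \<Longrightarrow> valid (Some Red) (wa w)"
     "valid (Some Red) w \<Longrightarrow> end_state (Some Red) (wa w) = end_state (Some Red) w" for w n
    using tree_inv_a by (auto simp: tree_inv_def)
  have 1: "length (wb w) = length w" "length (wc w) = length w" "length (wd w) = length w" for w
    by (induction w and w and w rule: wb_wc_wd.induct) (auto simp: a)
  have 2: "\<forall>n. wb (take n w) = take n (wb w)" "\<forall>n. wc (take n w) = take n (wc w)"
    "\<forall>n. wd (take n w) = take n (wd w)" for w
    by (induction w and w and w rule: wb_wc_wd.induct) (auto simp: a take_Cons split: nat.splits)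
  have 3: "wb (wb w) = w" "wc (wc w) = w" "wd (wd w) = w" for w
    by (induction w and w and w rule: wb_wc_wd.induct) (auto simp: a)
  have 4: "valid (Some Red) w \<longrightarrow> valid (Some Red) (wb w) \<and> end_state (Some Red) (wb w) = end_state (Some Red) w"
     "valid (Some Red) w \<longrightarrow> valid (Some Red) (wc w) \<and> end_state (Some Red) (wc w) = end_state (Some Red) w"
     "valid (Some Red) w \<longrightarrow> valid (Some Red) (wd w) \<and> end_state (Some Red) (wd w) = end_state (Some Red) w" for w
    by (induction w and w and w rule: wb_wc_wd.induct) (auto simp: a)
  show "tree_inv Red wb" "tree_inv Red wc" "tree_inv Red wd" using 1 2 3 4 by (simp_all add: tree_inv_def)
qed

section \<open>Labels as products of generators\<close>

definition wgens :: "color \<Rightarrow> (fword \<Rightarrow> fword) set" where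
  "wgens c = (case c of Blue \<Rightarrow> {wphi3} | Red \<Rightarrow> {wa, wb, wc, wd})"

lemma GG_tree_act: "GG c = generate (Aut_group c) (tree_act c ` wgens c)"
  by (cases c) (simp_all add: GG_def wgens_def tree_act_def phi3_def gen_a_def gen_b_def gen_c_def gen_d_def)

lemma wgens_tree_inv: "f \<in> wgens c \<Longrightarrow> tree_inv c f"
  by (cases c) (auto simp: wgens_def tree_inv_phi3 tree_inv_a tree_inv_bcd)

lemma Aut_Omega_Bij: "f \<in> Aut_Omega c \<Longrightarrow> f \<in> Bij (OM_c c)"
  by (simp add: Aut_Omega_def)

definition idc :: "color \<Rightarrow> iword \<Rightarrow> iword" where "idc c = (\<lambda>\<alpha>\<in>OM_c c. \<alpha>)"

lemma idc_apply [simp]: "\<alpha> \<in> Words (Some c) \<Longrightarrow> idc c \<alpha> = \<alpha>"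
  by (simp add: idc_def OM_c_Words)

lemma compose_idc:
  assumes "f \<in> Bij (OM_c c)"
  shows "compose (OM_c c) (idc c) f = f" "compose (OM_c c) f (idc c) = f"
  using assms Bij_imp_funcset[OF assms] Bij_imp_extensional[OF assms] by (simp_all add: idc_def)

lemma idc_Aut: "idc c \<in> Aut_Omega c"
proof -
  have "homeomorphic_map (Omega_top (edge_graph c)) (Omega_top (edge_graph c)) (idc c)"
    using homeomorphic_map_eq[of "Omega_top (edge_graph c)" "Omega_top (edge_graph c)" id "idc c"] by (simp add: idc_def)
  moreover have "tree_aut c (\<lambda>w. w)"
    by (simp add: tree_aut_def bij_betw_def)
  moreover have "idc c \<in> Bij (OM_c c)" by (simp add: idc_def id_Bij)
  ultimately show ?thesis by (auto simp: Aut_Omega_def idc_def intro!: exI[of _ "\<lambda>w. w"])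
qed

lemma Aut_Omega_compose:
  assumes "f \<in> Aut_Omega c" "g \<in> Aut_Omega c" shows "compose (OM_c c) f g \<in> Aut_Omega c"
proof -
  let ?T = "Omega_top (edge_graph c)"
  have B: "compose (OM_c c) f g \<in> Bij (OM_c c)"
    using assms by (simp add: Aut_Omega_def compose_Bij)
  have g: "g \<alpha> \<in> OM_c c" if "\<alpha> \<in> OM_c c" for \<alpha>
    using assms(2) that Bij_imp_funcset Aut_Omega_Bij by blast
  have "homeomorphic_map ?T ?T (f \<circ> g)"
    using assms by (auto simp: Aut_Omega_def intro: homeomorphic_map_compose)
  then have h: "homeomorphic_map ?T ?T (compose (OM_c c) f g)"
    by (rule homeomorphic_map_eq) (simp add: compose_eq)
  obtain p q where p: "tree_aut c p" "\<forall>\<alpha>\<in>OM_c c. \<forall>n. prefix n (f \<alpha>) = p (prefix n \<alpha>)"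
    and q: "tree_aut c q" "\<forall>\<alpha>\<in>OM_c c. \<forall>n. prefix n (g \<alpha>) = q (prefix n \<alpha>)"
    using assms by (auto simp: Aut_Omega_def)
  have qL: "q w \<in> LL_c c" if "w \<in> LL_c c" for w using q(1) that bij_betwE unfolding tree_aut_def by blast
  have "tree_aut c (p \<circ> q)"
    using p(1) q(1) qL unfolding tree_aut_def by (auto intro: bij_betw_trans)
  moreover have "prefix n (compose (OM_c c) f g \<alpha>) = (p \<circ> q) (prefix n \<alpha>)" if "\<alpha> \<in> OM_c c" for \<alpha> n
    using that p(2) q(2) g by (simp add: compose_eq)
  ultimately show ?thesis using B h unfolding Aut_Omega_def by blast
qed

lemma Aut_group_mult:
  "f \<in> Aut_Omega c \<Longrightarrow> g \<in> Aut_Omega c \<Longrightarrow> f \<otimes>\<^bsub>Aut_group c\<^esub> g = compose (OM_c c) f g"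
  "\<one>\<^bsub>Aut_group c\<^esub> = idc c"
  by (simp_all add: Aut_group_def BijGroup_def Aut_Omega_Bij idc_def)

text \<open>The generator is an involution, and composing it from the left with any of its right
  inverses \<open>y\<close> in two ways gives \<open>y\<close> itself. This uniqueness identifies
  the inverse directly from its description.\<close>

lemma Aut_group_inv:
  assumes "f \<in> wgens c" shows "inv\<^bsub>Aut_group c\<^esub> (tree_act c f) = tree_act c f"
proof -
  note t = tree_inv_tree_act[OF wgens_tree_inv[OF assms]]
  have un: "y = tree_act c f" if y: "y \<in> Aut_Omega c" "compose (OM_c c) (tree_act c f) y = idc c" for y
  proof -
    have "y = compose (OM_c c) (idc c) y"
      using y(1) Aut_Omega_Bij compose_idc by metis
    also have "\<dots> = compose (OM_c c) (tree_act c f) (compose (OM_c c) (tree_act c f) y)"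
      unfolding t(2)[symmetric] idc_def by (rule compose_assoc[symmetric]) (use y(1) Aut_Omega_Bij Bij_imp_funcset in blast)
    also have "\<dots> = tree_act c f" unfolding y(2)
      using t(1) Aut_Omega_Bij compose_idc by metis
    finally show ?thesis .
  qed
  show ?thesis unfolding m_inv_def
    by (rule the_equality)
       (use t un in \<open>auto simp: Aut_group_mult idc_def simp: Aut_group_def[of c, THEN arg_cong[of _ _ carrier]]\<close>)
qed

text \<open>Generators are their own inverses, so the case of inverses merges with that of
  generators and every label is a product of generators.\<close>

lemma GG_induct [consumes 1, case_names one gen comp]:
  assumes "l \<in> GG c" "P (idc c)" "\<And>f. f \<in> wgens c \<Longrightarrow> P (tree_act c f)"
    and "\<And>f g. f \<in> GG c \<Longrightarrow> g \<in> GG c \<Longrightarrow> f \<in> Aut_Omega c \<Longrightarrow> g \<in> Aut_Omega c \<Longrightarrow> P f \<Longrightarrow> P g \<Longrightarrow> P (compose (OM_c c) f g)"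
  shows "P l"
proof -
  have "l \<in> Aut_Omega c \<and> P l" using assms(1) unfolding GG_tree_act
  proof (induction rule: generate.induct)
    case one
    then show ?case using assms(2) idc_Aut by (simp add: Aut_group_mult)
  next
    case (incl h)
    then show ?case using assms(3) tree_inv_tree_act(1)[OF wgens_tree_inv] by auto
  next
    case (inv h)
    then show ?case using assms(3) tree_inv_tree_act(1)[OF wgens_tree_inv] by (auto simp: Aut_group_inv)
  next
    case (eng f g)
    then show ?case using assms(4)[of f g] by (simp add: Aut_group_mult Aut_Omega_compose GG_tree_act)
  qed
  then show ?thesis by blast
qed

lemma GG_Aut: "l \<in> GG c \<Longrightarrow> l \<in> Aut_Omega c"
  by (induction rule: GG_induct) (auto simp: idc_Aut tree_inv_tree_act(1)[OF wgens_tree_inv] Aut_Omega_compose)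

lemma GG_Bij: "l \<in> GG c \<Longrightarrow> l \<in> Bij (OM_c c)"
  using GG_Aut Aut_Omega_Bij by blast

lemma GG_Words [simp]: "l \<in> GG c \<Longrightarrow> \<alpha> \<in> Words (Some c) \<Longrightarrow> l \<alpha> \<in> Words (Some c)"
  using GG_Bij Bij_imp_funcset unfolding OM_c_Words by blast

lemma GG_idc [simp]: "idc c \<in> GG c"
  using generate.one[of "Aut_group c"] by (simp add: GG_tree_act Aut_group_mult)

lemma GG_tree_act_in: "f \<in> wgens c \<Longrightarrow> tree_act c f \<in> GG c"
  unfolding GG_tree_act by (rule generate.incl) auto

lemma GG_compose: "f \<in> GG c \<Longrightarrow> g \<in> GG c \<Longrightarrow> compose (OM_c c) f g \<in> GG c"
  using generate.eng[of f "Aut_group c" "tree_act c ` wgens c" g] Aut_group_mult(1)[OF GG_Aut GG_Aut, of f c g]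
  by (simp add: GG_tree_act)

lemma GG_inverse:
  assumes "l \<in> GG c"
  shows "\<exists>l'\<in>GG c. \<forall>\<alpha>\<in>Words (Some c). l' (l \<alpha>) = \<alpha> \<and> l (l' \<alpha>) = \<alpha>"
  using assms
proof (induction rule: GG_induct)
  case one
  then show ?case by (intro bexI[of _ "idc c"]) auto
next
  case (gen f)
  have "tree_act c f (tree_act c f \<alpha>) = \<alpha>" if "\<alpha> \<in> Words (Some c)" for \<alpha>
    using tree_inv_tree_act(2)[OF wgens_tree_inv[OF gen]] that by (metis OM_c_Words compose_eq restrict_apply')
  then show ?case using GG_tree_act_in[OF gen] by blast
next
  case (comp f g)
  then obtain f' g' where "f' \<in> GG c" "\<forall>\<alpha>\<in>Words (Some c). f' (f \<alpha>) = \<alpha> \<and> f (f' \<alpha>) = \<alpha>"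
    "g' \<in> GG c" "\<forall>\<alpha>\<in>Words (Some c). g' (g \<alpha>) = \<alpha> \<and> g (g' \<alpha>) = \<alpha>" by blast
  then show ?case using comp.hyps
    by (intro bexI[of _ "compose (OM_c c) g' f'"]) (auto simp: OM_c_Words compose_eq GG_compose[of _ c, unfolded OM_c_Words])
qed

lemma tree_act_eq: "\<alpha> \<in> Words (Some c) \<Longrightarrow> tree_act c f \<alpha> = induced f \<alpha>"
  by (simp add: tree_act_def OM_c_Words)

section \<open>States of labels\<close>

lemma generator_step:
  assumes "f \<in> wgens c" "allowed (Some c) x"
  shows "\<exists>y l'. allowed (Some c) y \<and> lcol y = lcol x \<and> l' \<in> GG (lcol x) \<and>
    (c = Blue \<or> lcol x = Blue \<longrightarrow> l' = idc (lcol x)) \<and> (x = E First \<longrightarrow> y = E First) \<and>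
    (\<forall>\<alpha>\<in>Words (Some (lcol x)). tree_act c f (x ## \<alpha>) = y ## l' \<alpha>)"
proof -
  have t: "tree_act c f (x ## \<alpha>) = induced f (x ## \<alpha>)" if "\<alpha> \<in> Words (Some (lcol x))" for \<alpha>
    using that assms by (simp add: tree_act_eq)
  note g = generator_recursion[simplified]
  have id: ?thesis if "\<And>\<alpha>. induced f (x ## \<alpha>) = y ## \<alpha>" "allowed (Some c) y" "lcol y = lcol x" "x = E First \<longrightarrow> y = E First" for y
    using that t by (intro exI[of _ y] exI[of _ "idc (lcol x)"]) auto
  have rec: ?thesis if "\<And>\<alpha>. induced f (x ## \<alpha>) = x ## induced f' \<alpha>" "f' \<in> wgens Red" "c = Red" "lcol x = Red" for f'
    using that t assms by (intro exI[of _ x] exI[of _ "tree_act Red f'"]) (auto simp: GG_tree_act_in tree_act_eq)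
  show ?thesis
  proof (cases c)
    case Blue
    then have f: "f = wphi3" using assms by (simp add: wgens_def)
    obtain i where "x = I i" using assms Blue allowed_Blue by blast
    then show ?thesis using id Blue g f by (cases i) (auto 0 3)
  next
    case Red
    obtain i where x: "x = E i" using assms Red allowed_Red by blast
    have f: "f = wa \<or> f = wb \<or> f = wc \<or> f = wd" using assms Red by (simp add: wgens_def)
    have w: "wa \<in> wgens Red" "wb \<in> wgens Red" "wc \<in> wgens Red" "wd \<in> wgens Red" by (simp_all add: wgens_def)
    show ?thesis
    proof (cases i)
      case First
      then show ?thesis using id[of "E First"] Red f g x by auto
    next
      case Second
      then show ?thesis using id[of "E Second"] id[of "E Third"] rec[of wa] Red f g x w by auto
    next
      case Third
      then show ?thesis using id[of "E Second"] rec[of wb] rec[of wc] rec[of wd] Red f g x w by auto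
    qed
  qed
qed

text \<open>Self-similarity for one letter, together with the two facts on which the gluing depends:
  a state is trivial when the label or the letter is blue, and \<open>E First\<close> is fixed. Both
  persist under composition.\<close>

lemma GG_step:
  assumes "l \<in> GG c" "allowed (Some c) x"
  shows "\<exists>y l'. allowed (Some c) y \<and> lcol y = lcol x \<and> l' \<in> GG (lcol x) \<and>
    (c = Blue \<or> lcol x = Blue \<longrightarrow> l' = idc (lcol x)) \<and> (x = E First \<longrightarrow> y = E First) \<and>
    (\<forall>\<alpha>\<in>Words (Some (lcol x)). l (x ## \<alpha>) = y ## l' \<alpha>)"
  using assms
proof (induction arbitrary: x rule: GG_induct)
  case one
  then show ?case by (intro exI[of _ x] exI[of _ "idc (lcol x)"]) auto
next
  case (gen f)
  then show ?case by (rule generator_step)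
next
  case (comp f g)
  from comp.IH(2)[OF comp.prems] obtain y g' where g: "allowed (Some c) y" "lcol y = lcol x" "g' \<in> GG (lcol x)"
    "c = Blue \<or> lcol x = Blue \<longrightarrow> g' = idc (lcol x)" "x = E First \<longrightarrow> y = E First"
    "\<forall>\<alpha>\<in>Words (Some (lcol x)). g (x ## \<alpha>) = y ## g' \<alpha>" by blast
  from comp.IH(1)[OF g(1)] obtain z f' where f: "allowed (Some c) z" "lcol z = lcol x" "f' \<in> GG (lcol x)"
    "c = Blue \<or> lcol x = Blue \<longrightarrow> f' = idc (lcol x)" "y = E First \<longrightarrow> z = E First"
    "\<forall>\<alpha>\<in>Words (Some (lcol x)). f (y ## \<alpha>) = z ## f' \<alpha>" unfolding g(2) by blast
  have "compose (OM_c (lcol x)) f' g' \<in> GG (lcol x)" using f g GG_compose by blast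
  moreover have "compose (OM_c c) f g (x ## \<alpha>) = z ## compose (OM_c (lcol x)) f' g' \<alpha>" if "\<alpha> \<in> Words (Some (lcol x))" for \<alpha>
    using that f g comp.prems by (simp add: OM_c_Words compose_eq)
  moreover have "c = Blue \<or> lcol x = Blue \<longrightarrow> compose (OM_c (lcol x)) f' g' = idc (lcol x)"
    using f(4) g(4) compose_idc(1)[OF Aut_Omega_Bij[OF idc_Aut]] by auto
  ultimately show ?case using f g by blast
qed

lemma GG_word:
  assumes "l \<in> GG c" "valid (Some c) u" "end_state (Some c) u = Some d"
  shows "\<exists>u' l'. length u' = length u \<and> valid (Some c) u' \<and> end_state (Some c) u' = Some d \<and> l' \<in> GG d \<and>
    (\<forall>\<alpha>\<in>Words (Some d). l (u \<frown> \<alpha>) = u' \<frown> l' \<alpha>)"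
  using assms
proof (induction u arbitrary: l c)
  case Nil
  then show ?case by auto
next
  case (Cons x u)
  then obtain y l1 where y: "allowed (Some c) y" "lcol y = lcol x" "l1 \<in> GG (lcol x)"
    "\<forall>\<alpha>\<in>Words (Some (lcol x)). l (x ## \<alpha>) = y ## l1 \<alpha>" using GG_step[of l c x] by auto
  then obtain u' l' where u: "length u' = length u" "valid (Some (lcol x)) u'" "end_state (Some (lcol x)) u' = Some d" "l' \<in> GG d"
    "\<forall>\<alpha>\<in>Words (Some d). l1 (u \<frown> \<alpha>) = u' \<frown> l' \<alpha>" using Cons.IH[of l1 "lcol x"] Cons.prems by auto
  then show ?case using y Cons.prems by (intro exI[of _ "y # u'"] exI[of _ l']) auto
qed

text \<open>The address starts with \<open>E First\<close>, which a red label fixes with trivial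
  state. Thus red labels fix the initial vertex; the terminal corner can be moved, for instance by
  \<open>a\<close>.\<close>

lemma GG_initial_address:
  assumes "l \<in> GG Red" shows "l (initial_address Red) = initial_address Red"
proof -
  obtain y l' where "l' = idc Blue" "y = E First" "\<forall>\<alpha>\<in>Words (Some Blue). l (E First ## \<alpha>) = y ## l' \<alpha>"
    using GG_step[OF assms, of "E First"] by auto
  then show ?thesis by (simp add: initial_address_def OM_c_Words)
qed

lemma GG_Blue: "l \<in> GG Blue \<Longrightarrow> l = idc Blue \<or> l = phi3"
proof (induction rule: GG_induct)
  case (gen f)
  then show ?case by (simp add: wgens_def phi3_def tree_act_def)
next
  case (comp f g)
  have p: "phi3 = tree_act Blue wphi3" by (simp add: phi3_def tree_act_def)
  have "compose (OM_c Blue) phi3 phi3 = idc Blue"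
    unfolding p idc_def by (rule tree_inv_tree_act(2)[OF tree_inv_phi3])
  then show ?case using comp.IH compose_idc[OF Aut_Omega_Bij[OF comp.hyps(3)]] compose_idc[OF Aut_Omega_Bij[OF comp.hyps(4)]]
    by (elim disjE) simp_all
qed simp

lemma phi3_GG: "phi3 \<in> GG Blue"
  using GG_tree_act_in[of wphi3 Blue] by (simp add: wgens_def phi3_def tree_act_def)

lemma phi3_simps:
  assumes "\<alpha> \<in> Words (Some Blue)"
  shows "phi3 (I First ## \<alpha>) = I Third ## \<alpha>" "phi3 (I Third ## \<alpha>) = I First ## \<alpha>"
  and "\<beta> \<in> Words (Some Red) \<Longrightarrow> phi3 (I Second ## \<beta>) = I Second ## \<beta>"
  using assms generator_recursion[simplified] by (simp_all add: phi3_def OM_c_Words)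

definition swap_side :: "side \<Rightarrow> side" where
  "swap_side t = (case t of Initial \<Rightarrow> Terminal | Terminal \<Rightarrow> Initial)"

text \<open>This is the reversal of a blue edge, recorded in a diagram by the transposition in
  Sym(2).\<close>

lemma phi3_corner: "phi3 (corner Blue t) = corner Blue (swap_side t)"
  using phi3_simps(1)[of I3w] phi3_simps(2)[of I3w] I3w_unfold
  by (cases t) (auto simp: corner_def initial_address_def swap_side_def)

section \<open>Gluing-preserving maps of infinite words\<close>

definition vertex_address :: "fword \<Rightarrow> letter \<Rightarrow> iword" where
  "vertex_address e x = e \<frown> x ## initial_address (lcol x)"

lemma same_vertex_vertex_address: "same_vertex \<alpha> \<beta> \<longleftrightarrow> (\<exists>e x y. \<alpha> = vertex_address e x \<and> \<beta> = vertex_address e y)"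
  by (simp add: same_vertex_def vertex_address_def)

text \<open>Gluing with the admissibility of the words left out, so that the base graph and both
  single edges share one relation.\<close>

definition eqv :: "iword \<Rightarrow> iword \<Rightarrow> bool" where
  "eqv \<alpha> \<beta> \<longleftrightarrow> \<alpha> = \<beta> \<or> same_vertex \<alpha> \<beta>"

lemma gluing_eqv: "(\<alpha>, \<beta>) \<in> gluing base_graph \<longleftrightarrow> \<alpha> \<in> Words None \<and> \<beta> \<in> Words None \<and> eqv \<alpha> \<beta>"
  and gluing_edge_eqv: "(\<alpha>, \<beta>) \<in> gluing (edge_graph c) \<longleftrightarrow> \<alpha> \<in> Words (Some c) \<and> \<beta> \<in> Words (Some c) \<and> eqv \<alpha> \<beta>"
  by (auto simp: base.gluing_iff edge.gluing_iff eqv_def)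

lemma I3w_suffix: "I3w = t \<frown> \<beta> \<Longrightarrow> \<beta> = I3w \<and> set t \<subseteq> {I Third}"
proof -
  assume a: "I3w = t \<frown> \<beta>"
  have "suffix (length t) I3w = I3w" by (simp add: I3w_def suffix_def)
  moreover have "suffix (length t) I3w = \<beta>" unfolding a by (rule suffix_conc_length)
  moreover have "prefix (length t) I3w = t" unfolding a by (rule prefix_conc_length)
  then have "set t = I3w ` {0..<length t}" using set_subsequence[of I3w 0 "length t"] by simp
  ultimately show ?thesis by (auto simp: I3w_def)
qed

text \<open>The longer prefix exceeds the shorter one by letters of the tail only, so it would end
  in \<open>I Third\<close>. Writing an address as such a prefix followed by \<open>I3w\<close> is
  thus a normal form, from which a branch point and the chosen letter can be recovered.\<close>

lemma I3w_cancel: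
  assumes "u \<frown> I3w = v \<frown> I3w" "u = [] \<or> last u \<noteq> I Third" "v = [] \<or> last v \<noteq> I Third"
  shows "u = v"
proof -
  have one: "u = v" if h: "u \<frown> I3w = v \<frown> I3w" "v = [] \<or> last v \<noteq> I Third" "length u \<le> length v" for u v
  proof -
    obtain t where t: "v = u @ t" "I3w = t \<frown> I3w" by (rule conc_comparable[OF h(1,3)])
    have "set t \<subseteq> {I Third}" using I3w_suffix[OF t(2)] by (rule conjunct2)
    then have "last t = I Third" if "t \<noteq> []" using last_in_set[OF that] by blast
    then have "t = []" using h(2) t(1) by (cases "t = []") auto
    then show ?thesis using t(1) by simp
  qed
  show ?thesis
  proof (cases "length u \<le> length v")
    case True
    then show ?thesis using one[OF assms(1,3)] by simp
  next
    case False
    then show ?thesis using one[OF assms(1)[symmetric] assms(2)] by simp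
  qed
qed

definition first_letter :: "color \<Rightarrow> letter" where
  "first_letter c = (case c of Blue \<Rightarrow> I First | Red \<Rightarrow> E First)"

lemma initial_address_first: "initial_address c = first_letter c ## I3w"
  by (simp add: initial_address_def first_letter_def)

lemma first_letter [simp]: "first_letter c \<noteq> I Third" "allowed (Some c) (first_letter c)" "lcol (first_letter c) = Blue"
  by (cases c; simp add: first_letter_def)+

lemma vertex_address_I3w: "vertex_address e x = (e @ [x, first_letter (lcol x)]) \<frown> I3w"
  by (simp add: vertex_address_def initial_address_first)

lemma vertex_address_inj: "vertex_address e x = vertex_address e' y \<longleftrightarrow> e = e' \<and> x = y"
proof
  assume "vertex_address e x = vertex_address e' y"
  then have "e @ [x, first_letter (lcol x)] = e' @ [y, first_letter (lcol y)]"
    unfolding vertex_address_I3w by (rule I3w_cancel) auto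
  then show "e = e' \<and> x = y" by (simp add: append_eq_append_conv)
qed simp

lemma vertex_address_Words [simp]: "vertex_address e x \<in> Words s \<longleftrightarrow> valid s (e @ [x])"
  by (simp add: vertex_address_def)

lemma eqv_refl [simp]: "eqv \<alpha> \<alpha>"
  and eqv_sym: "eqv \<alpha> \<beta> \<Longrightarrow> eqv \<beta> \<alpha>"
  and eqv_trans: "eqv \<alpha> \<beta> \<Longrightarrow> eqv \<beta> \<gamma> \<Longrightarrow> eqv \<alpha> \<gamma>"
  by (auto simp: eqv_def same_vertex_vertex_address vertex_address_inj)

lemma eqv_vertex_address: "eqv (vertex_address e x) \<beta> \<longleftrightarrow> (\<exists>y. \<beta> = vertex_address e y)"
  by (auto simp: eqv_def same_vertex_vertex_address vertex_address_inj)

lemma vertex_address_conc: "w \<frown> vertex_address e x = vertex_address (w @ e) x"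
  by (simp add: vertex_address_def)

lemma vertex_address_build: "z ## vertex_address e x = vertex_address (z # e) x"
  by (simp add: vertex_address_def)

text \<open>The branch point is either created inside the cell of \<open>w\<close>, or it was
  created above and the cell lies on the way of its address.\<close>

lemma conc_eq_vertex_address:
  assumes "w \<frown> \<alpha> = vertex_address e x"
  shows "(\<exists>t. e = w @ t \<and> \<alpha> = vertex_address t x) \<or> (\<exists>u. w = e @ x # u \<and> u \<frown> \<alpha> = initial_address (lcol x))"
proof (cases "length w \<le> length e")
  case True
  obtain t where "e = w @ t" "\<alpha> = t \<frown> x ## initial_address (lcol x)"
    using conc_comparable[OF assms[unfolded vertex_address_def] True] by blast
  then show ?thesis by (auto simp: vertex_address_def)
next
  case False
  then have l: "length (e @ [x]) \<le> length w" by simp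
  have "(e @ [x]) \<frown> initial_address (lcol x) = w \<frown> \<alpha>" using assms by (simp add: vertex_address_def)
  then obtain u where "w = (e @ [x]) @ u" "initial_address (lcol x) = u \<frown> \<alpha>" using l by (rule conc_comparable)
  then show ?thesis by auto
qed

text \<open>If the branch point were created above \<open>w\<close>, both addresses would continue
  with the same letter of \<open>w\<close> and hence be equal.\<close>

lemma eqv_conc: "eqv (w \<frown> \<alpha>) (w \<frown> \<beta>) \<longleftrightarrow> eqv \<alpha> \<beta>"
proof
  assume a: "eqv (w \<frown> \<alpha>) (w \<frown> \<beta>)"
  show "eqv \<alpha> \<beta>"
  proof (cases "\<alpha> = \<beta>")
    case False
    then obtain e x y where e: "w \<frown> \<alpha> = vertex_address e x" "w \<frown> \<beta> = vertex_address e y" "x \<noteq> y"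
      using a unfolding eqv_def same_vertex_vertex_address by (metis same_concat_eq)
    then show ?thesis using conc_eq_vertex_address[OF e(1)] conc_eq_vertex_address[OF e(2)] by (auto simp: eqv_vertex_address)
  qed simp
next
  assume "eqv \<alpha> \<beta>"
  then consider "\<alpha> = \<beta>" | e x y where "\<alpha> = vertex_address e x" "\<beta> = vertex_address e y" unfolding eqv_def same_vertex_vertex_address by blast
  then show "eqv (w \<frown> \<alpha>) (w \<frown> \<beta>)"
  proof cases
    case 2
    then show ?thesis by (simp only: vertex_address_conc eqv_vertex_address) blast
  qed simp
qed

lemma eqv_build: "eqv (x ## \<alpha>) (x ## \<beta>) \<longleftrightarrow> eqv \<alpha> \<beta>"
  using eqv_conc[of "[x]"] by simp

text \<open>Descending along \<open>e\<close> replaces the label by its state and reduces to the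
  centre of a cell. There the label permutes the three letters, and its states fix the initial
  addresses.\<close>

lemma GG_vertex_address:
  assumes "l \<in> GG c" "valid (Some c) (e @ [x])" "valid (Some c) (e @ [y])"
  shows "\<exists>e' x' y'. l (vertex_address e x) = vertex_address e' x' \<and> l (vertex_address e y) = vertex_address e' y'"
  using assms
proof (induction e arbitrary: l c)
  case Nil
  have one: "\<exists>x'. l (vertex_address [] x) = vertex_address [] x'" if x: "allowed (Some c) x" for x
  proof -
    obtain x' l' where s: "allowed (Some c) x'" "lcol x' = lcol x" "l' \<in> GG (lcol x)"
       "c = Blue \<or> lcol x = Blue \<longrightarrow> l' = idc (lcol x)"
      "\<forall>\<alpha>\<in>Words (Some (lcol x)). l (x ## \<alpha>) = x' ## l' \<alpha>" using GG_step[OF Nil.prems(1) x] by auto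
    have "l' (initial_address (lcol x)) = initial_address (lcol x)"
      using s(3,4) GG_initial_address by (cases "lcol x") auto
    then show ?thesis using s by (auto simp: vertex_address_def)
  qed
  show ?case using one[of x] one[of y] Nil.prems by auto
next
  case (Cons z e)
  then obtain z' l' where s: "lcol z' = lcol z" "l' \<in> GG (lcol z)"
      "\<forall>\<alpha>\<in>Words (Some (lcol z)). l (z ## \<alpha>) = z' ## l' \<alpha>" using GG_step[of l c z] by auto
  obtain e' x' y' where "l' (vertex_address e x) = vertex_address e' x'" "l' (vertex_address e y) = vertex_address e' y'"
    using Cons.IH[OF s(2)] Cons.prems by auto
  then have "l (vertex_address (z # e) x) = vertex_address (z' # e') x'" "l (vertex_address (z # e) y) = vertex_address (z' # e') y'"
    using s(3) Cons.prems by (auto simp flip: vertex_address_build)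
  then show ?case by blast
qed

lemma GG_eqv:
  assumes "l \<in> GG c" "\<alpha> \<in> Words (Some c)" "\<beta> \<in> Words (Some c)"
  shows "eqv (l \<alpha>) (l \<beta>) \<longleftrightarrow> eqv \<alpha> \<beta>"
proof -
  have fw: "eqv (l \<alpha>) (l \<beta>)" if h: "l \<in> GG c" "\<alpha> \<in> Words (Some c)" "\<beta> \<in> Words (Some c)" "eqv \<alpha> \<beta>" for l \<alpha> \<beta>
  proof (cases "\<alpha> = \<beta>")
    case False
    then obtain e x y where "\<alpha> = vertex_address e x" "\<beta> = vertex_address e y" using h(4) unfolding eqv_def same_vertex_vertex_address by blast
    then show ?thesis using GG_vertex_address[OF h(1), of e x y] h(2,3) by (auto simp: eqv_vertex_address)
  qed simp
  obtain l' where "l' \<in> GG c" "\<forall>\<alpha>\<in>Words (Some c). l' (l \<alpha>) = \<alpha> \<and> l (l' \<alpha>) = \<alpha>"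
    using GG_inverse[OF assms(1)] by blast
  then show ?thesis using fw[OF assms] fw[of l' "l \<alpha>" "l \<beta>"] assms by auto
qed

lemma GG_preserves_gluing: "l \<in> GG c \<Longrightarrow> preserves_gluing c l"
  using GG_eqv by (auto simp: preserves_gluing_def gluing_edge_eqv OM_c_Words)

lemma LL_conc: "w \<in> LL \<Longrightarrow> w \<frown> \<alpha> \<in> Words None \<longleftrightarrow> \<alpha> \<in> Words (Some (color_of w))"
  by (rule LL_conc_OM)

lemma LL_append: "w \<in> LL \<Longrightarrow> w @ u \<in> LL \<longleftrightarrow> valid (Some (color_of w)) u"
  and color_append: "w \<in> LL \<Longrightarrow> w @ u \<in> LL \<Longrightarrow> end_state (Some (color_of w)) u = Some (color_of (w @ u))"
  using color_of_end_state[of w] color_of_end_state[of "w @ u"] by (auto simp: LL_iff)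

section \<open>Maps that act on cells by a change of prefix and a label\<close>

definition acts_on_cell :: "(iword \<Rightarrow> iword) \<Rightarrow> fword \<Rightarrow> fword \<Rightarrow> bool" where
  "acts_on_cell \<Phi> w w' \<longleftrightarrow> w' \<in> LL \<and> color_of w' = color_of w \<and>
    (\<exists>l\<in>GG (color_of w). \<forall>\<alpha>\<in>Words (Some (color_of w)). \<Phi> (w \<frown> \<alpha>) = w' \<frown> l \<alpha>)"

lemma acts_on_cell_append:
  assumes "acts_on_cell \<Phi> w w'" "w \<in> LL" "w @ u \<in> LL"
  shows "\<exists>u'. length u' = length u \<and> acts_on_cell \<Phi> (w @ u) (w' @ u')"
proof -
  obtain l where l: "w' \<in> LL" "color_of w' = color_of w" "l \<in> GG (color_of w)"
    "\<forall>\<alpha>\<in>Words (Some (color_of w)). \<Phi> (w \<frown> \<alpha>) = w' \<frown> l \<alpha>" using assms(1) by (auto simp: acts_on_cell_def)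
  let ?d = "color_of (w @ u)"
  have u: "valid (Some (color_of w)) u" "end_state (Some (color_of w)) u = Some ?d"
    using assms LL_append color_append by auto
  obtain u' l' where u': "length u' = length u" "valid (Some (color_of w)) u'"
    "end_state (Some (color_of w)) u' = Some ?d" "l' \<in> GG ?d"
    "\<forall>\<alpha>\<in>Words (Some ?d). l (u \<frown> \<alpha>) = u' \<frown> l' \<alpha>" using GG_word[OF l(3) u] by blast
  have "w' @ u' \<in> LL" using LL_append[OF l(1)] l(2) u' by simp
  moreover have "color_of (w' @ u') = ?d" using color_append[OF l(1)] l(2) u' calculation by auto
  moreover have "\<Phi> ((w @ u) \<frown> \<alpha>) = (w' @ u') \<frown> l' \<alpha>" if "\<alpha> \<in> Words (Some ?d)" for \<alpha>
    using that l(4) u u'(5) by (simp flip: conc_conc)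
  ultimately show ?thesis using u' unfolding acts_on_cell_def by blast
qed

lemma acts_on_cell_compose:
  assumes "acts_on_cell \<Psi> w w'" "acts_on_cell \<Phi> w' w''"
  shows "acts_on_cell (\<Phi> \<circ> \<Psi>) w w''"
proof -
  obtain l where l: "w' \<in> LL" "color_of w' = color_of w" "l \<in> GG (color_of w)"
    "\<forall>\<alpha>\<in>Words (Some (color_of w)). \<Psi> (w \<frown> \<alpha>) = w' \<frown> l \<alpha>" using assms(1) by (auto simp: acts_on_cell_def)
  obtain k where k: "w'' \<in> LL" "color_of w'' = color_of w" "k \<in> GG (color_of w)"
    "\<forall>\<alpha>\<in>Words (Some (color_of w)). \<Phi> (w' \<frown> \<alpha>) = w'' \<frown> k \<alpha>" using assms(2) l(2) by (auto simp: acts_on_cell_def)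
  have "(\<Phi> \<circ> \<Psi>) (w \<frown> \<alpha>) = w'' \<frown> compose (OM_c (color_of w)) k l \<alpha>" if "\<alpha> \<in> Words (Some (color_of w))" for \<alpha>
    using that k l by (simp add: compose_eq OM_c_Words)
  then show ?thesis using k l GG_compose unfolding acts_on_cell_def by blast
qed

lemma acts_on_cell_inverse:
  assumes "acts_on_cell \<Phi> w w'" "w \<in> LL" "\<And>\<alpha>. \<alpha> \<in> Words None \<Longrightarrow> \<Psi> (\<Phi> \<alpha>) = \<alpha>"
  shows "acts_on_cell \<Psi> w' w"
proof -
  obtain l where l: "w' \<in> LL" "color_of w' = color_of w" "l \<in> GG (color_of w)"
    "\<forall>\<alpha>\<in>Words (Some (color_of w)). \<Phi> (w \<frown> \<alpha>) = w' \<frown> l \<alpha>" using assms(1) by (auto simp: acts_on_cell_def)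
  obtain l' where l': "l' \<in> GG (color_of w)" "\<forall>\<alpha>\<in>Words (Some (color_of w)). l' (l \<alpha>) = \<alpha> \<and> l (l' \<alpha>) = \<alpha>"
    using GG_inverse[OF l(3)] by blast
  have "\<Psi> (w' \<frown> \<alpha>) = w \<frown> l' \<alpha>" if "\<alpha> \<in> Words (Some (color_of w))" for \<alpha>
  proof -
    have a: "l' \<alpha> \<in> Words (Some (color_of w))" using l'(1) that by simp
    then have "\<Phi> (w \<frown> l' \<alpha>) = w' \<frown> \<alpha>" using l(4) l'(2) that by simp
    moreover have "\<Psi> (\<Phi> (w \<frown> l' \<alpha>)) = w \<frown> l' \<alpha>" using assms(3)[of "w \<frown> l' \<alpha>"] LL_conc[OF assms(2)] a by blast
    ultimately show ?thesis by simp
  qed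
  then show ?thesis using l l' assms(2) unfolding acts_on_cell_def by auto
qed

text \<open>The transformations of infinite words underlying the elements of \<open>EG\<close>; values outside
  \<open>Words None\<close> are irrelevant.\<close>

definition gluing_maps :: "(iword \<Rightarrow> iword) set" where
  "gluing_maps = {\<Phi>. bij_betw \<Phi> (Words None) (Words None) \<and>
    (\<forall>\<alpha>\<in>Words None. \<forall>\<beta>\<in>Words None. eqv (\<Phi> \<alpha>) (\<Phi> \<beta>) \<longleftrightarrow> eqv \<alpha> \<beta>) \<and>
    (\<exists>N. \<forall>w\<in>LL. N \<le> length w \<longrightarrow> (\<exists>w'. acts_on_cell \<Phi> w w'))}"

lemma gluing_maps_Words: "\<Phi> \<in> gluing_maps \<Longrightarrow> \<alpha> \<in> Words None \<Longrightarrow> \<Phi> \<alpha> \<in> Words None"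
  by (auto simp: gluing_maps_def bij_betw_def)

lemma gluing_maps_eqv: "\<Phi> \<in> gluing_maps \<Longrightarrow> \<alpha> \<in> Words None \<Longrightarrow> \<beta> \<in> Words None \<Longrightarrow> eqv (\<Phi> \<alpha>) (\<Phi> \<beta>) \<longleftrightarrow> eqv \<alpha> \<beta>"
  by (simp add: gluing_maps_def)

lemma gluing_maps_locE:
  assumes "\<Phi> \<in> gluing_maps" obtains N where "\<And>w. w \<in> LL \<Longrightarrow> N \<le> length w \<Longrightarrow> \<exists>w'. acts_on_cell \<Phi> w w'"
proof -
  have "\<exists>N. \<forall>w\<in>LL. N \<le> length w \<longrightarrow> (\<exists>w'. acts_on_cell \<Phi> w w')" using assms by (simp add: gluing_maps_def)
  then show ?thesis using that by blast
qed

text \<open>Once the map acts on a cell, each further letter of the word lengthens the image word by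
  one letter. This is what makes compositions act on deep cells and what gives continuity.\<close>

lemma gluing_maps_long:
  assumes "\<Phi> \<in> gluing_maps"
  shows "\<exists>N. \<forall>w\<in>LL. \<forall>k. N + k \<le> length w \<longrightarrow> (\<exists>w'. acts_on_cell \<Phi> w w' \<and> k \<le> length w')"
proof -
  obtain N where N: "\<And>w. w \<in> LL \<Longrightarrow> N \<le> length w \<Longrightarrow> \<exists>w'. acts_on_cell \<Phi> w w'" using gluing_maps_locE[OF assms(1)] by blast
  have "\<exists>w'. acts_on_cell \<Phi> w w' \<and> k \<le> length w'" if w: "w \<in> LL" "Suc N + k \<le> length w" for w k
  proof -
    \<comment> \<open>\<open>Suc N\<close> instead of \<open>N\<close> keeps this prefix nonempty,
      as membership in \<open>LL\<close> requires.\<close>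
    let ?v = "take (Suc N) w" let ?u = "drop (Suc N) w"
    have v: "?v \<in> LL" using w by (auto simp: LL_iff valid_take)
    obtain v' where "acts_on_cell \<Phi> ?v v'" using N[OF v] w(2) by auto
    then obtain u' where "length u' = length ?u" "acts_on_cell \<Phi> (?v @ ?u) (v' @ u')" using acts_on_cell_append[of \<Phi> ?v v' ?u] v w by auto
    then show ?thesis using w(2) by (intro exI[of _ "v' @ u'"]) auto
  qed
  then show ?thesis by blast
qed

lemma gluing_maps_compose:
  assumes "\<Phi> \<in> gluing_maps" "\<Psi> \<in> gluing_maps" shows "\<Phi> \<circ> \<Psi> \<in> gluing_maps"
proof -
  obtain M where M: "\<And>w. w \<in> LL \<Longrightarrow> M \<le> length w \<Longrightarrow> \<exists>w'. acts_on_cell \<Phi> w w'" using gluing_maps_locE[OF assms(1)] by blast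
  obtain N where N: "\<And>w k. w \<in> LL \<Longrightarrow> N + k \<le> length w \<Longrightarrow> \<exists>w'. acts_on_cell \<Psi> w w' \<and> k \<le> length w'"
    using gluing_maps_long[OF assms(2)] by blast
  have "\<exists>w'. acts_on_cell (\<Phi> \<circ> \<Psi>) w w'" if w: "w \<in> LL" "N + M \<le> length w" for w
  proof -
    obtain w' where w': "acts_on_cell \<Psi> w w'" "M \<le> length w'" using N[OF w] by blast
    then obtain w'' where "acts_on_cell \<Phi> w' w''" using M[of w'] unfolding acts_on_cell_def by blast
    then show ?thesis using acts_on_cell_compose w' by blast
  qed
  moreover have "bij_betw (\<Phi> \<circ> \<Psi>) (Words None) (Words None)" using assms by (auto simp: gluing_maps_def intro: bij_betw_trans)
  moreover have "eqv ((\<Phi> \<circ> \<Psi>) \<alpha>) ((\<Phi> \<circ> \<Psi>) \<beta>) \<longleftrightarrow> eqv \<alpha> \<beta>" if "\<alpha> \<in> Words None" "\<beta> \<in> Words None" for \<alpha> \<beta>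
    using that assms gluing_maps_Words[OF assms(2)] by (simp add: gluing_maps_def)
  ultimately show ?thesis unfolding gluing_maps_def by blast
qed

text \<open>Only finitely many words have length \<open>Suc N\<close>. A word at least as long as
  all their images lies below one of these images, and there the inverse acts by the inverse
  label.\<close>

lemma gluing_maps_inverse:
  assumes "\<Phi> \<in> gluing_maps" and inv: "\<And>\<alpha>. \<alpha> \<in> Words None \<Longrightarrow> \<Psi> (\<Phi> \<alpha>) = \<alpha>"
  shows "\<Psi> \<in> gluing_maps"
proof -
  have b: "bij_betw \<Phi> (Words None) (Words None)" using assms by (simp add: gluing_maps_def)
  have S: "\<exists>\<beta>\<in>Words None. \<alpha> = \<Phi> \<beta>" if "\<alpha> \<in> Words None" for \<alpha> using b that by (auto simp: bij_betw_def)
  obtain N where N: "\<And>w. w \<in> LL \<Longrightarrow> N \<le> length w \<Longrightarrow> \<exists>w'. acts_on_cell \<Phi> w w'" using gluing_maps_locE[OF assms(1)] by blast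
  define W where "W = {w \<in> LL. length w = Suc N}"
  have "finite W" unfolding W_def by (rule finite_subset[OF _ finite_valid_length[of None "Suc N"]]) (auto simp: LL_iff)
  have "\<forall>w\<in>W. \<exists>w'. acts_on_cell \<Phi> w w'" using N by (auto simp: W_def)
  from bchoice[OF this] obtain f where f: "\<And>w. w \<in> W \<Longrightarrow> acts_on_cell \<Phi> w (f w)" by blast
  define M where "M = Max (length ` f ` W)"
  have "\<exists>w'. acts_on_cell \<Psi> v w'" if v: "v \<in> LL" "M \<le> length v" for v
  proof -
    obtain \<alpha> where "\<alpha> \<in> Words (Some (color_of v))" using Words_nonempty by blast
    then have "v \<frown> \<alpha> \<in> Words None" using LL_conc[OF v(1)] by blast
    then obtain \<beta> where \<beta>: "\<beta> \<in> Words None" "v \<frown> \<alpha> = \<Phi> \<beta>" using S by blast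
    then obtain w \<gamma> where w: "\<beta> = w \<frown> \<gamma>" "length w = Suc N" "valid None w" "\<gamma> \<in> Words (end_state None w)" by (metis Words_split)
    then have "w \<in> LL" by (auto simp: LL_iff)
    then have wW: "w \<in> W" using w by (simp add: W_def)
    then have l: "acts_on_cell \<Phi> w (f w)" using f by blast
    then obtain k where "k \<in> GG (color_of w)" "\<Phi> \<beta> = f w \<frown> k \<gamma>"
      using w \<open>w \<in> LL\<close> color_of_end_state by (auto simp: acts_on_cell_def)
    moreover have "length (f w) \<le> length v"
      using v(2) wW \<open>finite W\<close> unfolding M_def by (metis (no_types, lifting) Max_ge dual_order.trans finite_imageI image_eqI)
    ultimately have "f w \<frown> k \<gamma> = v \<frown> \<alpha>" "length (f w) \<le> length v" using \<beta>(2) by simp_all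
    then obtain t where "v = f w @ t" by (rule conc_comparable)
    then show ?thesis using acts_on_cell_append[OF acts_on_cell_inverse[OF l \<open>w \<in> LL\<close> inv]] l v(1) by (metis acts_on_cell_def)
  qed
  moreover have "bij_betw \<Psi> (Words None) (Words None)"
    by (rule bij_betw_byWitness[where f' = \<Phi>]) (use inv S gluing_maps_Words[OF assms(1)] in \<open>auto, metis+\<close>)
  moreover have "eqv (\<Psi> \<alpha>) (\<Psi> \<beta>) \<longleftrightarrow> eqv \<alpha> \<beta>" if ab: "\<alpha> \<in> Words None" "\<beta> \<in> Words None" for \<alpha> \<beta>
  proof -
    obtain \<alpha>' \<beta>' where "\<alpha>' \<in> Words None" "\<beta>' \<in> Words None" "\<alpha> = \<Phi> \<alpha>'" "\<beta> = \<Phi> \<beta>'" using S ab by blast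
    then show ?thesis using assms(1) inv by (simp add: gluing_maps_def)
  qed
  ultimately show ?thesis unfolding gluing_maps_def by blast
qed

lemma gluing_maps_has_inverse:
  assumes "\<Phi> \<in> gluing_maps"
  obtains \<Psi> where "\<Psi> \<in> gluing_maps" "\<And>\<alpha>. \<alpha> \<in> Words None \<Longrightarrow> \<Psi> (\<Phi> \<alpha>) = \<alpha>" "\<And>\<alpha>. \<alpha> \<in> Words None \<Longrightarrow> \<Phi> (\<Psi> \<alpha>) = \<alpha>"
proof -
  have b: "bij_betw \<Phi> (Words None) (Words None)" using assms by (simp add: gluing_maps_def)
  let ?P = "inv_into (Words None) \<Phi>"
  have "?P (\<Phi> \<alpha>) = \<alpha>" "\<Phi> (?P \<alpha>) = \<alpha>" if "\<alpha> \<in> Words None" for \<alpha>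
    using b that by (simp_all add: bij_betw_inv_into_left bij_betw_inv_into_right)
  then show ?thesis using that gluing_maps_inverse[OF assms] by blast
qed

text \<open>A map agreeing with \<Phi> on infinite words inverts an inverse of \<Phi>, so applying
  the closure under inverses twice suffices.\<close>

lemma gluing_maps_cong: "\<Phi> \<in> gluing_maps \<Longrightarrow> (\<And>\<alpha>. \<alpha> \<in> Words None \<Longrightarrow> \<Psi> \<alpha> = \<Phi> \<alpha>) \<Longrightarrow> \<Psi> \<in> gluing_maps"
proof -
  assume a: "\<Phi> \<in> gluing_maps" "\<And>\<alpha>. \<alpha> \<in> Words None \<Longrightarrow> \<Psi> \<alpha> = \<Phi> \<alpha>"
  obtain \<Theta> where t: "\<Theta> \<in> gluing_maps" "\<And>\<alpha>. \<alpha> \<in> Words None \<Longrightarrow> \<Theta> (\<Phi> \<alpha>) = \<alpha>" "\<And>\<alpha>. \<alpha> \<in> Words None \<Longrightarrow> \<Phi> (\<Theta> \<alpha>) = \<alpha>"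
    using gluing_maps_has_inverse[OF a(1)] by blast
  show "\<Psi> \<in> gluing_maps" by (rule gluing_maps_inverse[OF t(1)]) (simp add: a(2) t gluing_maps_Words[OF t(1)])
qed

lemma gluing_maps_id: "id \<in> gluing_maps"
proof -
  have "acts_on_cell id w w" if "w \<in> LL" for w
    using that unfolding acts_on_cell_def by (auto intro!: bexI[of _ "idc (color_of w)"])
  then show ?thesis by (auto simp: gluing_maps_def)
qed

section \<open>Induced maps of the limit space\<close>

lemma mem_cls: "\<beta> \<in> cls \<alpha> \<longleftrightarrow> \<alpha> \<in> Words None \<and> \<beta> \<in> Words None \<and> eqv \<alpha> \<beta>"
  by (simp add: cls_def gluing_eqv)

lemma cls_eq:
  assumes "\<alpha> \<in> Words None" "\<beta> \<in> Words None" shows "cls \<alpha> = cls \<beta> \<longleftrightarrow> eqv \<alpha> \<beta>"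
proof
  assume "cls \<alpha> = cls \<beta>"
  moreover have "\<beta> \<in> cls \<beta>" unfolding mem_cls using assms(2) by simp
  ultimately have "\<beta> \<in> cls \<alpha>" by simp
  then show "eqv \<alpha> \<beta>" unfolding mem_cls by simp
next
  assume e: "eqv \<alpha> \<beta>"
  have "eqv \<alpha> \<gamma> \<longleftrightarrow> eqv \<beta> \<gamma>" for \<gamma>
    using eqv_trans[OF e, of \<gamma>] eqv_trans[OF eqv_sym[OF e], of \<gamma>] by (rule iffI[rotated])
  then show "cls \<alpha> = cls \<beta>" unfolding set_eq_iff mem_cls using assms by simp
qed

definition limit_map :: "(iword \<Rightarrow> iword) \<Rightarrow> iword set \<Rightarrow> iword set" where
  "limit_map \<Phi> = (\<lambda>p\<in>limit_space. cls (\<Phi> (SOME \<alpha>. \<alpha> \<in> p)))"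

lemma limit_spaceE:
  assumes "p \<in> limit_space" obtains \<alpha> where "\<alpha> \<in> Words None" "p = cls \<alpha>"
  using assms by (auto simp: limit_space_eq OM_Words)

lemma cls_limit_space [simp]: "\<alpha> \<in> Words None \<Longrightarrow> cls \<alpha> \<in> limit_space"
  by (simp add: cls_in_limit_space OM_Words)

lemma limit_map_cls:
  assumes "\<Phi> \<in> gluing_maps" "\<alpha> \<in> Words None" shows "limit_map \<Phi> (cls \<alpha>) = cls (\<Phi> \<alpha>)"
proof -
  let ?b = "SOME \<beta>. \<beta> \<in> cls \<alpha>"
  have "?b \<in> cls \<alpha>" by (rule someI[of _ \<alpha>]) (simp add: mem_cls assms)
  then have b: "?b \<in> Words None" "eqv \<alpha> ?b" unfolding mem_cls by blast+
  have "eqv (\<Phi> \<alpha>) (\<Phi> ?b)" using gluing_maps_eqv[OF assms b(1)] b(2) by simp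
  then have "cls (\<Phi> \<alpha>) = cls (\<Phi> ?b)"
    using cls_eq[OF gluing_maps_Words[OF assms] gluing_maps_Words[OF assms(1) b(1)]] by simp
  then show ?thesis using assms by (simp add: limit_map_def)
qed

lemma limit_ext:
  assumes "f \<in> extensional limit_space" "g \<in> extensional limit_space"
    "\<And>\<alpha>. \<alpha> \<in> Words None \<Longrightarrow> f (cls \<alpha>) = g (cls \<alpha>)"
  shows "f = g"
  by (rule extensionalityI[OF assms(1,2)]) (erule limit_spaceE, simp add: assms(3))

lemma limit_map_cong:
  assumes "\<Phi> \<in> gluing_maps" "\<And>\<alpha>. \<alpha> \<in> Words None \<Longrightarrow> \<Psi> \<alpha> = \<Phi> \<alpha>" shows "limit_map \<Psi> = limit_map \<Phi>"
  by (rule limit_ext) (simp_all add: limit_map_cls[OF assms(1)] limit_map_cls[OF gluing_maps_cong[OF assms]] assms(2), simp_all add: limit_map_def)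

lemma limit_map_compose:
  assumes "\<Phi> \<in> gluing_maps" "\<Psi> \<in> gluing_maps" shows "limit_map (\<Phi> \<circ> \<Psi>) = compose limit_space (limit_map \<Phi>) (limit_map \<Psi>)"
  by (rule limit_ext)
    (simp_all add: limit_map_cls[OF gluing_maps_compose[OF assms]] compose_eq limit_map_cls[OF assms(1)] limit_map_cls[OF assms(2)] gluing_maps_Words[OF assms(2)],
     simp_all add: limit_map_def)

lemma limit_map_id: "limit_map id = (\<lambda>p\<in>limit_space. p)"
  by (rule limit_ext) (simp_all add: limit_map_cls[OF gluing_maps_id], simp_all add: limit_map_def)

lemma limit_map_inverse:
  assumes "\<Phi> \<in> gluing_maps" "\<Psi> \<in> gluing_maps" "\<And>\<alpha>. \<alpha> \<in> Words None \<Longrightarrow> \<Psi> (\<Phi> \<alpha>) = \<alpha>" "p \<in> limit_space"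
  shows "limit_map \<Psi> (limit_map \<Phi> p) = p"
proof -
  obtain \<alpha> where a: "\<alpha> \<in> Words None" "p = cls \<alpha>" by (rule limit_spaceE[OF assms(4)])
  then show ?thesis by (simp add: limit_map_cls[OF assms(1)] limit_map_cls[OF assms(2)] gluing_maps_Words[OF assms(1)] assms(3))
qed

lemma limit_map_limit_space: "\<Phi> \<in> gluing_maps \<Longrightarrow> p \<in> limit_space \<Longrightarrow> limit_map \<Phi> p \<in> limit_space"
  by (erule limit_spaceE) (simp add: limit_map_cls gluing_maps_Words)

lemma limit_map_Bij: assumes "\<Phi> \<in> gluing_maps" shows "limit_map \<Phi> \<in> Bij limit_space"
proof -
  obtain \<Psi> where P: "\<Psi> \<in> gluing_maps" "\<And>\<alpha>. \<alpha> \<in> Words None \<Longrightarrow> \<Psi> (\<Phi> \<alpha>) = \<alpha>" "\<And>\<alpha>. \<alpha> \<in> Words None \<Longrightarrow> \<Phi> (\<Psi> \<alpha>) = \<alpha>"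
    using gluing_maps_has_inverse[OF assms] by blast
  have "bij_betw (limit_map \<Phi>) limit_space limit_space"
  proof (rule bij_betw_byWitness[where f' = "limit_map \<Psi>"])
    show "\<forall>p\<in>limit_space. limit_map \<Psi> (limit_map \<Phi> p) = p" using limit_map_inverse[OF assms P(1,2)] by blast
    show "\<forall>p\<in>limit_space. limit_map \<Phi> (limit_map \<Psi> p) = p" using limit_map_inverse[OF P(1) assms P(3)] by blast
  qed (use limit_map_limit_space P(1) assms in blast)+
  then show ?thesis by (simp add: Bij_def limit_map_def)
qed

text \<open>Letter \<open>n\<close> of the image depends only on the first \<open>N + Suc n\<close>
  letters, because the cell of this prefix is mapped into a cell whose word is longer than
  \<open>n\<close>.\<close>

lemma gluing_maps_continuous:
  assumes "\<Phi> \<in> gluing_maps" shows "continuous_map (Omega_top base_graph) (Omega_top base_graph) \<Phi>"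
proof (rule continuous_map_Omega_top)
  show "\<Phi> \<alpha> \<in> OM" if "\<alpha> \<in> OM" for \<alpha> using that gluing_maps_Words[OF assms] by (simp add: OM_Words)
  obtain N where N: "\<And>w k. w \<in> LL \<Longrightarrow> N + k \<le> length w \<Longrightarrow> \<exists>w'. acts_on_cell \<Phi> w w' \<and> k \<le> length w'"
    using gluing_maps_long[OF assms] by blast
  fix n
  have "\<Phi> \<alpha> n = \<Phi> \<beta> n" if ab: "\<alpha> \<in> OM" "\<beta> \<in> OM" "prefix (N + Suc n) \<alpha> = prefix (N + Suc n) \<beta>" for \<alpha> \<beta>
  proof -
    obtain w \<gamma> where w: "\<alpha> = w \<frown> \<gamma>" "length w = N + Suc n" "valid None w" using ab(1) by (metis OM_Words Words_split)
    have "prefix (N + Suc n) \<alpha> = w" unfolding w(1) w(2)[symmetric] by (rule prefix_conc_length)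
    moreover define \<delta> where "\<delta> = suffix (N + Suc n) \<beta>"
    ultimately have d: "\<beta> = w \<frown> \<delta>" using prefix_suffix[of \<beta> "N + Suc n"] ab(3) by simp
    have wL: "w \<in> LL" using w by (auto simp: LL_iff)
    then obtain w' where "acts_on_cell \<Phi> w w'" "Suc n \<le> length w'" using N[OF wL, of "Suc n"] w by auto
    moreover have "\<gamma> \<in> Words (Some (color_of w))" "\<delta> \<in> Words (Some (color_of w))"
      using ab(1,2) w(1) d LL_conc[OF wL] unfolding OM_Words by blast+
    ultimately obtain l where "\<Phi> \<alpha> = w' \<frown> l \<gamma>" "\<Phi> \<beta> = w' \<frown> l \<delta>" using w d by (auto simp: acts_on_cell_def)
    then show ?thesis using \<open>Suc n \<le> length w'\<close> by simp
  qed
  then show "\<exists>m. \<forall>\<alpha>\<in>OM. \<forall>\<beta>\<in>OM. prefix m \<alpha> = prefix m \<beta> \<longrightarrow> \<Phi> \<alpha> n = \<Phi> \<beta> n" by blast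
qed

lemma limit_map_continuous:
  assumes "\<Phi> \<in> gluing_maps" shows "continuous_map limit_top limit_top (limit_map \<Phi>)"
proof -
  have "continuous_map (Omega_top base_graph) limit_top (cls \<circ> \<Phi>)"
    using gluing_maps_continuous[OF assms] quotient_imp_continuous_map[OF quotient_map_cls] by (rule continuous_map_compose)
  then have "continuous_map (Omega_top base_graph) limit_top (limit_map \<Phi> \<circ> cls)"
    by (rule continuous_map_eq) (simp add: OM_Words limit_map_cls assms)
  then show ?thesis using continuous_compose_quotient_map_eq[OF quotient_map_cls] by blast
qed

lemma limit_map_homeomorphic:
  assumes "\<Phi> \<in> gluing_maps" shows "homeomorphic_map limit_top limit_top (limit_map \<Phi>)"
proof -
  obtain \<Psi> where P: "\<Psi> \<in> gluing_maps" "\<And>\<alpha>. \<alpha> \<in> Words None \<Longrightarrow> \<Psi> (\<Phi> \<alpha>) = \<alpha>" "\<And>\<alpha>. \<alpha> \<in> Words None \<Longrightarrow> \<Phi> (\<Psi> \<alpha>) = \<alpha>"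
    using gluing_maps_has_inverse[OF assms] by blast
  have "homeomorphic_maps limit_top limit_top (limit_map \<Phi>) (limit_map \<Psi>)"
    unfolding homeomorphic_maps_def topspace_limit_top
    using limit_map_continuous[OF assms] limit_map_continuous[OF P(1)] limit_map_inverse[OF assms P(1,2)] limit_map_inverse[OF P(1) assms P(3)]
    by blast
  then show ?thesis using homeomorphic_map_maps by blast
qed

section \<open>Expansions as complete prefix codes\<close>

text \<open>Finite partitions of the infinite words into cells. They are exactly the edge sets of
  expansions, so a domain or range can be given without a sequence of expansions leading to
  it.\<close>

definition prefix_code :: "fword set \<Rightarrow> bool" where
  "prefix_code P \<longleftrightarrow> finite P \<and> P \<subseteq> LL \<and> (\<forall>\<alpha>\<in>Words None. \<exists>e\<in>P. \<exists>\<beta>. \<alpha> = e \<frown> \<beta>) \<and>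
    (\<forall>e\<in>P. \<forall>u. e @ u \<in> P \<longrightarrow> u = [])"

lemma prefix_code_unique:
  assumes "prefix_code P" "e \<in> P" "e' \<in> P" "e \<frown> \<alpha> = e' \<frown> \<beta>"
  shows "e = e' \<and> \<alpha> = \<beta>"
proof -
  have one: "e = e'" if h: "e \<in> P" "e' \<in> P" "e \<frown> \<alpha> = e' \<frown> \<beta>" "length e \<le> length e'" for e e' and \<alpha> \<beta> :: iword
  proof -
    obtain t where "e' = e @ t" by (rule conc_comparable[OF h(3,4)])
    then show ?thesis using h assms(1) by (auto simp: prefix_code_def)
  qed
  have "e = e'"
  proof (cases "length e \<le> length e'")
    case True
    then show ?thesis using one assms by blast
  next
    case False
    then show ?thesis using one[OF assms(3,2) assms(4)[symmetric]] by simp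
  qed
  then show ?thesis using assms(4) by simp
qed

lemma codeE:
  assumes "prefix_code P" "\<alpha> \<in> Words None"
  obtains e \<beta> where "e \<in> P" "\<alpha> = e \<frown> \<beta>" "\<beta> \<in> Words (Some (color_of e))"
proof -
  obtain e \<beta> where e: "e \<in> P" "\<alpha> = e \<frown> \<beta>" using assms unfolding prefix_code_def by blast
  then have "e \<in> LL" using assms(1) by (auto simp: prefix_code_def)
  then show ?thesis using that e assms(2) LL_conc by blast
qed

lemma ex_letter: "\<exists>x. allowed (Some c) x \<and> index x = i"
  by (cases c) (use letter.sel allowed.simps in metis)+

lemma expansion_prefix_code: "G \<in> expansions base_graph \<Longrightarrow> prefix_code (edges G)"
proof (induction rule: expansions.induct)
  case base
  have f: "finite (edges base_graph)" using finite_idx by (simp add: base_graph_def full_SetCompr_eq)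
  have "\<exists>e\<in>edges base_graph. \<exists>\<beta>. \<alpha> = e \<frown> \<beta>" if \<alpha>: "\<alpha> \<in> Words None" for \<alpha>
  proof -
    obtain x \<beta> where x: "\<alpha> = x ## \<beta>" "allowed None x" using \<alpha> by (rule Words_cases)
    then obtain i where "x = Z i" by (auto simp: allowed_None)
    then have "\<alpha> = [Z i] \<frown> \<beta>" using x by simp
    then show ?thesis by (auto simp: base_graph_def)
  qed
  moreover have "edges base_graph \<subseteq> LL" using expansions.base by (auto simp: lang_def)
  moreover have "u = []" if "e \<in> edges base_graph" "e @ u \<in> edges base_graph" for e u
    using that by (auto simp: base_graph_def)
  ultimately show ?case using f unfolding prefix_code_def by blast
next
  case (step G w)
  let ?N = "{w @ [x] |x. allowed (Some (color_of w)) x}"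
  have P: "edges (expand G w) = (edges G - {w}) \<union> ?N"
    using word_color_bdry_base(1)[OF step.hyps] by (simp add: edges_expand)
  have w: "w \<in> LL" using step by (auto simp: prefix_code_def)
  have "finite ?N"
    by (rule finite_subset[of _ "(\<lambda>u. w @ u) ` {u. valid (Some (color_of w)) u \<and> length u = 1}"])
       (auto simp: finite_valid_length image_iff)
  then have f: "finite (edges (expand G w))" using step.IH by (simp add: P prefix_code_def)
  have L: "edges (expand G w) \<subseteq> LL" using step.IH w by (auto simp: P prefix_code_def LL_append)
  have c: "\<exists>e\<in>edges (expand G w). \<exists>\<beta>. \<alpha> = e \<frown> \<beta>" if \<alpha>: "\<alpha> \<in> Words None" for \<alpha>
  proof -
    obtain e \<beta> where e: "e \<in> edges G" "\<alpha> = e \<frown> \<beta>" "\<beta> \<in> Words (Some (color_of e))" by (rule codeE[OF step.IH \<alpha>])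
    show ?thesis
    proof (cases "e = w")
      case True
      obtain x \<gamma> where x: "\<beta> = x ## \<gamma>" "allowed (Some (color_of w)) x" using e(3) unfolding True by (rule Words_cases)
      then have "\<alpha> = (w @ [x]) \<frown> \<gamma>" using e(2) True by simp
      then show ?thesis using x(2) unfolding P by blast
    next
      case False
      then show ?thesis using e unfolding P by blast
    qed
  qed
  have "u = []" if h: "e \<in> edges (expand G w)" "e @ u \<in> edges (expand G w)" for e u
  proof -
    have pf: "\<And>e u. e \<in> edges G \<Longrightarrow> e @ u \<in> edges G \<Longrightarrow> u = []" using step.IH by (auto simp: prefix_code_def)
    consider "e \<in> edges G - {w}" "e @ u \<in> edges G - {w}"
      | x where "e \<in> edges G - {w}" "e @ u = w @ [x]"
      | x where "e = w @ [x]" "e @ u \<in> edges G - {w}"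
      | x y where "e = w @ [x]" "e @ u = w @ [y]" using h unfolding P by blast
    then show ?thesis
    proof cases
      case 1
      then show ?thesis using pf by blast
    next
      case 2
      then show ?thesis using pf[of e "butlast u"] step.hyps(2)
        by (cases u rule: rev_cases) auto
    next
      case 3
      then show ?thesis using pf[of w "[x] @ u"] step.hyps(2) by simp
    next
      case 4
      then show ?thesis by simp
    qed
  qed
  then show ?case using f L c unfolding prefix_code_def by blast
qed

text \<open>Together with a longest word \<open>w @ [x]\<close> all its siblings belong to the code.
  Contracting them to \<open>w\<close> gives a code of smaller total length, from which
  \<open>P\<close> is recovered by expanding \<open>w\<close>.\<close>

lemma prefix_code_expansion: "prefix_code P \<Longrightarrow> \<exists>G\<in>expansions base_graph. edges G = P"
proof (induction "\<Sum>e\<in>P. length e" arbitrary: P rule: less_induct)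
  case less
  note P = less.prems
  have end_state: "finite P" "P \<subseteq> LL" and pf: "\<And>e u. e \<in> P \<Longrightarrow> e @ u \<in> P \<Longrightarrow> u = []" using P by (auto simp: prefix_code_def)
  obtain \<alpha>0 where "\<alpha>0 \<in> Words None" using Words_nonempty by blast
  then have "P \<noteq> {}" using P unfolding prefix_code_def by blast
  define m where "m = Max (length ` P)"
  have "m \<in> length ` P" unfolding m_def using end_state(1) \<open>P \<noteq> {}\<close> by (intro Max_in) auto
  then obtain e where e: "e \<in> P" "length e = m" by blast
  have mx: "length f \<le> length e" if "f \<in> P" for f
    using end_state(1) that unfolding e(2) m_def by (intro Max_ge) auto
  show ?case
  proof (cases "length e = 1")
    case True
    have "f \<in> edges base_graph" if f: "f \<in> P" for f
    proof -
      have "f \<in> LL" "length f = 1" using f end_state(2) mx[OF f] True length_LL[of f] by auto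
      then show ?thesis using length_base_LL by (auto simp: lang_def base_graph_def)
    qed
    moreover have "f \<in> P" if f: "f \<in> edges base_graph" for f
    proof -
      obtain i where i: "f = [Z i]" using f by (auto simp: base_graph_def)
      have "Z i ## initial_address Red \<in> Words None" by simp
      then obtain g \<beta> where g: "g \<in> P" "Z i ## initial_address Red = g \<frown> \<beta>" by (rule codeE[OF P])
      obtain j where "g = [Z j]" using calculation[OF g(1)] by (auto simp: base_graph_def)
      then show ?thesis using g i by simp
    qed
    ultimately show ?thesis using expansions.base by blast
  next
    case False
    have "e \<in> LL" using e end_state by blast
    then obtain w x where wx: "e = w @ [x]" "w \<noteq> []"
      using False length_LL[of e] by (cases e rule: rev_cases) auto
    have w: "w \<in> LL" "allowed (Some (color_of w)) x"
      using \<open>e \<in> LL\<close> wx color_of_end_state[of w] by (auto simp: LL_iff)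
    let ?N = "{w @ [y] |y. allowed (Some (color_of w)) y}"
    have N: "?N \<subseteq> P"
    proof
      fix f assume "f \<in> ?N"
      then obtain y where y: "f = w @ [y]" "allowed (Some (color_of w)) y" by blast
      have fL: "f \<in> LL" using y LL_append[OF w(1), of "[y]"] by simp
      then have "f \<frown> initial_address (color_of f) \<in> Words None" using LL_conc initial_address_Words by blast
      then obtain g \<beta> where g: "g \<in> P" "f \<frown> initial_address (color_of f) = g \<frown> \<beta>" by (rule codeE[OF P])
      have "length g \<le> length f" using mx[OF g(1)] y wx by simp
      then obtain t where t: "f = g @ t" by (rule conc_comparable[OF g(2)[symmetric]])
      \<comment> \<open>Otherwise the code word \<open>g\<close> is a prefix of \<open>w\<close> and
        therefore a proper prefix of the code word \<open>e\<close>.\<close>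
      have "t = []"
      proof (rule ccontr)
        assume "t \<noteq> []"
        then obtain t' where "w = g @ t'" using t y by (cases t rule: rev_cases) auto
        then show False using pf[of g "t' @ [x]"] g(1) e wx by simp
      qed
      then show "f \<in> P" using t g(1) by simp
    qed
    let ?Q = "insert w (P - ?N)"
    have wP: "w \<notin> P" using pf[of w "[x]"] e(1) wx by auto
    have "prefix_code ?Q"
      unfolding prefix_code_def
    proof (intro conjI ballI allI impI)
      show "finite ?Q" using end_state by simp
      show "?Q \<subseteq> LL" using end_state w by blast
      fix \<alpha> assume "\<alpha> \<in> Words None"
      then obtain g \<beta> where g: "g \<in> P" "\<alpha> = g \<frown> \<beta>" by (rule codeE[OF P])
      show "\<exists>e\<in>?Q. \<exists>\<beta>. \<alpha> = e \<frown> \<beta>"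
      proof (cases "g \<in> ?N")
        case True
        then obtain y where "g = w @ [y]" by blast
        then have "\<alpha> = w \<frown> y ## \<beta>" using g by simp
        then show ?thesis by blast
      next
        case False
        then show ?thesis using g by blast
      qed
    next
      fix f u assume a: "f \<in> ?Q" "f @ u \<in> ?Q"
      consider "f = w" "f @ u = w" | "f = w" "f @ u \<in> P - ?N" | "f \<in> P" "f @ u = w" | "f \<in> P" "f @ u \<in> P"
        using a by blast
      then show "u = []"
      proof cases
        case 2
        show ?thesis
        proof (rule ccontr)
          assume "u \<noteq> []"
          then obtain y v where u: "u = y # v" by (cases u) auto
          have "w @ y # v \<in> LL" using 2 u end_state by blast
          then have "allowed (Some (color_of w)) y" using LL_append[OF w(1), of "y # v"] by simp
          then have "w @ [y] \<in> ?N" by blast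
          then have "v = []" using N pf[of "w @ [y]" v] 2 u by auto
          then show False using \<open>w @ [y] \<in> ?N\<close> 2 u by simp
        qed
      next
        case 3
        then show ?thesis using pf[of f "u @ [x]"] e wx by auto
      next
        case 4
        then show ?thesis using pf by blast
      qed auto
    qed
    moreover have "(\<Sum>f\<in>?Q. length f) < (\<Sum>f\<in>P. length f)"
    proof -
      have eN: "e \<in> ?N" using wx w by blast
      have "(\<Sum>f\<in>?Q. length f) = length w + (\<Sum>f\<in>P - ?N. length f)"
        using wP end_state by (subst sum.insert) auto
      also have "\<dots> \<le> length w + (\<Sum>f\<in>P - {e}. length f)"
        using end_state eN by (intro add_left_mono sum_mono2) auto
      also have "\<dots> < length e + (\<Sum>f\<in>P - {e}. length f)" using wx by simp
      also have "\<dots> = (\<Sum>f\<in>P. length f)" using sum.remove[OF end_state(1) e(1), of length] by simp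
      finally show ?thesis .
    qed
    ultimately obtain G where G: "G \<in> expansions base_graph" "edges G = ?Q" using less.hyps by blast
    then have w': "w \<in> edges G" by blast
    have "edges (expand G w) = (?Q - {w}) \<union> ?N"
      using word_color_bdry_base(1)[OF G(1) w'] G(2) by (simp add: edges_expand)
    also have "\<dots> = P" using wP N by blast
    finally show ?thesis using expansions.step[OF G(1) w'] by blast
  qed
qed

text \<open>Expansions have no isolated vertices, so a vertex bijection can be defined by its effect
  on the ends of edges.\<close>

lemma verts_expansion:
  "G \<in> expansions base_graph \<Longrightarrow> verts G = {bdry G e t |e t. e \<in> edges G}"
proof (induction rule: expansions.induct)
  case base
  have "v \<in> {bdry base_graph e t |e t. e \<in> edges base_graph}" if "v \<in> range BaseV" for v :: "star_vertex vertex"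
  proof -
    obtain u where u: "v = BaseV u" using \<open>v \<in> range BaseV\<close> by blast
    have "bdry base_graph [Z First] Initial = BaseV Centre" "bdry base_graph [Z i] Terminal = BaseV (Leaf i)" for i
      by (simp_all add: base_graph_def star_bdry_def)
    moreover have "[Z i] \<in> edges base_graph" for i by (simp add: base_graph_def)
    ultimately show ?thesis unfolding u by (cases u) (metis (mono_tags, lifting) mem_Collect_eq)+
  qed
  then show ?case by (auto simp: base_graph_def)
next
  case (step G w)
  let ?G' = "expand G w"
  let ?V = "\<lambda>G. {bdry G e t |e t. e \<in> edges G}"
  have w: "w \<in> LL" using step.hyps by (auto simp: lang_def)
  have col: "ecolor G w = color_of w" using word_color_bdry_base(1)[OF step.hyps] by simp
  have bd: "bdry G e = lam e" if "e \<in> edges G" for e using word_color_bdry_base(2)[OF step.hyps(1) that] by simp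
  have bd': "bdry ?G' e = lam e" if "e \<in> edges ?G'" for e
    using word_color_bdry_base(2)[OF expansions.step[OF step.hyps] that] by simp
  have e': "edges ?G' = (edges G - {w}) \<union> {w @ [x] |x. allowed (Some (color_of w)) x}" by (simp add: edges_expand col)
  have V': "verts ?G' = verts G \<union> {lam w Initial, lam w Terminal, NewV w Centre, NewV w (Leaf Second)}"
  proof -
    have "u = Centre \<or> u = Leaf First \<or> u = Leaf Second \<or> u = Leaf Third" for u
      by (cases u) (auto, metis idx.exhaust)
    then have "(UNIV :: star_vertex set) = {Centre, Leaf First, Leaf Second, Leaf Third}" by blast
    then show ?thesis using bd[OF step.hyps(2)]
      by (auto simp: expand_def Let_def replacement_iff glue_def rep_bdry_def)
  qed
  have new: "lam (w @ [x]) Initial = NewV w Centre"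
     "lam (w @ [x]) Terminal = (case index x of First \<Rightarrow> lam w Initial
            | Second \<Rightarrow> NewV w (Leaf Second) | Third \<Rightarrow> lam w Terminal)" if "allowed (Some (color_of w)) x" for x
    using base.snoc[OF w, of x] color_of_end_state[OF w] that by simp_all
  obtain x1 x2 x3 where x: "allowed (Some (color_of w)) x1" "index x1 = First" "allowed (Some (color_of w)) x2" "index x2 = Second"
    "allowed (Some (color_of w)) x3" "index x3 = Third" using ex_letter by metis
  have in': "w @ [y] \<in> edges ?G'" if "allowed (Some (color_of w)) y" for y using that unfolding e' by blast
  have mem: "lam e t \<in> ?V ?G'" if "e \<in> edges ?G'" for e t using that bd' by (metis (mono_tags, lifting) mem_Collect_eq)
  have four: "lam w Initial \<in> ?V ?G'" "lam w Terminal \<in> ?V ?G'" "NewV w Centre \<in> ?V ?G'" "NewV w (Leaf Second) \<in> ?V ?G'"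
    using mem[OF in'[OF x(1)], of Terminal] mem[OF in'[OF x(5)], of Terminal] mem[OF in'[OF x(1)], of Initial]
      mem[OF in'[OF x(3)], of Terminal] new x by simp_all
  show ?case
  proof (intro equalityI subsetI)
    fix v assume "v \<in> verts ?G'"
    then consider "v \<in> {lam w Initial, lam w Terminal, NewV w Centre, NewV w (Leaf Second)}"
      | e t where "e \<in> edges G" "v = bdry G e t" unfolding V' step.IH by blast
    then show "v \<in> ?V ?G'"
    proof cases
      case 1
      then show ?thesis using four by blast
    next
      case 2
      show ?thesis
      proof (cases "e = w")
        case True
        then show ?thesis using 2 bd[OF 2(1)] four by (cases t) auto
      next
        case False
        then show ?thesis using 2 bd[OF 2(1)] mem[of e t] unfolding e' by auto
      qed
    qed
  next
    fix v assume "v \<in> ?V ?G'"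
    then obtain e t where e: "e \<in> edges ?G'" "v = lam e t" using bd' by auto
    from e(1) consider "e \<in> edges G" | x where "e = w @ [x]" "allowed (Some (color_of w)) x" unfolding e' by blast
    then show "v \<in> verts ?G'"
    proof cases
      case 1
      have "v = bdry G e t" using e(2) bd[OF 1] by simp
      then show ?thesis using 1 unfolding V' step.IH by blast
    next
      case 2
      show ?thesis unfolding e(2) 2(1) V' using new[OF 2(2)] by (cases t; cases "index x") auto
    qed
  qed
qed

section \<open>Elements of the group as maps of infinite words\<close>

text \<open>The labels define \<Phi> cell by cell, and \<Phi> respects the gluing in both directions
  because \<open>h\<close> is an injective map on classes. The two expansions are recorded for the
  later normalization of domain and range.\<close>

lemma EG_imp_gluing_maps:
  assumes "h \<in> carrier EG"
  shows "\<exists>\<Phi>\<in>gluing_maps. h = limit_map \<Phi> \<and> (\<exists>D\<in>expansions base_graph. \<exists>D'\<in>expansions base_graph.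
    \<forall>e\<in>edges D. \<exists>e'\<in>edges D'. acts_on_cell \<Phi> e e')"
proof -
  obtain D D' fV fE \<pi> l where h: "h \<in> Bij limit_space" and d: "diagram D D' fV fE \<pi> l"
    and hl: "\<And>e \<alpha>. e \<in> edges D \<Longrightarrow> \<alpha> \<in> OM_c (color_of e) \<Longrightarrow> h (cls (e \<frown> \<alpha>)) = cls (fE e \<frown> l e \<alpha>)"
    using assms unfolding EG_def by auto
  have D: "prefix_code (edges D)" "prefix_code (edges D')" using d expansion_prefix_code by (auto simp: diagram_def)
  have f: "bij_betw fE (edges D) (edges D')" using d by (auto simp: diagram_def pi_isomorphism_def)
  have l: "l e \<in> GG (color_of e)" if "e \<in> edges D" for e using d that by (auto simp: diagram_def)
  have col: "color_of (fE e) = color_of e" "e \<in> LL" "fE e \<in> LL" if "e \<in> edges D" for e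
    using d that by (auto simp: diagram_def cell_isomorphism_def)
  define \<Phi> where "\<Phi> \<alpha> = (let e = (SOME e. e \<in> edges D \<and> (\<exists>\<beta>. \<alpha> = e \<frown> \<beta>)) in fE e \<frown> l e (suffix (length e) \<alpha>))" for \<alpha>
  have \<Phi>: "\<Phi> (e \<frown> \<alpha>) = fE e \<frown> l e \<alpha>" if e: "e \<in> edges D" for e \<alpha>
  proof -
    have "(SOME e'. e' \<in> edges D \<and> (\<exists>\<beta>. e \<frown> \<alpha> = e' \<frown> \<beta>)) = e"
    proof (rule some_equality)
      show "e \<in> edges D \<and> (\<exists>\<beta>. e \<frown> \<alpha> = e \<frown> \<beta>)" using e by blast
      show "e' = e" if "e' \<in> edges D \<and> (\<exists>\<beta>. e \<frown> \<alpha> = e' \<frown> \<beta>)" for e'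
        using that prefix_code_unique[OF D(1) e, of e'] by blast
    qed
    then show ?thesis unfolding \<Phi>_def Let_def by simp
  qed
  have Words: "\<Phi> \<alpha> \<in> Words None" if \<alpha>: "\<alpha> \<in> Words None" for \<alpha>
  proof -
    obtain e \<beta> where e: "e \<in> edges D" "\<alpha> = e \<frown> \<beta>" "\<beta> \<in> Words (Some (color_of e))" by (rule codeE[OF D(1) \<alpha>])
    have "l e \<beta> \<in> Words (Some (color_of (fE e)))" using l[OF e(1)] e(3) col[OF e(1)] by simp
    then show ?thesis unfolding e(2) \<Phi>[OF e(1)] using LL_conc[OF col(3)[OF e(1)]] by blast
  qed
  have h\<Phi>: "h (cls \<alpha>) = cls (\<Phi> \<alpha>)" if \<alpha>: "\<alpha> \<in> Words None" for \<alpha>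
  proof -
    obtain e \<beta> where e: "e \<in> edges D" "\<alpha> = e \<frown> \<beta>" "\<beta> \<in> Words (Some (color_of e))" by (rule codeE[OF D(1) \<alpha>])
    then show ?thesis using hl[OF e(1), of \<beta>] by (simp add: \<Phi> OM_c_Words)
  qed
  have "inj_on \<Phi> (Words None)"
  proof (rule inj_onI)
    fix \<alpha> \<alpha>' assume a: "\<alpha> \<in> Words None" "\<alpha>' \<in> Words None" "\<Phi> \<alpha> = \<Phi> \<alpha>'"
    obtain e \<beta> where e: "e \<in> edges D" "\<alpha> = e \<frown> \<beta>" "\<beta> \<in> Words (Some (color_of e))" by (rule codeE[OF D(1) a(1)])
    obtain e' \<beta>' where e': "e' \<in> edges D" "\<alpha>' = e' \<frown> \<beta>'" "\<beta>' \<in> Words (Some (color_of e'))" by (rule codeE[OF D(1) a(2)])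
    have "fE e \<frown> l e \<beta> = fE e' \<frown> l e' \<beta>'" using a(3) e e' by (simp add: \<Phi>)
    moreover have "fE e \<in> edges D'" "fE e' \<in> edges D'" using f e(1) e'(1) bij_betwE by blast+
    ultimately have u: "fE e = fE e'" "l e \<beta> = l e' \<beta>'" using prefix_code_unique[OF D(2)] by blast+
    then have ee: "e = e'" using f e(1) e'(1) by (auto simp: bij_betw_def inj_on_def)
    have "inj_on (l e) (Words (Some (color_of e)))"
      using GG_Bij[OF l[OF e(1)]] by (auto simp: Bij_def OM_c_Words bij_betw_def)
    then have "\<beta> = \<beta>'" using u e(3) e'(3) unfolding ee by (auto dest: inj_onD)
    then show "\<alpha> = \<alpha>'" using e e' ee by simp
  qed
  moreover have "\<alpha> \<in> \<Phi> ` Words None" if \<alpha>: "\<alpha> \<in> Words None" for \<alpha>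
  proof -
    obtain e' \<beta> where e: "e' \<in> edges D'" "\<alpha> = e' \<frown> \<beta>" "\<beta> \<in> Words (Some (color_of e'))" by (rule codeE[OF D(2) \<alpha>])
    obtain e where e': "e \<in> edges D" "e' = fE e" using f e(1) by (auto simp: bij_betw_def)
    obtain k where k: "k \<in> GG (color_of e)" "\<forall>\<alpha>\<in>Words (Some (color_of e)). k (l e \<alpha>) = \<alpha> \<and> l e (k \<alpha>) = \<alpha>"
      using GG_inverse[OF l[OF e'(1)]] by blast
    have b: "\<beta> \<in> Words (Some (color_of e))" using e(3) e' col by simp
    have "\<alpha> = \<Phi> (e \<frown> k \<beta>)" using e(2) e' k(2) b by (simp add: \<Phi>)
    moreover have "e \<frown> k \<beta> \<in> Words None" using LL_conc[OF col(2)[OF e'(1)]] GG_Words[OF k(1) b] by blast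
    ultimately show ?thesis by blast
  qed
  ultimately have bij: "bij_betw \<Phi> (Words None) (Words None)" using Words by (auto simp: bij_betw_def)
  have eq: "eqv (\<Phi> \<alpha>) (\<Phi> \<beta>) \<longleftrightarrow> eqv \<alpha> \<beta>" if ab: "\<alpha> \<in> Words None" "\<beta> \<in> Words None" for \<alpha> \<beta>
  proof -
    have "inj_on h limit_space" using h by (auto simp: Bij_def bij_betw_def)
    then have "h (cls \<alpha>) = h (cls \<beta>) \<longleftrightarrow> cls \<alpha> = cls \<beta>" using ab by (intro inj_on_eq_iff) auto
    then show ?thesis using ab Words by (simp add: h\<Phi> cls_eq)
  qed
  have acts_on_cell: "acts_on_cell \<Phi> e (fE e)" if e: "e \<in> edges D" for e
    unfolding acts_on_cell_def using col[OF e] l[OF e] \<Phi>[OF e] by blast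
  define N where "N = Max (length ` edges D)"
  have "\<exists>w'. acts_on_cell \<Phi> w w'" if w: "w \<in> LL" "N \<le> length w" for w
  proof -
    have "w \<frown> initial_address (color_of w) \<in> Words None" using LL_conc[OF w(1)] initial_address_Words by blast
    then obtain e \<beta> where e: "e \<in> edges D" "w \<frown> initial_address (color_of w) = e \<frown> \<beta>" by (rule codeE[OF D(1)])
    have "length e \<le> N" unfolding N_def using D(1) e(1) by (intro Max_ge) (auto simp: prefix_code_def)
    then have "length e \<le> length w" using w(2) by simp
    then obtain u where u: "w = e @ u" by (rule conc_comparable[OF e(2)[symmetric]])
    show ?thesis using acts_on_cell_append[OF acts_on_cell[OF e(1)] col(2)[OF e(1)]] w(1) unfolding u by blast
  qed
  then have "\<Phi> \<in> gluing_maps" using bij eq unfolding gluing_maps_def by blast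
  moreover have "h = limit_map \<Phi>"
  proof (rule limit_ext)
    show "h \<in> extensional limit_space" using h by (simp add: Bij_def)
    show "limit_map \<Phi> \<in> extensional limit_space" by (simp add: limit_map_def)
    show "h (cls \<alpha>) = limit_map \<Phi> (cls \<alpha>)" if "\<alpha> \<in> Words None" for \<alpha>
      using h\<Phi>[OF that] limit_map_cls[OF calculation that] by simp
  qed
  moreover have "\<exists>e'\<in>edges D'. acts_on_cell \<Phi> e e'" if e: "e \<in> edges D" for e
    using acts_on_cell[OF e] bij_betwE[OF f] e by blast
  moreover have "D \<in> expansions base_graph" "D' \<in> expansions base_graph" using d by (auto simp: diagram_def)
  ultimately show ?thesis by blast
qed

section \<open>Boundary vertices and topological boundaries of cells\<close>

text \<open>The terminal vertex of a red edge is a leaf of every expansion.\<close>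

definition inner :: "color \<Rightarrow> side \<Rightarrow> bool" where
  "inner c t \<longleftrightarrow> \<not> (c = Red \<and> t = Terminal)"

lemma I3w_conc_Suc: "(u \<frown> I3w) (length u + k) = I Third"
  by (simp add: I3w_def)

text \<open>This word is eventually \<open>E Third\<close>, whereas addresses of branch points are
  eventually \<open>I Third\<close>. Consequently a red terminal vertex is glued to nothing.\<close>

lemma red_terminal_not_vertex_address: "e \<frown> corner Red Terminal \<noteq> vertex_address p x"
proof
  assume a: "e \<frown> corner Red Terminal = vertex_address p x"
  let ?n = "length e + length (p @ [x, first_letter (lcol x)])"
  have "(e \<frown> corner Red Terminal) ?n = E Third" by (simp add: corner_def)
  moreover have "vertex_address p x ?n = I Third" unfolding vertex_address_I3w
    using I3w_conc_Suc[of "p @ [x, first_letter (lcol x)]" "length e"] by (simp only: add.commute)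
  ultimately show False using a by simp
qed

text \<open>In normal form an inner corner has at most one letter before the tail
  \<open>I3w\<close>, the address of a branch point at least two.\<close>

lemma corner_not_vertex_address: "corner c t \<noteq> vertex_address p x"
proof
  assume a: "corner c t = vertex_address p x"
  show False
  proof (cases "inner c t")
    case False
    then show ?thesis using red_terminal_not_vertex_address[of "[]" p x] a by (simp add: inner_def)
  next
    case True
    have "\<exists>v. corner c t = v \<frown> I3w \<and> (v = [] \<or> last v \<noteq> I Third) \<and> length v \<le> 1"
    proof (cases t)
      case Initial
      then have "corner c t = [first_letter c] \<frown> I3w" by (simp add: corner_def initial_address_first)
      then show ?thesis by (intro exI[of _ "[first_letter c]"]) simp
    next
      case Terminal
      then have "corner c t = [] \<frown> I3w" using True by (cases c) (simp_all add: corner_def inner_def)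
      then show ?thesis by (intro exI[of _ "[]"]) simp
    qed
    then obtain v where v: "corner c t = v \<frown> I3w" "v = [] \<or> last v \<noteq> I Third" "length v \<le> 1" by blast
    have "v = p @ [x, first_letter (lcol x)]"
      by (rule I3w_cancel) (use v a vertex_address_I3w in auto)
    then show False using v(3) by simp
  qed
qed

lemma corner_inj:
  assumes "corner c t = corner c t'" shows "t = t'"
proof -
  obtain x where x: "corner c t = x ## corner (lcol x) Terminal"
    "index x = (case t of Initial \<Rightarrow> First | Terminal \<Rightarrow> Third)" by (rule corner_cases)
  obtain y where y: "corner c t' = y ## corner (lcol y) Terminal"
    "index y = (case t' of Initial \<Rightarrow> First | Terminal \<Rightarrow> Third)" by (rule corner_cases)
  have "x = y" using assms unfolding x(1) y(1) by blast
  then show ?thesis using x(2) y(2) by (cases t; cases t') auto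
qed

lemma lam_eq_iff:
  assumes "e \<in> LL" "e' \<in> LL" "\<And>u. e \<noteq> e' @ u" "\<And>u. e' \<noteq> e @ u"
  shows "lam e t = lam e' t' \<longleftrightarrow> eqv (e \<frown> corner (color_of e) t) (e' \<frown> corner (color_of e') t')"
proof -
  have O: "e \<frown> corner (color_of e) t \<in> Words None" "e' \<frown> corner (color_of e') t' \<in> Words None"
    using LL_conc[OF assms(1)] LL_conc[OF assms(2)] by simp_all
  show ?thesis
    using base.share_iff[OF assms color_of_end_state[OF assms(1)] color_of_end_state[OF assms(2)], of t t'] O
    unfolding gluing_eqv by blast
qed

text \<open>The terminal corner of a red edge is glued only to itself, so a shared vertex would put
  the same word into two incomparable cells.\<close>

lemma lam_red_terminal:
  assumes "e \<in> LL" "e' \<in> LL" "\<And>u. e \<noteq> e' @ u" "\<And>u. e' \<noteq> e @ u" "\<not> inner (color_of e) t"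
  shows "lam e t \<noteq> lam e' t'"
proof
  assume "lam e t = lam e' t'"
  then have "eqv (e \<frown> corner Red Terminal) (e' \<frown> corner (color_of e') t')"
    using lam_eq_iff[OF assms(1-4)] assms(5) by (simp add: inner_def)
  then have eq: "e \<frown> corner Red Terminal = e' \<frown> corner (color_of e') t'"
    unfolding eqv_def same_vertex_vertex_address using red_terminal_not_vertex_address by blast
  show False
  proof (cases "length e \<le> length e'")
    case True
    then show False using conc_comparable[OF eq] assms(4) by blast
  next
    case False
    then show False using conc_comparable[OF eq[symmetric]] assms(3) by simp
  qed
qed

text \<open>The boundary vertex is the centre created at some \<open>p\<close> above
  \<open>e\<close>. Every other address enters through another child of \<open>p\<close>, where the
  point is the initial vertex.\<close>

lemma eqv_corner:
  assumes e: "e \<in> LL" and a: "\<alpha> \<in> Words None" "eqv (e \<frown> corner (color_of e) t) \<alpha>" "\<alpha> \<noteq> e \<frown> corner (color_of e) t"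
  obtains w where "w \<in> LL" "\<alpha> = w \<frown> corner (color_of w) Initial" "lam w Initial = lam e t"
    "\<And>u. e \<noteq> w @ u" "\<And>u. w \<noteq> e @ u"
proof -
  obtain p x y where p: "e \<frown> corner (color_of e) t = vertex_address p x" "\<alpha> = vertex_address p y"
    using a(2,3) unfolding eqv_def same_vertex_vertex_address by blast
  have xy: "x \<noteq> y" using a(3) p by auto
  obtain u where u: "e = p @ x # u" "u \<frown> corner (color_of e) t = initial_address (lcol x)"
    using conc_eq_vertex_address[OF p(1)] corner_not_vertex_address by blast
  let ?w = "p @ [y]"
  have w: "?w \<in> LL" using a(1) unfolding p(2) by (simp add: LL_iff)
  have c: "color_of ?w = lcol y" using color_of_last[OF w] by simp
  have \<alpha>: "\<alpha> = ?w \<frown> corner (color_of ?w) Initial" unfolding c p(2) by (simp add: vertex_address_def corner_def)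
  have i: "e \<noteq> ?w @ v" "?w \<noteq> e @ v" for v using u(1) xy by auto
  have "lam e t = lam ?w Initial" using lam_eq_iff[OF e w i] a(2) \<alpha> by simp
  then show ?thesis using that[OF w \<alpha> _ i] by simp
qed

lemma incident_corner:
  assumes e: "e \<in> LL" and n: "n \<ge> length e"
  shows "incident base_graph (prefix n (e \<frown> corner (color_of e) t)) (lam e t)"
proof -
  have "prefix n (e \<frown> corner (color_of e) t) = e @ prefix (n - length e) (corner (color_of e) t)"
    using n by (rule prefix_conc_snd)
  then show ?thesis using base.corner_incident[OF e color_of_end_state[OF e], where n = "n - length e" and t = t]
    unfolding incident_def by (metis rangeI)
qed

text \<open>Along every address of the point the late prefixes stay incident on this vertex, by
  \<open>eqv_corner\<close> and \<open>incident_corner\<close>. Uniqueness is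
  \<open>corner_all\<close> applied to the address inside \<open>e\<close>.\<close>

lemma vertex_at_corner:
  assumes e: "e \<in> LL"
  shows "vertex_at e (cls (e \<frown> corner (color_of e) t)) = lam e t"
  unfolding vertex_at_def
proof (rule the_equality)
  let ?\<gamma> = "e \<frown> corner (color_of e) t"
  have \<gamma>: "?\<gamma> \<in> Words None" using LL_conc[OF e] by simp
  have "\<exists>N. \<forall>n\<ge>N. incident base_graph (prefix n \<alpha>) (lam e t)" if \<alpha>: "\<alpha> \<in> cls ?\<gamma>" for \<alpha>
  proof (cases "\<alpha> = ?\<gamma>")
    case True
    show ?thesis unfolding True using incident_corner[OF e] by blast
  next
    case False
    have a: "\<alpha> \<in> Words None" "eqv ?\<gamma> \<alpha>" using \<alpha> unfolding mem_cls by blast+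
    obtain w where w: "w \<in> LL" "\<alpha> = w \<frown> corner (color_of w) Initial" "lam w Initial = lam e t"
      by (rule eqv_corner[OF e a False])
    show ?thesis unfolding w(2) w(3)[symmetric] using incident_corner[OF w(1)] by blast
  qed
  then show "incident base_graph e (lam e t) \<and>
      (\<forall>\<alpha>\<in>cls ?\<gamma>. \<exists>N. \<forall>n\<ge>N. incident base_graph (prefix n \<alpha>) (lam e t))"
    unfolding incident_def by blast
  fix v assume v: "incident base_graph e v \<and>
      (\<forall>\<alpha>\<in>cls ?\<gamma>. \<exists>N. \<forall>n\<ge>N. incident base_graph (prefix n \<alpha>) v)"
  then obtain t' where t': "v = lam e t'" unfolding incident_def by blast
  have "?\<gamma> \<in> cls ?\<gamma>" unfolding mem_cls using \<gamma> by simp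
  then obtain N where N: "\<And>n. n \<ge> N \<Longrightarrow> incident base_graph (prefix n ?\<gamma>) v" using v by blast
  have "corner (color_of e) t = corner (color_of e) t'"
  proof (rule base.corner_all[OF e color_of_end_state[OF e] corner_Words])
    fix n assume n: "N \<le> n"
    have "incident base_graph (prefix (length e + n) ?\<gamma>) v" by (rule N) (use n in simp)
    moreover have "prefix (length e + n) ?\<gamma> = e @ prefix n (corner (color_of e) t)"
      using prefix_conc_snd[of e "length e + n"] by simp
    ultimately show "\<exists>ta. lam (e @ prefix n (corner (color_of e) t)) ta = lam e t'"
      unfolding incident_def t' by (metis rangeE)
  qed
  then show "v = lam e t" using corner_inj t' by blast
qed

lemma prefix_eqD: "prefix n \<alpha> = e \<Longrightarrow> \<alpha> = e \<frown> suffix n \<alpha>"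
  by (erule subst) (rule prefix_suffix)

lemma cell_eq: "e \<in> LL \<Longrightarrow> cell e = {cls (e \<frown> \<beta>) |\<beta>. \<beta> \<in> Words (Some (color_of e))}"
proof -
  assume e: "e \<in> LL"
  have "{\<alpha> \<in> OM. prefix (length e) \<alpha> = e} = {e \<frown> \<beta> |\<beta>. \<beta> \<in> Words (Some (color_of e))}"
  proof (intro equalityI subsetI)
    fix \<alpha> assume a: "\<alpha> \<in> {\<alpha> \<in> OM. prefix (length e) \<alpha> = e}"
    then obtain \<beta> where b: "\<alpha> = e \<frown> \<beta>" "\<alpha> \<in> Words None" unfolding OM_Words using prefix_eqD by blast
    then have "\<beta> \<in> Words (Some (color_of e))" using LL_conc[OF e, of \<beta>] by blast
    then show "\<alpha> \<in> {e \<frown> \<beta> |\<beta>. \<beta> \<in> Words (Some (color_of e))}" using b(1) by blast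
  next
    fix \<alpha> assume "\<alpha> \<in> {e \<frown> \<beta> |\<beta>. \<beta> \<in> Words (Some (color_of e))}"
    then show "\<alpha> \<in> {\<alpha> \<in> OM. prefix (length e) \<alpha> = e}" using LL_conc[OF e] unfolding OM_Words by auto
  qed
  then show ?thesis unfolding cell_def by auto
qed

text \<open>The complement of the cell is open, and so is the cell without its inner corners; a
  boundary point can only be an inner corner. The terminal corner of a red cell falls into the open
  part.\<close>

lemma cell_boundary:
  assumes e: "e \<in> LL" and p: "p \<in> cell_bd e"
  shows "\<exists>t. inner (color_of e) t \<and> p = cls (e \<frown> corner (color_of e) t)"
proof (rule ccontr)
  let ?c = "color_of e"
  define C where "C = {cls (e \<frown> corner ?c t) |t. inner ?c t}"
  assume "\<not> ?thesis"
  then have pC: "p \<notin> C" unfolding C_def by blast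
  have \<gamma>: "e \<frown> corner ?c t \<in> Words None" for t using LL_conc[OF e] by simp
  \<comment> \<open>A word outside the cell represents one of its points only if it is glued to a
    word inside, and the latter must then be an inner corner.\<close>
  have mem: "cls \<alpha> \<in> cell e \<longleftrightarrow> (\<exists>\<beta>. \<alpha> = e \<frown> \<beta>) \<or> cls \<alpha> \<in> C" if \<alpha>: "\<alpha> \<in> Words None" for \<alpha>
  proof
    assume "cls \<alpha> \<in> cell e"
    then obtain \<beta> where \<beta>: "cls \<alpha> = cls (e \<frown> \<beta>)" "\<beta> \<in> Words (Some ?c)" unfolding cell_eq[OF e] by blast
    have eb: "e \<frown> \<beta> \<in> Words None" using LL_conc[OF e] \<beta>(2) by blast
    have q: "eqv (e \<frown> \<beta>) \<alpha>" using cls_eq[OF \<alpha> eb] \<beta>(1) eqv_sym by blast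
    show "(\<exists>\<beta>. \<alpha> = e \<frown> \<beta>) \<or> cls \<alpha> \<in> C"
    proof (cases "\<alpha> = e \<frown> \<beta>")
      case False
      then obtain q x y where q: "e \<frown> \<beta> = vertex_address q x" "\<alpha> = vertex_address q y" using q unfolding eqv_def same_vertex_vertex_address by blast
      from conc_eq_vertex_address[OF q(1)] show ?thesis
      proof
        assume "\<exists>t. q = e @ t \<and> \<beta> = vertex_address t x"
        then obtain t where "q = e @ t" by blast
        then have "\<alpha> = e \<frown> vertex_address t y" using q(2) by (simp add: vertex_address_conc)
        then show ?thesis by blast
      next
        assume "\<exists>u. e = q @ x # u \<and> u \<frown> \<beta> = initial_address (lcol x)"
        then obtain u where u: "e = q @ x # u" "u \<frown> \<beta> = initial_address (lcol x)" by blast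
        have "\<exists>t. inner ?c t \<and> \<beta> = corner ?c t"
        proof (cases u)
          case Nil
          then have "?c = lcol x" using color_of_last[OF e] u(1) by simp
          then have "\<beta> = corner ?c Initial" using u(2) Nil by (simp add: corner_def)
          then show ?thesis by (intro exI[of _ Initial]) (simp add: inner_def)
        next
          case (Cons z v)
          then have z: "z = first_letter (lcol x)" "I3w = v \<frown> \<beta>" using u(2) by (simp_all add: initial_address_first)
          have v: "\<beta> = I3w" "set v \<subseteq> {I Third}" using I3w_suffix[OF z(2)] by blast+
          have "last (z # v) \<in> {z, I Third}"
          proof (cases "v = []")
            case False
            then have "last v = I Third" using v(2) last_in_set by blast
            then show ?thesis using False by simp
          qed simp
          then have "?c = Blue" using color_of_last[OF e] u(1) Cons z(1) by auto
          then have "\<beta> = corner ?c Terminal" "inner ?c Terminal" using v(1) by (simp_all add: corner_def inner_def)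
          then show ?thesis by blast
        qed
        then show ?thesis using \<beta>(1) unfolding C_def by blast
      qed
    qed blast
  next
    assume "(\<exists>\<beta>. \<alpha> = e \<frown> \<beta>) \<or> cls \<alpha> \<in> C"
    then show "cls \<alpha> \<in> cell e"
    proof
      assume "\<exists>\<beta>. \<alpha> = e \<frown> \<beta>"
      then obtain \<beta> where b: "\<alpha> = e \<frown> \<beta>" by blast
      have "\<beta> \<in> Words (Some ?c)" using \<alpha> LL_conc[OF e] unfolding b by blast
      then show ?thesis unfolding cell_eq[OF e] b by blast
    next
      assume "cls \<alpha> \<in> C"
      then show ?thesis unfolding cell_eq[OF e] C_def using corner_Words by blast
    qed
  qed
  \<comment> \<open>Failure of gluing shows at a single length \<open>n\<close>, so it persists for
    all words with the same prefix of that length.\<close>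
  have far: "\<exists>m. \<forall>\<beta>\<in>OM. prefix m \<beta> = prefix m \<alpha> \<longrightarrow> cls \<beta> \<noteq> cls (e \<frown> corner ?c t)"
    if \<alpha>: "\<alpha> \<in> Words None" "cls \<alpha> \<noteq> cls (e \<frown> corner ?c t)" for \<alpha> t
  proof -
    let ?g = "e \<frown> corner ?c t"
    let ?S = "\<lambda>\<beta> n. \<exists>v. incident base_graph (prefix n \<beta>) v \<and> incident base_graph (prefix n ?g) v"
    have glu: "(\<beta>, ?g) \<in> gluing base_graph \<longleftrightarrow> (\<forall>n>0. ?S \<beta> n)" if "\<beta> \<in> Words None" for \<beta>
      unfolding gluing_def OM_Words using that \<gamma>[of t] by simp
    have cg: "cls \<beta> = cls ?g \<longleftrightarrow> (\<beta>, ?g) \<in> gluing base_graph" if "\<beta> \<in> Words None" for \<beta>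
      unfolding gluing_eqv using that \<gamma>[of t] cls_eq[OF that \<gamma>[of t]] by simp
    obtain n where n: "n > 0" "\<not> ?S \<alpha> n" using \<alpha>(2) unfolding cg[OF \<alpha>(1)] glu[OF \<alpha>(1)] by blast
    have "cls \<beta> \<noteq> cls ?g" if b: "\<beta> \<in> OM" "prefix n \<beta> = prefix n \<alpha>" for \<beta>
    proof
      have O: "\<beta> \<in> Words None" using b(1) unfolding OM_Words .
      assume "cls \<beta> = cls ?g"
      then have "?S \<beta> n" using n(1) unfolding cg[OF O] glu[OF O] by blast
      then show False using n(2) unfolding b(2) by blast
    qed
    then show ?thesis by blast
  qed
  have farC: "\<exists>m. \<forall>\<beta>\<in>OM. prefix m \<beta> = prefix m \<alpha> \<longrightarrow> cls \<beta> \<notin> C"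
    if \<alpha>: "\<alpha> \<in> Words None" "cls \<alpha> \<notin> C" for \<alpha>
  proof -
    define R where "R t m \<longleftrightarrow> (\<forall>\<beta>\<in>OM. prefix m \<beta> = prefix m \<alpha> \<longrightarrow> inner ?c t \<longrightarrow> cls \<beta> \<noteq> cls (e \<frown> corner ?c t))" for t m
    have "\<exists>m. R t m" for t
    proof (cases "inner ?c t")
      case True
      then have "cls \<alpha> \<noteq> cls (e \<frown> corner ?c t)" using \<alpha>(2) unfolding C_def by blast
      from far[OF \<alpha>(1) this] show ?thesis
        unfolding R_def by (rule ex_forward) simp
    next
      case False
      then show ?thesis unfolding R_def by simp
    qed
    then obtain k m where km: "R Initial k" "R Terminal m" by blast
    have "cls \<beta> \<notin> C" if b: "\<beta> \<in> OM" "prefix (k + m) \<beta> = prefix (k + m) \<alpha>" for \<beta>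
    proof -
      have "prefix k \<beta> = prefix k \<alpha>" "prefix m \<beta> = prefix m \<alpha>"
        using arg_cong[OF b(2), of "take k"] arg_cong[OF b(2), of "take m"] by simp_all
      then have "inner ?c Initial \<longrightarrow> cls \<beta> \<noteq> cls (e \<frown> corner ?c Initial)"
        "inner ?c Terminal \<longrightarrow> cls \<beta> \<noteq> cls (e \<frown> corner ?c Terminal)"
        using bspec[OF km(1)[unfolded R_def] b(1)] bspec[OF km(2)[unfolded R_def] b(1)] by simp_all
      then have "inner ?c t \<longrightarrow> cls \<beta> \<noteq> cls (e \<frown> corner ?c t)" for t by (cases t) simp_all
      then show ?thesis unfolding C_def by blast
    qed
    then show ?thesis by blast
  qed
  have sat: "{\<alpha> \<in> OM. cls \<alpha> \<in> cell e - C} = {\<alpha> \<in> OM. prefix (length e) \<alpha> = e \<and> cls \<alpha> \<notin> C}"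
    "{\<alpha> \<in> OM. cls \<alpha> \<in> limit_space - cell e} = {\<alpha> \<in> OM. prefix (length e) \<alpha> \<noteq> e \<and> cls \<alpha> \<notin> C}"
  proof -
    have ext: "prefix (length e) \<alpha> = e \<longleftrightarrow> (\<exists>\<beta>. \<alpha> = e \<frown> \<beta>)" for \<alpha>
    proof
      assume "prefix (length e) \<alpha> = e"
      then show "\<exists>\<beta>. \<alpha> = e \<frown> \<beta>" using prefix_eqD by blast
    qed auto
    have mem': "cls \<alpha> \<in> cell e \<longleftrightarrow> prefix (length e) \<alpha> = e \<or> cls \<alpha> \<in> C" if "\<alpha> \<in> OM" for \<alpha>
      unfolding ext by (rule mem) (use that in \<open>simp only: OM_Words\<close>)
    have lim: "cls \<alpha> \<in> limit_space" if "\<alpha> \<in> OM" for \<alpha> using that unfolding OM_Words by simp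
    show "{\<alpha> \<in> OM. cls \<alpha> \<in> cell e - C} = {\<alpha> \<in> OM. prefix (length e) \<alpha> = e \<and> cls \<alpha> \<notin> C}"
      using mem' by blast
    show "{\<alpha> \<in> OM. cls \<alpha> \<in> limit_space - cell e} = {\<alpha> \<in> OM. prefix (length e) \<alpha> \<noteq> e \<and> cls \<alpha> \<notin> C}"
      using mem' lim by blast
  qed
  have opn: "openin (Omega_top base_graph) {\<alpha> \<in> OM. P (prefix (length e) \<alpha>) \<and> cls \<alpha> \<notin> C}" for P
  proof (rule openin_Omega_top)
    fix \<alpha> assume a: "\<alpha> \<in> {\<alpha> \<in> OM. P (prefix (length e) \<alpha>) \<and> cls \<alpha> \<notin> C}"
    then obtain m where m: "\<forall>\<beta>\<in>OM. prefix m \<beta> = prefix m \<alpha> \<longrightarrow> cls \<beta> \<notin> C" using farC unfolding OM_Words by blast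
    let ?m = "m + length e"
    have "\<beta> \<in> {\<alpha> \<in> OM. P (prefix (length e) \<alpha>) \<and> cls \<alpha> \<notin> C}" if b: "\<beta> \<in> OM" "prefix ?m \<beta> = prefix ?m \<alpha>" for \<beta>
    proof -
      have "prefix m \<beta> = prefix m \<alpha>" "prefix (length e) \<beta> = prefix (length e) \<alpha>"
        using arg_cong[OF b(2), of "take m"] arg_cong[OF b(2), of "take (length e)"] by simp_all
      then show ?thesis using m b(1) a by auto
    qed
    then show "\<exists>m. \<forall>\<beta>\<in>OM. prefix m \<beta> = prefix m \<alpha> \<longrightarrow> \<beta> \<in> {\<alpha> \<in> OM. P (prefix (length e) \<alpha>) \<and> cls \<alpha> \<notin> C}" by blast
  qed blast
  have sub: "cell e \<subseteq> limit_space" unfolding cell_eq[OF e] using LL_conc[OF e] by auto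
  have o1: "openin limit_top (cell e - C)"
    unfolding openin_limit_top sat(1) using opn[of "\<lambda>w. w = e"] sub by (intro conjI) auto
  have o2: "openin limit_top (limit_space - cell e)"
    unfolding openin_limit_top sat(2) using opn[of "\<lambda>w. w \<noteq> e"] by (intro conjI) auto
  have fr: "p \<in> limit_top closure_of cell e" "p \<notin> limit_top interior_of cell e"
    using p unfolding cell_bd_def frontier_of_def by simp_all
  have "closedin limit_top (cell e)" unfolding closedin_def topspace_limit_top using o2 sub by simp
  then have "p \<in> cell e" using fr(1) by (simp add: closure_of_closedin)
  then have "p \<in> cell e - C" using pC by simp
  moreover have "cell e - C \<subseteq> limit_top interior_of cell e" by (rule interior_of_maximal[OF _ o1]) simp
  ultimately show False using fr(2) by (meson subsetD)
qed

section \<open>From gluing-preserving maps to diagrams\<close>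

lemma relabel:
  assumes "\<And>i j. i \<in> S \<Longrightarrow> j \<in> S \<Longrightarrow> p i = p j \<longleftrightarrow> q i = q j"
  obtains f where "bij_betw f (p ` S) (q ` S)" "\<And>i. i \<in> S \<Longrightarrow> f (p i) = q i"
proof -
  define f where "f v = q (SOME i. i \<in> S \<and> p i = v)" for v
  have f: "f (p i) = q i" if i: "i \<in> S" for i
  proof -
    have "(SOME j. j \<in> S \<and> p j = p i) \<in> S \<and> p (SOME j. j \<in> S \<and> p j = p i) = p i"
      by (rule someI[of _ i]) (use i in simp)
    then show ?thesis using assms i unfolding f_def by blast
  qed
  have "bij_betw f (p ` S) (q ` S)"
    unfolding bij_betw_def inj_on_def using f assms by (auto simp: image_image)
  then show ?thesis using that f by blast
qed

text \<open>The words of length \<open>Suc N\<close> form the domain partition and their images the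
  range partition. Equality of boundary vertices is gluing of inner corners, hence preserved; it
  remains to orient the edges correctly and to treat red terminal vertices, each of which belongs to
  one edge only.\<close>

lemma gluing_maps_imp_EG:
  assumes H: "\<Phi> \<in> gluing_maps" shows "limit_map \<Phi> \<in> carrier EG"
proof -
  obtain N where N: "\<And>w. w \<in> LL \<Longrightarrow> N \<le> length w \<Longrightarrow> \<exists>w'. acts_on_cell \<Phi> w w'" using gluing_maps_locE[OF H] by blast
  define P where "P = {w \<in> LL. length w = Suc N}"
  have cP: "prefix_code P"
    unfolding prefix_code_def
  proof (intro conjI ballI)
    show "finite P" unfolding P_def by (rule finite_subset[OF _ finite_valid_length[of None "Suc N"]]) (auto simp: LL_iff)
    show "P \<subseteq> LL" by (auto simp: P_def)
    show "\<exists>e\<in>P. \<exists>\<beta>. \<alpha> = e \<frown> \<beta>" if \<alpha>: "\<alpha> \<in> Words None" for \<alpha>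
    proof -
      obtain w \<beta> where w: "\<alpha> = w \<frown> \<beta>" "length w = Suc N" "valid None w" by (rule Words_split[OF \<alpha>])
      then have "w \<in> P" by (auto simp: P_def LL_iff)
      then show ?thesis using w(1) by blast
    qed
    show "\<forall>u. e @ u \<in> P \<longrightarrow> u = []" if "e \<in> P" for e using that by (auto simp: P_def)
  qed
  have P: "e \<in> LL" if "e \<in> P" for e using that by (simp add: P_def)
  have "\<forall>w\<in>P. \<exists>w'. acts_on_cell \<Phi> w w'" using N by (auto simp: P_def)
  from bchoice[OF this] obtain f where "\<forall>w\<in>P. acts_on_cell \<Phi> w (f w)" by blast
  then have f: "f e \<in> LL" "color_of (f e) = color_of e"
    "\<exists>l\<in>GG (color_of e). \<forall>\<alpha>\<in>Words (Some (color_of e)). \<Phi> (e \<frown> \<alpha>) = f e \<frown> l \<alpha>" if "e \<in> P" for e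
    using that unfolding acts_on_cell_def by blast+
  then have "\<forall>e\<in>P. \<exists>l. l \<in> GG (color_of e) \<and> (\<forall>\<alpha>\<in>Words (Some (color_of e)). \<Phi> (e \<frown> \<alpha>) = f e \<frown> l \<alpha>)" by blast
  from bchoice[OF this] obtain l where l: "\<And>e. e \<in> P \<Longrightarrow> l e \<in> GG (color_of e)"
    "\<And>e \<alpha>. e \<in> P \<Longrightarrow> \<alpha> \<in> Words (Some (color_of e)) \<Longrightarrow> \<Phi> (e \<frown> \<alpha>) = f e \<frown> l e \<alpha>" by blast
  have surj: "\<exists>\<alpha>\<in>Words (Some (color_of e)). l e \<alpha> = \<beta>" if "e \<in> P" "\<beta> \<in> Words (Some (color_of e))" for e \<beta>
    using GG_inverse[OF l(1)[OF that(1)]] that(2) GG_Words by blast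
  have inj\<Phi>: "inj_on \<Phi> (Words None)" using H by (auto simp: gluing_maps_def bij_betw_def)
  \<comment> \<open>If one image word is a prefix of another, the image cells have a common word,
    and its preimage under the injective \<Phi> lies in both cells.\<close>
  have ff: "e = e'" if h: "e \<in> P" "e' \<in> P" "f e @ u = f e'" for e e' u
  proof -
    have "f e' \<in> LL" using f(1)[OF h(2)] .
    then have u: "valid (Some (color_of e)) u" "end_state (Some (color_of e)) u = Some (color_of e')"
      using LL_append[OF f(1)[OF h(1)], of u] color_append[OF f(1)[OF h(1)], of u] h(3) f(2)[OF h(1)] f(2)[OF h(2)] by auto
    obtain \<beta> where b: "\<beta> \<in> Words (Some (color_of e'))" using Words_nonempty by blast
    then obtain \<alpha>' where a': "\<alpha>' \<in> Words (Some (color_of e'))" "l e' \<alpha>' = \<beta>" using surj[OF h(2)] by blast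
    have "u \<frown> \<beta> \<in> Words (Some (color_of e))" using u b by simp
    then obtain \<alpha> where a: "\<alpha> \<in> Words (Some (color_of e))" "l e \<alpha> = u \<frown> \<beta>" using surj[OF h(1)] by blast
    have "\<Phi> (e \<frown> \<alpha>) = \<Phi> (e' \<frown> \<alpha>')" using l(2)[OF h(1) a(1)] l(2)[OF h(2) a'(1)] a(2) a'(2) h(3) by simp
    then have "e \<frown> \<alpha> = e' \<frown> \<alpha>'"
      using inj\<Phi> a(1) a'(1) LL_conc[OF P[OF h(1)]] LL_conc[OF P[OF h(2)]] by (meson inj_onD)
    then show ?thesis using prefix_code_unique[OF cP h(1,2)] by blast
  qed
  have inj: "inj_on f P" by (rule inj_onI) (use ff[of _ _ "[]"] in simp)
  have cQ: "prefix_code (f ` P)"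
    unfolding prefix_code_def
  proof (intro conjI ballI allI impI)
    show "finite (f ` P)" using cP by (simp add: prefix_code_def)
    show "f ` P \<subseteq> LL" using f(1) by blast
    fix \<alpha> assume a: "\<alpha> \<in> Words None"
    have "\<alpha> \<in> \<Phi> ` Words None" using H a by (auto simp: gluing_maps_def bij_betw_def)
    then obtain \<beta> where b: "\<alpha> = \<Phi> \<beta>" "\<beta> \<in> Words None" by blast
    obtain e \<gamma> where e: "e \<in> P" "\<beta> = e \<frown> \<gamma>" "\<gamma> \<in> Words (Some (color_of e))" by (rule codeE[OF cP b(2)])
    have "\<alpha> = f e \<frown> l e \<gamma>" using b(1) e(2) l(2)[OF e(1,3)] by simp
    then show "\<exists>e\<in>f ` P. \<exists>\<beta>. \<alpha> = e \<frown> \<beta>" using e(1) by blast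
  next
    fix e u assume "e \<in> f ` P" "e @ u \<in> f ` P"
    then show "u = []" using ff by (metis (no_types, lifting) append_self_conv imageE)
  qed
  obtain D where D: "D \<in> expansions base_graph" "edges D = P" using prefix_code_expansion[OF cP] by blast
  obtain D' where D': "D' \<in> expansions base_graph" "edges D' = f ` P" using prefix_code_expansion[OF cQ] by blast
  have bd: "bdry D e = lam e" if "e \<in> P" for e using word_color_bdry_base(2)[OF D(1)] that D(2) by simp
  have bd': "bdry D' (f e) = lam (f e)" if "e \<in> P" for e using word_color_bdry_base(2)[OF D'(1)] that D'(2) by simp
  \<comment> \<open>Only \<open>phi3\<close> reverses an edge. A red label counts as preserving the
    direction even if it moves the terminal corner, which is not a boundary point of the
    cell.\<close>
  define \<pi> where "\<pi> e = (if color_of e = Blue \<and> l e = phi3 then swap_side else id)" for e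
  have bij\<pi>: "bij (\<pi> e)" for e
    by (rule o_bij[of "\<pi> e"]) (auto simp: \<pi>_def fun_eq_iff swap_side_def split: side.split)
  have inner\<pi>: "inner (color_of e) (\<pi> e t) \<longleftrightarrow> inner (color_of e) t" for e t
    by (auto simp: \<pi>_def inner_def)
  have corner: "l e (corner (color_of e) t) = corner (color_of e) (\<pi> e t)" if e: "e \<in> P" "inner (color_of e) t" for e t
  proof (cases "color_of e")
    case Blue
    then have "l e = idc Blue \<or> l e = phi3" using l(1)[OF e(1)] GG_Blue by simp
    then show ?thesis using Blue phi3_corner by (auto simp: \<pi>_def)
  next
    case Red
    then have "t = Initial" using e(2) by (cases t) (auto simp: inner_def)
    then show ?thesis using Red GG_initial_address l(1)[OF e(1)] by (simp add: \<pi>_def corner_def)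
  qed
  have inc: "e \<noteq> e' @ u" "f e \<noteq> f e' @ u" if "e \<in> P" "e' \<in> P" "e \<noteq> e'" for e e' u
    using that cP ff[of e' e u] unfolding prefix_code_def by (metis append_Nil2)+
  \<comment> \<open>Inner sides are compared through the gluing of their addresses. If a red
    terminal side occurs, both equations are false for distinct edges.\<close>
  have compat: "lam e t = lam e' t' \<longleftrightarrow> lam (f e) (\<pi> e t) = lam (f e') (\<pi> e' t')" if e: "e \<in> P" "e' \<in> P" for e e' t t'
  proof (cases "e = e'")
    case True
    then show ?thesis using base.noloop[OF P[OF e(2)]] base.noloop[OF f(1)[OF e(2)]] bij\<pi>[of e']
      by (auto simp: bij_def dest: injD)
  next
    case ne: False
    note L = P[OF e(1)] P[OF e(2)] inc(1)[OF e ne] inc(1)[OF e(2,1) ne[symmetric]]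
    note L' = f(1)[OF e(1)] f(1)[OF e(2)] inc(2)[OF e ne] inc(2)[OF e(2,1) ne[symmetric]]
    consider "inner (color_of e) t" "inner (color_of e') t'" | "\<not> inner (color_of e) t" | "\<not> inner (color_of e') t'" by blast
    then show ?thesis
    proof cases
      case 1
      have "f e \<frown> corner (color_of (f e)) (\<pi> e t) = \<Phi> (e \<frown> corner (color_of e) t)"
        "f e' \<frown> corner (color_of (f e')) (\<pi> e' t') = \<Phi> (e' \<frown> corner (color_of e') t')"
        using l(2)[OF e(1) corner_Words] l(2)[OF e(2) corner_Words] corner[OF e(1) 1(1)] corner[OF e(2) 1(2)] f(2)[OF e(1)] f(2)[OF e(2)]
        by simp_all
      moreover have "e \<frown> corner (color_of e) t \<in> Words None" "e' \<frown> corner (color_of e') t' \<in> Words None"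
        using LL_conc[OF L(1)] LL_conc[OF L(2)] by simp_all
      ultimately show ?thesis unfolding lam_eq_iff[OF L] lam_eq_iff[OF L'] using gluing_maps_eqv[OF H] by simp
    next
      case 2
      then have "\<not> inner (color_of (f e)) (\<pi> e t)" using inner\<pi> f(2)[OF e(1)] by simp
      then show ?thesis using lam_red_terminal[OF L 2] lam_red_terminal[OF L'] by blast
    next
      case 3
      note M = L(2,1,4,3) and M' = L'(2,1,4,3)
      have "\<not> inner (color_of (f e')) (\<pi> e' t')" using 3 inner\<pi> f(2)[OF e(2)] by simp
      then show ?thesis using lam_red_terminal[OF M 3] lam_red_terminal[OF M'] by metis
    qed
  qed
  let ?S = "P \<times> (UNIV :: side set)"
  obtain fV where fV: "bij_betw fV ((\<lambda>(e, t). lam e t) ` ?S) ((\<lambda>(e, t). lam (f e) (\<pi> e t)) ` ?S)"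
    "\<And>i. i \<in> ?S \<Longrightarrow> fV ((\<lambda>(e, t). lam e t) i) = (\<lambda>(e, t). lam (f e) (\<pi> e t)) i"
    by (rule relabel[of ?S "\<lambda>(e, t). lam e t" "\<lambda>(e, t). lam (f e) (\<pi> e t)"]) (use compat in auto)
  have V: "verts D = (\<lambda>(e, t). lam e t) ` ?S" unfolding verts_expansion[OF D(1)] D(2) using bd by force
  have V': "verts D' = (\<lambda>(e, t). lam (f e) (\<pi> e t)) ` ?S"
  proof (intro equalityI subsetI)
    fix v assume "v \<in> verts D'"
    then obtain e t where e: "e \<in> P" "v = lam (f e) t" unfolding verts_expansion[OF D'(1)] D'(2) using bd' by auto
    obtain t' where "t = \<pi> e t'" using bij\<pi>[of e] by (metis bij_pointE)
    then show "v \<in> (\<lambda>(e, t). lam (f e) (\<pi> e t)) ` ?S" using e by auto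
  next
    fix v assume "v \<in> (\<lambda>(e, t). lam (f e) (\<pi> e t)) ` ?S"
    then obtain e t where e: "e \<in> P" "v = lam (f e) (\<pi> e t)" by auto
    then have "v = bdry D' (f e) (\<pi> e t)" using bd' by simp
    then show "v \<in> verts D'" unfolding verts_expansion[OF D'(1)] D'(2) using e(1) by blast
  qed
  have iso: "pi_isomorphism D D' fV f \<pi>"
    unfolding pi_isomorphism_def D(2) D'(2)
  proof (intro conjI ballI allI)
    show "bij_betw fV (verts D) (verts D')" unfolding V V' by (rule fV(1))
    show "bij_betw f P (f ` P)" using inj by (simp add: bij_betw_def)
    show "bij (\<pi> e)" for e by (rule bij\<pi>)
    show "fV (bdry D e t) = bdry D' (f e) (\<pi> e t)" if "e \<in> P" for e t
      using fV(2)[of "(e, t)"] that bd bd' by simp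
  qed
  have hcls: "limit_map \<Phi> (cls (e \<frown> \<alpha>)) = cls (f e \<frown> l e \<alpha>)" if e: "e \<in> P" "\<alpha> \<in> Words (Some (color_of e))" for e \<alpha>
    using limit_map_cls[OF H, of "e \<frown> \<alpha>"] LL_conc[OF P[OF e(1)]] e(2) l(2)[OF e] by simp
  have hcell: "limit_map \<Phi> ` cell e = cell (f e)" if e: "e \<in> P" for e
  proof (intro equalityI subsetI)
    fix p assume "p \<in> limit_map \<Phi> ` cell e"
    then obtain \<beta> where b: "\<beta> \<in> Words (Some (color_of e))" "p = limit_map \<Phi> (cls (e \<frown> \<beta>))" unfolding cell_eq[OF P[OF e]] by blast
    then have "p = cls (f e \<frown> l e \<beta>)" using hcls[OF e] by simp
    moreover have "l e \<beta> \<in> Words (Some (color_of (f e)))" using b(1) l(1)[OF e] f(2)[OF e] by simp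
    ultimately show "p \<in> cell (f e)" unfolding cell_eq[OF f(1)[OF e]] by blast
  next
    fix p assume "p \<in> cell (f e)"
    then obtain \<beta> where b: "\<beta> \<in> Words (Some (color_of e))" "p = cls (f e \<frown> \<beta>)" unfolding cell_eq[OF f(1)[OF e]] f(2)[OF e] by blast
    obtain \<alpha> where a: "\<alpha> \<in> Words (Some (color_of e))" "l e \<alpha> = \<beta>" using surj[OF e b(1)] by blast
    then have "p = limit_map \<Phi> (cls (e \<frown> \<alpha>))" using hcls[OF e a(1)] b(2) by simp
    then show "p \<in> limit_map \<Phi> ` cell e" unfolding cell_eq[OF P[OF e]] using a(1) by blast
  qed
  have cell_sub: "cell e \<subseteq> limit_space" if "e \<in> LL" for e
    unfolding cell_eq[OF that] using LL_conc[OF that] by auto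
  have "diagram D D' fV f \<pi> l"
    unfolding diagram_def D(2)
  proof (intro conjI ballI)
    show "D \<in> expansions base_graph" "D' \<in> expansions base_graph" by (fact D(1), fact D'(1))
    show "pi_isomorphism D D' fV f \<pi>" by (rule iso)
    fix e assume e: "e \<in> P"
    show "l e \<in> GG (color_of e)" by (rule l(1)[OF e])
    have bb: "bij_betw (limit_map \<Phi>) (cell_bd e) (cell_bd (f e))"
    proof -
      have "cell_bd (f e) = limit_map \<Phi> ` cell_bd e"
        unfolding cell_bd_def hcell[OF e, symmetric]
        by (rule homeomorphic_map_frontier_of[OF limit_map_homeomorphic[OF H]]) (use cell_sub P[OF e] in simp)
      moreover have "cell_bd e \<subseteq> limit_space"
        unfolding cell_bd_def using frontier_of_subset_topspace[of limit_top] by simp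
      moreover have "inj_on (limit_map \<Phi>) limit_space" using limit_map_Bij[OF H] by (auto simp: Bij_def bij_betw_def)
      ultimately show ?thesis unfolding bij_betw_def using inj_on_subset by blast
    qed
    have ci: "cell_isomorphism e (f e) (l e) (limit_map \<Phi>)"
      unfolding cell_isomorphism_def OM_c_Words
      using P[OF e] f(1,2)[OF e] GG_Aut[OF l(1)[OF e]] GG_preserves_gluing[OF l(1)[OF e]] hcls[OF e] bb by simp
    have "vertex_at (f e) (limit_map \<Phi> p) = lam (f e) (\<pi> e (inv_into UNIV (lam e) (vertex_at e p)))" if p: "p \<in> cell_bd e" for p
    proof -
      obtain t where t: "inner (color_of e) t" "p = cls (e \<frown> corner (color_of e) t)"
        using cell_boundary[OF P[OF e] p] by blast
      have "limit_map \<Phi> p = cls (f e \<frown> corner (color_of (f e)) (\<pi> e t))"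
        using hcls[OF e corner_Words] corner[OF e t(1)] f(2)[OF e] t(2) by simp
      then have 1: "vertex_at (f e) (limit_map \<Phi> p) = lam (f e) (\<pi> e t)" using vertex_at_corner[OF f(1)[OF e]] by simp
      have "inj (lam e)" using base.noloop[OF P[OF e]] by (auto simp: inj_on_def)
      then have "inv_into UNIV (lam e) (vertex_at e p) = t" unfolding t(2) vertex_at_corner[OF P[OF e]] by (rule inv_f_f)
      then show ?thesis using 1 by simp
    qed
    then show "\<exists>F. cell_isomorphism e (f e) (l e) F \<and>
      (\<forall>p\<in>cell_bd e. vertex_at (f e) (F p) = lam (f e) (\<pi> e (inv_into UNIV (lam e) (vertex_at e p))))" using ci by blast
  qed
  moreover have "\<forall>e\<in>edges D. \<forall>\<alpha>\<in>OM_c (color_of e). limit_map \<Phi> (cls (e \<frown> \<alpha>)) = cls (f e \<frown> l e \<alpha>)"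
    using hcls unfolding D(2) OM_c_Words by blast
  ultimately have "\<exists>D D' fV fE \<pi> l. diagram D D' fV fE \<pi> l \<and>
      (\<forall>e\<in>edges D. \<forall>\<alpha>\<in>OM_c (color_of e). limit_map \<Phi> (cls (e \<frown> \<alpha>)) = cls (fE e \<frown> l e \<alpha>))" by blast
  then show ?thesis unfolding EG_def using limit_map_Bij[OF H] limit_map_homeomorphic[OF H] by simp
qed

section \<open>The group structure\<close>

lemma carrier_EG: "carrier EG = limit_map ` gluing_maps"
  using EG_imp_gluing_maps gluing_maps_imp_EG by blast

lemma EG_mult:
  assumes "\<Phi> \<in> gluing_maps" "\<Psi> \<in> gluing_maps" shows "limit_map \<Phi> \<otimes>\<^bsub>EG\<^esub> limit_map \<Psi> = limit_map (\<Phi> \<circ> \<Psi>)"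
  using limit_map_Bij[OF assms(1)] limit_map_Bij[OF assms(2)] limit_map_compose[OF assms] by (simp add: EG_def BijGroup_def)

lemma EG_one: "\<one>\<^bsub>EG\<^esub> = limit_map id"
  by (simp add: EG_def BijGroup_def limit_map_id)

lemma limit_map_carrier: "\<Phi> \<in> gluing_maps \<Longrightarrow> limit_map \<Phi> \<in> carrier EG"
  unfolding carrier_EG by (rule imageI)

lemma carrier_EG_cases:
  assumes "x \<in> carrier EG" obtains \<Phi> where "\<Phi> \<in> gluing_maps" "x = limit_map \<Phi>"
  using assms unfolding carrier_EG by (rule imageE)

lemma group_EG: "group EG"
proof (rule groupI)
  show "\<one>\<^bsub>EG\<^esub> \<in> carrier EG" unfolding EG_one by (rule limit_map_carrier[OF gluing_maps_id])
  fix x assume "x \<in> carrier EG"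
  then obtain \<Phi> where P: "\<Phi> \<in> gluing_maps" "x = limit_map \<Phi>" by (rule carrier_EG_cases)
  show "\<one>\<^bsub>EG\<^esub> \<otimes>\<^bsub>EG\<^esub> x = x" unfolding EG_one P(2) EG_mult[OF gluing_maps_id P(1)] by simp
  obtain \<Psi> where Q: "\<Psi> \<in> gluing_maps" "\<And>\<alpha>. \<alpha> \<in> Words None \<Longrightarrow> \<Psi> (\<Phi> \<alpha>) = \<alpha>" "\<And>\<alpha>. \<alpha> \<in> Words None \<Longrightarrow> \<Phi> (\<Psi> \<alpha>) = \<alpha>"
    using gluing_maps_has_inverse[OF P(1)] by blast
  have "limit_map (\<Psi> \<circ> \<Phi>) = limit_map id" by (rule limit_map_cong[OF gluing_maps_id]) (simp add: Q(2))
  then have "limit_map \<Psi> \<otimes>\<^bsub>EG\<^esub> x = \<one>\<^bsub>EG\<^esub>" unfolding P(2) EG_mult[OF Q(1) P(1)] EG_one .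
  then show "\<exists>y\<in>carrier EG. y \<otimes>\<^bsub>EG\<^esub> x = \<one>\<^bsub>EG\<^esub>" using limit_map_carrier[OF Q(1)] by (rule bexI)
  fix y assume "y \<in> carrier EG"
  then obtain \<Theta> where T: "\<Theta> \<in> gluing_maps" "y = limit_map \<Theta>" by (rule carrier_EG_cases)
  show "x \<otimes>\<^bsub>EG\<^esub> y \<in> carrier EG"
    unfolding P(2) T(2) EG_mult[OF P(1) T(1)] by (rule limit_map_carrier[OF gluing_maps_compose[OF P(1) T(1)]])
  fix z assume "z \<in> carrier EG"
  then obtain \<Xi> where X: "\<Xi> \<in> gluing_maps" "z = limit_map \<Xi>" by (rule carrier_EG_cases)
  show "x \<otimes>\<^bsub>EG\<^esub> y \<otimes>\<^bsub>EG\<^esub> z = x \<otimes>\<^bsub>EG\<^esub> (y \<otimes>\<^bsub>EG\<^esub> z)"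
    unfolding P(2) T(2) X(2) EG_mult[OF P(1) T(1)] EG_mult[OF T(1) X(1)]
      EG_mult[OF gluing_maps_compose[OF P(1) T(1)] X(1)] EG_mult[OF P(1) gluing_maps_compose[OF T(1) X(1)]]
    by (simp only: comp_assoc)
qed

section \<open>Generators\<close>

lemma suffix_build: "suffix (Suc n) (x ## \<alpha>) = suffix n \<alpha>"
  using suffix_conc_snd[of "[x]" "Suc n" \<alpha>] by simp

fun piecewise :: "(fword \<times> fword \<times> (iword \<Rightarrow> iword)) list \<Rightarrow> iword \<Rightarrow> iword" where
  "piecewise [] \<alpha> = \<alpha>"
| "piecewise ((u, v, l) # t) \<alpha> = (if prefix (length u) \<alpha> = u then v \<frown> l (suffix (length u) \<alpha>) else piecewise t \<alpha>)"

lemmas piecewise_eval = prefix_build suffix_build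

text \<open>The involution exchanging the centre of the base graph and the centre of the cell of its
  first edge.\<close>

definition root_swap :: "iword \<Rightarrow> iword" where
  "root_swap = piecewise [([Z Second], [Z First, E Second], id), ([Z Third], [Z First, E Third], id),
    ([Z First, E First], [Z First, E First], phi3),
    ([Z First, E Second], [Z Second], id), ([Z First, E Third], [Z Third], id)]"

text \<open>Inside a red cell, the map which turns an expansion of its edge and then of the blue edge
  \<open>E First\<close> into an expansion of its edge and then of the red edge \<open>E Second\<close>.\<close>

definition cell_shift :: "iword \<Rightarrow> iword" where
  "cell_shift = piecewise [([E First, I Third], [E First], id), ([E First, I Second], [E Third], id),
    ([E First, I First], [E Second, E First], phi3),
    ([E Second], [E Second, E Second], id), ([E Third], [E Second, E Third], id)]"

definition cell_shift_inv :: "iword \<Rightarrow> iword" where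
  "cell_shift_inv = piecewise [([E First], [E First, I Third], id), ([E Third], [E First, I Second], id),
    ([E Second, E First], [E First, I First], phi3),
    ([E Second, E Second], [E Second], id), ([E Second, E Third], [E Third], id)]"

definition base_perm :: "(idx \<Rightarrow> idx) \<Rightarrow> iword \<Rightarrow> iword" where
  "base_perm \<sigma> \<alpha> = Z (\<sigma> (index (\<alpha> 0))) ## suffix 1 \<alpha>"

definition at_cell :: "fword \<Rightarrow> (iword \<Rightarrow> iword) \<Rightarrow> iword \<Rightarrow> iword" where
  "at_cell z \<theta> \<alpha> = (if prefix (length z) \<alpha> = z then z \<frown> \<theta> (suffix (length z) \<alpha>) else \<alpha>)"

text \<open>The blue edge between the two centres keeps its place but exchanges its ends, hence the
  label \<open>phi3\<close>; the two red edges at one centre move to the other centre.\<close>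

lemma root_swap_simps [simp]:
  "root_swap (Z Second ## \<alpha>) = Z First ## E Second ## \<alpha>"
  "root_swap (Z Third ## \<alpha>) = Z First ## E Third ## \<alpha>"
  "root_swap (Z First ## E First ## \<alpha>) = Z First ## E First ## phi3 \<alpha>"
  "root_swap (Z First ## E Second ## \<alpha>) = Z Second ## \<alpha>"
  "root_swap (Z First ## E Third ## \<alpha>) = Z Third ## \<alpha>"
  by (simp_all add: root_swap_def piecewise_eval del: subseq_to_Suc)

lemma cell_shift_simps [simp]:
  "cell_shift (E First ## I Third ## \<alpha>) = E First ## \<alpha>"
  "cell_shift (E First ## I Second ## \<alpha>) = E Third ## \<alpha>"
  "cell_shift (E First ## I First ## \<alpha>) = E Second ## E First ## phi3 \<alpha>"
  "cell_shift (E Second ## \<alpha>) = E Second ## E Second ## \<alpha>"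
  "cell_shift (E Third ## \<alpha>) = E Second ## E Third ## \<alpha>"
  by (simp_all add: cell_shift_def piecewise_eval del: subseq_to_Suc)

lemma cell_shift_inv_simps [simp]:
  "cell_shift_inv (E First ## \<alpha>) = E First ## I Third ## \<alpha>"
  "cell_shift_inv (E Third ## \<alpha>) = E First ## I Second ## \<alpha>"
  "cell_shift_inv (E Second ## E First ## \<alpha>) = E First ## I First ## phi3 \<alpha>"
  "cell_shift_inv (E Second ## E Second ## \<alpha>) = E Second ## \<alpha>"
  "cell_shift_inv (E Second ## E Third ## \<alpha>) = E Third ## \<alpha>"
  by (simp_all add: cell_shift_inv_def piecewise_eval del: subseq_to_Suc)

lemma base_perm_simp [simp]: "base_perm \<sigma> (Z i ## \<alpha>) = Z (\<sigma> i) ## \<alpha>"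
  by (simp add: base_perm_def suffix_build)

lemma at_Nil [simp]: "at_cell [] \<theta> \<alpha> = \<theta> \<alpha>"
  by (simp add: at_cell_def)

lemma at_Cons [simp]: "at_cell (x # z) \<theta> (y ## \<alpha>) = (if x = y then y ## at_cell z \<theta> \<alpha> else y ## \<alpha>)"
  by (auto simp: at_cell_def piecewise_eval simp del: subseq_to_Suc)

lemma at_conc [simp]: "at_cell (w @ z) \<theta> (w \<frown> \<alpha>) = w \<frown> at_cell z \<theta> \<alpha>"
  by (induction w) simp_all

lemma at_same [simp]: "at_cell w \<theta> (w \<frown> \<alpha>) = w \<frown> \<theta> \<alpha>"
  using at_conc[of w "[]"] by simp

lemma at_other: "(\<And>\<beta>. \<alpha> \<noteq> z \<frown> \<beta>) \<Longrightarrow> at_cell z \<theta> \<alpha> = \<alpha>"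
  using prefix_eqD unfolding at_cell_def by metis

lemma Words_None_cases:
  assumes "\<alpha> \<in> Words None" obtains i \<beta> where "\<alpha> = Z i ## \<beta>" "\<beta> \<in> Words (Some Red)"
  using assms by (rule Words_cases) (auto simp: allowed_None)

lemma Words_Red_cases:
  assumes "\<alpha> \<in> Words (Some Red)"
  obtains \<beta> where "\<alpha> = E First ## \<beta>" "\<beta> \<in> Words (Some Blue)"
  | \<beta> where "\<alpha> = E Second ## \<beta>" "\<beta> \<in> Words (Some Red)"
  | \<beta> where "\<alpha> = E Third ## \<beta>" "\<beta> \<in> Words (Some Red)"
proof -
  obtain x \<beta> where x: "\<alpha> = x ## \<beta>" "allowed (Some Red) x" "\<beta> \<in> Words (Some (lcol x))" using assms by (rule Words_cases)
  then obtain i where "x = E i" by (auto simp: allowed_Red)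
  then show ?thesis using x that by (cases i) auto
qed

lemma Words_Blue_cases:
  assumes "\<alpha> \<in> Words (Some Blue)"
  obtains \<beta> where "\<alpha> = I First ## \<beta>" "\<beta> \<in> Words (Some Blue)"
  | \<beta> where "\<alpha> = I Second ## \<beta>" "\<beta> \<in> Words (Some Red)"
  | \<beta> where "\<alpha> = I Third ## \<beta>" "\<beta> \<in> Words (Some Blue)"
proof -
  obtain x \<beta> where x: "\<alpha> = x ## \<beta>" "allowed (Some Blue) x" "\<beta> \<in> Words (Some (lcol x))" using assms by (rule Words_cases)
  then obtain i where "x = I i" by (auto simp: allowed_Blue)
  then show ?thesis using x that by (cases i) auto
qed

lemma phi3_Words [simp]: "\<alpha> \<in> Words (Some Blue) \<Longrightarrow> phi3 \<alpha> \<in> Words (Some Blue)"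
  using GG_Words[OF phi3_GG] .

lemma phi3_phi3 [simp]: "\<alpha> \<in> Words (Some Blue) \<Longrightarrow> phi3 (phi3 \<alpha>) = \<alpha>"
  by (erule Words_Blue_cases) (simp_all add: phi3_simps phi3_simps(3)[OF I3w_Words])

lemma phi3_I3w [simp]: "phi3 I3w = initial_address Blue" "phi3 (initial_address Blue) = I3w" "phi3 (I First ## I3w) = I3w"
  using phi3_corner[of Terminal] phi3_corner[of Initial] by (simp_all add: corner_def swap_side_def initial_address_def)

lemma initial_address_simps: "initial_address Red = E First ## I3w" "initial_address Blue = I First ## I3w"
  by (simp_all add: initial_address_def)


lemma eqv_adrs: "eqv (vertex_address e x) (vertex_address e y)"
  by (auto simp: eqv_vertex_address)

lemma allowed_Red_cases:
  assumes "allowed (Some Red) x" obtains "x = E First" | "x = E Second" | "x = E Third"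
proof -
  obtain i where "x = E i" using assms by (auto simp: allowed_Red)
  then show ?thesis using that by (cases i) auto
qed

lemma allowed_Blue_cases:
  assumes "allowed (Some Blue) x" obtains "x = I First" | "x = I Second" | "x = I Third"
proof -
  obtain i where "x = I i" using assms by (auto simp: allowed_Blue)
  then show ?thesis using that by (cases i) auto
qed

lemma allowed_None_cases:
  assumes "allowed None x" obtains "x = Z First" | "x = Z Second" | "x = Z Third"
proof -
  obtain i where "x = Z i" using assms by (auto simp: allowed_None)
  then show ?thesis using that by (cases i) auto
qed

lemma I3_I3w [simp]: "I Third ## I3w = I3w"
  using I3w_unfold by simp

section \<open>The generators respect the gluing relation\<close>

lemma eqv_from_vertex_address:
  assumes "\<And>e x y. valid s (e @ [x]) \<Longrightarrow> valid s (e @ [y]) \<Longrightarrow> eqv (\<Phi> (vertex_address e x)) (\<Phi> (vertex_address e y))"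
    and "\<alpha> \<in> Words s" "\<beta> \<in> Words s" "eqv \<alpha> \<beta>"
  shows "eqv (\<Phi> \<alpha>) (\<Phi> \<beta>)"
proof (cases "\<alpha> = \<beta>")
  case False
  then obtain e x y where e: "\<alpha> = vertex_address e x" "\<beta> = vertex_address e y" using assms(4) unfolding eqv_def same_vertex_vertex_address by blast
  then have "valid s (e @ [x])" "valid s (e @ [y])" using assms(2,3) by simp_all
  then show ?thesis using assms(1) e by blast
qed simp

lemma phi3_eqv: "valid (Some Blue) (e @ [x]) \<Longrightarrow> valid (Some Blue) (e @ [y]) \<Longrightarrow> eqv (phi3 (vertex_address e x)) (phi3 (vertex_address e y))"
  using GG_eqv[OF phi3_GG, of "vertex_address e x" "vertex_address e y"] eqv_adrs by simp

text \<open>Two branch points are torn apart by the pieces of the map: the centre of the red cell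
  and the centre of \<open>E First\<close>. They go to the centre of \<open>E Second\<close> and to
  the centre of the red cell. All other branch points are created inside a single piece, which acts
  by a change of prefix or by \<open>phi3\<close>.\<close>

lemma cell_shift_eqv:
  assumes "valid (Some Red) (e @ [x])" "valid (Some Red) (e @ [y])"
  shows "eqv (cell_shift (vertex_address e x)) (cell_shift (vertex_address e y))"
proof (cases e)
  case Nil
  have "\<exists>y. cell_shift (vertex_address [] x) = vertex_address [E Second] y" if "allowed (Some Red) x" for x
    using that by (rule allowed_Red_cases) (auto simp: vertex_address_def initial_address_simps)
  then show ?thesis using Nil assms eqv_adrs by (metis append_Nil valid.simps(2))
next
  case (Cons z e1)
  then have "allowed (Some Red) z" using assms by simp
  then show ?thesis
  proof (cases rule: allowed_Red_cases)
    case 1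
    show ?thesis
    proof (cases e1)
      case Nil
      have "\<exists>y. cell_shift (vertex_address [E First] x) = vertex_address [] y" if "allowed (Some Blue) x" for x
        using that by (rule allowed_Blue_cases) (auto simp: vertex_address_def initial_address_simps)
      then show ?thesis using Nil Cons 1 assms eqv_adrs by (metis append_Cons append_Nil valid.simps(2) lcol.simps(3))
    next
      case (Cons y1 e2)
      then have "allowed (Some Blue) y1" using assms \<open>e = z # e1\<close> 1 by simp
      then show ?thesis using assms \<open>e = z # e1\<close> 1 Cons phi3_eqv[of e2 x y]
        by (cases rule: allowed_Blue_cases) (simp_all flip: vertex_address_build add: eqv_build eqv_adrs)
    qed
  qed (use Cons assms in \<open>simp_all flip: vertex_address_build add: eqv_build eqv_adrs\<close>)
qed

lemma cell_shift_inv_eqv: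
  assumes "valid (Some Red) (e @ [x])" "valid (Some Red) (e @ [y])"
  shows "eqv (cell_shift_inv (vertex_address e x)) (cell_shift_inv (vertex_address e y))"
proof (cases e)
  case Nil
  have "\<exists>y. cell_shift_inv (vertex_address [] x) = vertex_address [E First] y" if "allowed (Some Red) x" for x
    using that by (rule allowed_Red_cases) (auto simp: vertex_address_def initial_address_simps)
  then show ?thesis using Nil assms eqv_adrs by (metis append_Nil valid.simps(2))
next
  case (Cons z e1)
  then have "allowed (Some Red) z" using assms by simp
  then show ?thesis
  proof (cases rule: allowed_Red_cases)
    case 2
    show ?thesis
    proof (cases e1)
      case Nil
      have "\<exists>y. cell_shift_inv (vertex_address [E Second] x) = vertex_address [] y" if "allowed (Some Red) x" for x
        using that by (rule allowed_Red_cases) (auto simp: vertex_address_def initial_address_simps)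
      then show ?thesis using Nil Cons 2 assms eqv_adrs by (metis append_Cons append_Nil valid.simps(2) lcol.simps(3) idx.distinct(1))
    next
      case (Cons y1 e2)
      then have "allowed (Some Red) y1" using assms \<open>e = z # e1\<close> 2 by simp
      then show ?thesis using assms \<open>e = z # e1\<close> 2 Cons phi3_eqv[of e2 x y]
        by (cases rule: allowed_Red_cases) (simp_all flip: vertex_address_build add: eqv_build eqv_adrs)
    qed
  qed (use Cons assms in \<open>simp_all flip: vertex_address_build add: eqv_build eqv_adrs\<close>)
qed

lemma root_swap_eqv:
  assumes "valid None (e @ [x])" "valid None (e @ [y])"
  shows "eqv (root_swap (vertex_address e x)) (root_swap (vertex_address e y))"
proof (cases e)
  case Nil
  have "\<exists>y. root_swap (vertex_address [] x) = vertex_address [Z First] y" if "allowed None x" for x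
    using that by (rule allowed_None_cases) (auto simp: vertex_address_def initial_address_simps)
  then show ?thesis using Nil assms eqv_adrs by (metis append_Nil valid.simps(2))
next
  case (Cons z e1)
  then have "allowed None z" using assms by simp
  then show ?thesis
  proof (cases rule: allowed_None_cases)
    case 1
    show ?thesis
    proof (cases e1)
      case Nil
      have "\<exists>y. root_swap (vertex_address [Z First] x) = vertex_address [] y" if "allowed (Some Red) x" for x
        using that by (rule allowed_Red_cases) (auto simp: vertex_address_def initial_address_simps)
      then show ?thesis using Nil Cons 1 assms eqv_adrs by (metis append_Cons append_Nil valid.simps(2) lcol.simps(1))
    next
      case (Cons y1 e2)
      then have "allowed (Some Red) y1" using assms \<open>e = z # e1\<close> 1 by simp
      then show ?thesis using assms \<open>e = z # e1\<close> 1 Cons phi3_eqv[of e2 x y]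
        by (cases rule: allowed_Red_cases) (simp_all flip: vertex_address_build add: eqv_build eqv_adrs)
    qed
  qed (use Cons assms in \<open>simp_all flip: vertex_address_build add: eqv_build eqv_adrs\<close>)
qed

section \<open>The generators are gluing maps\<close>

lemma gluing_maps_intro:
  assumes O: "\<And>\<alpha>. \<alpha> \<in> Words None \<Longrightarrow> \<Phi> \<alpha> \<in> Words None" "\<And>\<alpha>. \<alpha> \<in> Words None \<Longrightarrow> \<Psi> \<alpha> \<in> Words None"
    and inv: "\<And>\<alpha>. \<alpha> \<in> Words None \<Longrightarrow> \<Psi> (\<Phi> \<alpha>) = \<alpha>" "\<And>\<alpha>. \<alpha> \<in> Words None \<Longrightarrow> \<Phi> (\<Psi> \<alpha>) = \<alpha>"
    and fw: "\<And>e x y. valid None (e @ [x]) \<Longrightarrow> valid None (e @ [y]) \<Longrightarrow> eqv (\<Phi> (vertex_address e x)) (\<Phi> (vertex_address e y))"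
      "\<And>e x y. valid None (e @ [x]) \<Longrightarrow> valid None (e @ [y]) \<Longrightarrow> eqv (\<Psi> (vertex_address e x)) (\<Psi> (vertex_address e y))"
    and lc: "\<And>w. w \<in> LL \<Longrightarrow> N \<le> length w \<Longrightarrow> \<exists>v u v'. w = v @ u \<and> v \<in> LL \<and> acts_on_cell \<Phi> v v'"
  shows "\<Phi> \<in> gluing_maps"
proof -
  have "bij_betw \<Phi> (Words None) (Words None)"
    by (rule bij_betw_byWitness[where f' = \<Psi>]) (use O inv in auto)
  moreover have "eqv (\<Phi> \<alpha>) (\<Phi> \<beta>) \<longleftrightarrow> eqv \<alpha> \<beta>" if ab: "\<alpha> \<in> Words None" "\<beta> \<in> Words None" for \<alpha> \<beta>
  proof
    show "eqv \<alpha> \<beta>" if "eqv (\<Phi> \<alpha>) (\<Phi> \<beta>)"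
      using eqv_from_vertex_address[where \<Phi> = \<Psi>, OF fw(2) O(1)[OF ab(1)] O(1)[OF ab(2)] that] inv(1) ab by simp
    show "eqv (\<Phi> \<alpha>) (\<Phi> \<beta>)" if "eqv \<alpha> \<beta>" by (rule eqv_from_vertex_address[where \<Phi> = \<Phi>, OF fw(1) ab that])
  qed
  moreover have "\<exists>w'. acts_on_cell \<Phi> w w'" if w: "w \<in> LL" "N \<le> length w" for w
  proof -
    obtain v u v' where v: "w = v @ u" "v \<in> LL" "acts_on_cell \<Phi> v v'" using lc[OF w] by blast
    then show ?thesis using acts_on_cell_append[OF v(3,2)] w(1) by blast
  qed
  ultimately show ?thesis unfolding gluing_maps_def by blast
qed

lemma acts_on_cell_replace:
  assumes "w \<in> LL" "w' \<in> LL" "color_of w' = color_of w" "\<And>\<alpha>. \<Phi> (w \<frown> \<alpha>) = w' \<frown> \<alpha>"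
  shows "acts_on_cell \<Phi> w w'"
  unfolding acts_on_cell_def using assms by (auto intro!: bexI[of _ "idc (color_of w)"])

lemma LL_Cons: "w \<in> LL \<longleftrightarrow> (\<exists>i u. w = Z i # u \<and> valid (Some Red) u)"
  by (cases w) (auto simp: LL_iff allowed_None)

lemma root_swap_acts_on_cell:
  "valid (Some Red) u \<Longrightarrow> acts_on_cell root_swap (Z Second # u) (Z First # E Second # u)"
  "valid (Some Red) u \<Longrightarrow> acts_on_cell root_swap (Z Third # u) (Z First # E Third # u)"
  "valid (Some Red) u \<Longrightarrow> acts_on_cell root_swap (Z First # E Second # u) (Z Second # u)"
  "valid (Some Red) u \<Longrightarrow> acts_on_cell root_swap (Z First # E Third # u) (Z Third # u)"
  "acts_on_cell root_swap [Z First, E First] [Z First, E First]"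
proof -
  have L: "Z Second # u \<in> LL" "Z Third # u \<in> LL" "Z First # E Second # u \<in> LL" "Z First # E Third # u \<in> LL"
    if "valid (Some Red) u" for u using that by (simp_all add: LL_iff)
  show "acts_on_cell root_swap (Z Second # u) (Z First # E Second # u)" "acts_on_cell root_swap (Z Third # u) (Z First # E Third # u)"
    "acts_on_cell root_swap (Z First # E Second # u) (Z Second # u)" "acts_on_cell root_swap (Z First # E Third # u) (Z Third # u)"
    if "valid (Some Red) u" for u
    by (rule acts_on_cell_replace; use L[OF that] color_of_last in \<open>auto simp: color_of_last\<close>)+
  have "[Z First, E First] \<in> LL" by (simp add: LL_iff)
  moreover from this have "color_of [Z First, E First] = Blue" by (simp add: color_of_last)
  ultimately show "acts_on_cell root_swap [Z First, E First] [Z First, E First]"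
    unfolding acts_on_cell_def using phi3_GG by (auto intro!: bexI[of _ phi3])
qed

text \<open>The cell of \<open>[Z First]\<close> is cut into three pieces and has to be excluded.
  Keeping the last letter \<open>E First\<close> matters because it marks the blue edges that come
  from expanding a red edge.\<close>

lemma root_swap_acts_on_cell_last:
  assumes "y \<in> LL" "y \<noteq> [Z First]"
  shows "\<exists>y'. acts_on_cell root_swap y y' \<and> (last y = E First \<longrightarrow> last y' = E First)"
proof -
  obtain i u where y: "y = Z i # u" "valid (Some Red) u" using assms(1) unfolding LL_Cons by blast
  show ?thesis
  proof (cases i)
    case Second
    then show ?thesis using root_swap_acts_on_cell(1)[OF y(2)] y(1) by (intro exI[of _ "Z First # E Second # u"]) auto
  next
    case Third
    then show ?thesis using root_swap_acts_on_cell(2)[OF y(2)] y(1) by (intro exI[of _ "Z First # E Third # u"]) auto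
  next
    case First
    then obtain x v where u: "u = x # v" using assms(2) y(1) by (cases u) auto
    then have v: "allowed (Some Red) x" "valid (Some (lcol x)) v" using y(2) by simp_all
    from v(1) show ?thesis
    proof (cases rule: allowed_Red_cases)
      case 2
      then show ?thesis using root_swap_acts_on_cell(3)[of v] v y(1) u First by (intro exI[of _ "Z Second # v"]) auto
    next
      case 3
      then show ?thesis using root_swap_acts_on_cell(4)[of v] v y(1) u First by (intro exI[of _ "Z Third # v"]) auto
    next
      case 1
      have y1: "y = [Z First, E First] @ v" using y(1) u First 1 by simp
      have "[Z First, E First] \<in> LL" by (simp add: LL_iff)
      then obtain v' where v': "length v' = length v" "acts_on_cell root_swap y ([Z First, E First] @ v')"
        using acts_on_cell_append[OF root_swap_acts_on_cell(5), of v] assms(1) unfolding y1 by blast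
      show ?thesis
      proof (cases v rule: rev_cases)
        case Nil
        then show ?thesis using v' by (intro exI[of _ "[Z First, E First] @ v'"]) simp
      next
        case (snoc w x)
        have "valid (Some Blue) (w @ [x])" using v(2) 1 snoc by simp
        then have "allowed (end_state (Some Blue) w) x" by simp
        have wx: "w @ [x] = v" using snoc by simp
        show ?thesis
        proof (cases "x = E First")
          case False
          then show ?thesis using v'(2) y1 snoc by auto
        next
          case True
          \<comment> \<open>\<open>E First\<close> cannot follow a blue edge directly, so a letter
            \<open>z\<close> intervenes; \<open>phi3\<close> changes \<open>z\<close> and leaves the
            rest alone.\<close>
          obtain z w2 where w2: "w = z # w2" using \<open>allowed (end_state (Some Blue) w) x\<close> True by (cases w) auto
          have L: "[Z First, E First, z] \<in> LL" using assms(1) y1 snoc w2 by (simp add: LL_iff)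
          have zo: "allowed (Some Blue) z" using L by (simp add: LL_iff)
          obtain z' where z': "allowed (Some Blue) z'" "lcol z' = lcol z" "\<And>\<alpha>. \<alpha> \<in> Words (Some (lcol z)) \<Longrightarrow> phi3 (z ## \<alpha>) = z' ## \<alpha>"
          proof -
            obtain z' l' where "allowed (Some Blue) z'" "lcol z' = lcol z" "l' = idc (lcol z)"
              "\<forall>\<alpha>\<in>Words (Some (lcol z)). phi3 (z ## \<alpha>) = z' ## l' \<alpha>" using GG_step[OF phi3_GG zo] by auto
            then show ?thesis using that by auto
          qed
          let ?y = "Z First # E First # z' # w2 @ [x]"
          have L': "?y \<in> LL" using assms(1) y1 snoc w2 z'(1,2) by (simp add: LL_iff)
          have "acts_on_cell root_swap y ?y"
            unfolding acts_on_cell_def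
          proof (intro conjI bexI ballI)
            show "?y \<in> LL" by (rule L')
            show "color_of ?y = color_of y" using color_of_last[OF L'] color_of_last[OF assms(1)] y1 snoc by simp
            show "idc (color_of y) \<in> GG (color_of y)" by simp
            fix \<alpha> assume "\<alpha> \<in> Words (Some (color_of y))"
            moreover from this have "y \<frown> \<alpha> \<in> Words None" using LL_conc[OF assms(1)] by blast
            ultimately show "root_swap (y \<frown> \<alpha>) = ?y \<frown> idc (color_of y) \<alpha>"
              using z'(3)[of "w2 \<frown> x ## \<alpha>"] by (simp add: y1 snoc w2)
          qed
          moreover have "last ?y = last y" using y1 snoc by simp
          ultimately show ?thesis by auto
        qed
      qed
    qed
  qed
qed

lemma root_swap_Words: "\<alpha> \<in> Words None \<Longrightarrow> root_swap \<alpha> \<in> Words None"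
  and root_swap_root_swap: "\<alpha> \<in> Words None \<Longrightarrow> root_swap (root_swap \<alpha>) = \<alpha>"
proof -
  have "root_swap \<alpha> \<in> Words None \<and> root_swap (root_swap \<alpha>) = \<alpha>" if a: "\<alpha> \<in> Words None" for \<alpha>
  proof -
    obtain i \<beta> where b: "\<alpha> = Z i ## \<beta>" "\<beta> \<in> Words (Some Red)" using a by (rule Words_None_cases)
    from b(2) show ?thesis by (cases i; cases rule: Words_Red_cases) (simp_all add: b(1))
  qed
  then show "\<alpha> \<in> Words None \<Longrightarrow> root_swap \<alpha> \<in> Words None" "\<alpha> \<in> Words None \<Longrightarrow> root_swap (root_swap \<alpha>) = \<alpha>" by blast+
qed

lemma root_swap_gluing_maps: "root_swap \<in> gluing_maps"
proof (rule gluing_maps_intro[OF root_swap_Words root_swap_Words root_swap_root_swap root_swap_root_swap root_swap_eqv root_swap_eqv])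
  fix w assume w: "w \<in> LL" "2 \<le> length w"
  then have "w \<noteq> [Z First]" by auto
  then obtain w' where "acts_on_cell root_swap w w'" using root_swap_acts_on_cell_last w(1) by blast
  then show "\<exists>v u v'. w = v @ u \<and> v \<in> LL \<and> acts_on_cell root_swap v v'" using w(1) by (metis append_Nil2)
qed

lemma base_perm_acts_on_cell:
  assumes "Z i # u \<in> LL" shows "acts_on_cell (base_perm \<sigma>) (Z i # u) (Z (\<sigma> i) # u)"
proof (rule acts_on_cell_replace[OF assms])
  show L: "Z (\<sigma> i) # u \<in> LL" using assms by (simp add: LL_Cons)
  show "color_of (Z (\<sigma> i) # u) = color_of (Z i # u)"
    using color_of_last[OF L] color_of_last[OF assms] by simp
qed simp

lemma base_perm_gluing_maps:
  assumes "bij \<sigma>" shows "base_perm \<sigma> \<in> gluing_maps"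
proof (rule gluing_maps_intro[where \<Psi> = "base_perm (inv_into UNIV \<sigma>)" and N = 1])
  have s: "inv_into UNIV \<sigma> (\<sigma> i) = i" "\<sigma> (inv_into UNIV \<sigma> i) = i" for i
    using assms by (simp_all add: bij_is_inj bij_is_surj surj_f_inv_f)
  show "base_perm \<sigma> \<alpha> \<in> Words None" "base_perm (inv_into UNIV \<sigma>) \<alpha> \<in> Words None"
    "base_perm (inv_into UNIV \<sigma>) (base_perm \<sigma> \<alpha>) = \<alpha>" "base_perm \<sigma> (base_perm (inv_into UNIV \<sigma>) \<alpha>) = \<alpha>" if "\<alpha> \<in> Words None" for \<alpha>
    using that by (auto elim!: Words_None_cases simp: s)
  have e: "eqv (base_perm \<tau> (vertex_address e x)) (base_perm \<tau> (vertex_address e y))" if h: "valid None (e @ [x])" "valid None (e @ [y])" for e x y \<tau>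
  proof (cases e)
    case Nil
    obtain i j where "x = Z i" "y = Z j" using h Nil by (auto simp: allowed_None)
    then show ?thesis using Nil eqv_adrs[of "[]" "Z (\<tau> i)" "Z (\<tau> j)"] by (simp add: vertex_address_def)
  next
    case (Cons z e')
    then show ?thesis using h by (auto simp: allowed_None eqv_build eqv_adrs simp flip: vertex_address_build)
  qed
  show "eqv (base_perm \<sigma> (vertex_address e x)) (base_perm \<sigma> (vertex_address e y))"
    "eqv (base_perm (inv_into UNIV \<sigma>) (vertex_address e x)) (base_perm (inv_into UNIV \<sigma>) (vertex_address e y))"
    if "valid None (e @ [x])" "valid None (e @ [y])" for e x y using e that by blast+
  fix w assume w: "w \<in> LL" "1 \<le> length w"
  obtain i u where u: "w = Z i # u" "valid (Some Red) u" using w(1) LL_Cons by auto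
  have "acts_on_cell (base_perm \<sigma>) w (Z (\<sigma> i) # u)" using base_perm_acts_on_cell w(1) unfolding u(1) by blast
  then show "\<exists>v u v'. w = v @ u \<and> v \<in> LL \<and> acts_on_cell (base_perm \<sigma>) v v'" using w(1) by (metis append_Nil2)
qed

text \<open>A red cell meets the outside only in its initial vertex. The addresses of a branch point
  not created inside \<open>z\<close> therefore avoid the cell or equal its initial address, which
  \<theta> fixes.\<close>

lemma at_vertex_address:
  assumes z: "z \<in> LL" "color_of z = Red" and k: "\<theta> (initial_address Red) = initial_address Red"
  shows "(\<exists>t. e = z @ t) \<or> at_cell z \<theta> (vertex_address e x) = vertex_address e x"
proof (cases "\<exists>\<alpha>. vertex_address e x = z \<frown> \<alpha>")
  case True
  then obtain \<alpha> where a: "z \<frown> \<alpha> = vertex_address e x" by metis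
  from conc_eq_vertex_address[OF a] show ?thesis
  proof
    assume "\<exists>u. z = e @ x # u \<and> u \<frown> \<alpha> = initial_address (lcol x)"
    then obtain u where u: "z = e @ x # u" "u \<frown> \<alpha> = initial_address (lcol x)" by blast
    \<comment> \<open>A longer \<open>u\<close> would continue as an initial address does, so
      \<open>z\<close> would end in a blue letter.\<close>
    have "u = []"
    proof (rule ccontr)
      assume "u \<noteq> []"
      then obtain y v where v: "u = y # v" by (cases u) auto
      then have y: "y = first_letter (lcol x)" "I3w = v \<frown> \<alpha>" using u(2) by (simp_all add: initial_address_first)
      then have s: "set v \<subseteq> {I Third}" using I3w_suffix by blast
      have "lcol (last z) = Blue"
      proof (cases "v = []")
        case False
        then have "last v = I Third" using s last_in_set by blast
        then show ?thesis using False u(1) v by simp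
      qed (use u(1) v y in simp)
      then show False using z color_of_last by simp
    qed
    then have "\<alpha> = initial_address Red" using u z color_of_last[of z] by simp
    then have "at_cell z \<theta> (z \<frown> \<alpha>) = z \<frown> \<alpha>" by (simp add: k)
    then show ?thesis unfolding a by blast
  qed blast
next
  case False
  then show ?thesis using at_other by blast
qed

lemma at_eqv:
  assumes z: "z \<in> LL" "color_of z = Red" and k: "\<theta> (initial_address Red) = initial_address Red"
    and fw: "\<And>e x y. valid (Some Red) (e @ [x]) \<Longrightarrow> valid (Some Red) (e @ [y]) \<Longrightarrow> eqv (\<theta> (vertex_address e x)) (\<theta> (vertex_address e y))"
    and v: "valid None (e @ [x])" "valid None (e @ [y])"
  shows "eqv (at_cell z \<theta> (vertex_address e x)) (at_cell z \<theta> (vertex_address e y))"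
proof (cases "\<exists>t. e = z @ t")
  case True
  then obtain t where t: "e = z @ t" by blast
  have "eqv (\<theta> (vertex_address t x)) (\<theta> (vertex_address t y))" by (rule fw) (use v color_of_end_state[OF z(1)] z(2) in \<open>simp_all add: t\<close>)
  then show ?thesis unfolding t vertex_address_conc[symmetric] at_same eqv_conc .
next
  case False
  have "at_cell z \<theta> (vertex_address e x) = vertex_address e x" "at_cell z \<theta> (vertex_address e y) = vertex_address e y"
    using at_vertex_address[where \<theta> = \<theta>, OF z k, of e x] at_vertex_address[where \<theta> = \<theta>, OF z k, of e y] False by blast+
  then show ?thesis using eqv_adrs by simp
qed

lemma Z1_LL: "[Z First] \<in> LL" "color_of [Z First] = Red"
proof -
  show "[Z First] \<in> LL" by (simp add: LL_iff)
  then show "color_of [Z First] = Red" by (simp add: color_of_last)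
qed

lemma at_gluing_maps:
  assumes O: "\<And>\<alpha>. \<alpha> \<in> Words (Some Red) \<Longrightarrow> \<theta> \<alpha> \<in> Words (Some Red)" "\<And>\<alpha>. \<alpha> \<in> Words (Some Red) \<Longrightarrow> \<theta>' \<alpha> \<in> Words (Some Red)"
    and inv: "\<And>\<alpha>. \<alpha> \<in> Words (Some Red) \<Longrightarrow> \<theta>' (\<theta> \<alpha>) = \<alpha>" "\<And>\<alpha>. \<alpha> \<in> Words (Some Red) \<Longrightarrow> \<theta> (\<theta>' \<alpha>) = \<alpha>"
    and k: "\<theta> (initial_address Red) = initial_address Red"
    and fw: "\<And>e x y. valid (Some Red) (e @ [x]) \<Longrightarrow> valid (Some Red) (e @ [y]) \<Longrightarrow> eqv (\<theta> (vertex_address e x)) (\<theta> (vertex_address e y))"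
      "\<And>e x y. valid (Some Red) (e @ [x]) \<Longrightarrow> valid (Some Red) (e @ [y]) \<Longrightarrow> eqv (\<theta>' (vertex_address e x)) (\<theta>' (vertex_address e y))"
    and lc: "\<And>u. valid (Some Red) u \<Longrightarrow> N \<le> length u \<Longrightarrow>
      \<exists>v u' v'. u = v @ u' \<and> acts_on_cell (at_cell [Z First] \<theta>) (Z First # v) v'"
  shows "at_cell [Z First] \<theta> \<in> gluing_maps"
proof (rule gluing_maps_intro[where \<Psi> = "at_cell [Z First] \<theta>'" and N = "Suc N"])
  have k': "\<theta>' (initial_address Red) = initial_address Red" using inv(1)[of "initial_address Red"] k by simp
  show "at_cell [Z First] \<theta> \<alpha> \<in> Words None" "at_cell [Z First] \<theta>' \<alpha> \<in> Words None"
    "at_cell [Z First] \<theta>' (at_cell [Z First] \<theta> \<alpha>) = \<alpha>" "at_cell [Z First] \<theta> (at_cell [Z First] \<theta>' \<alpha>) = \<alpha>" if a: "\<alpha> \<in> Words None" for \<alpha>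
  proof -
    obtain i \<beta> where "\<alpha> = Z i ## \<beta>" "\<beta> \<in> Words (Some Red)" using a by (rule Words_None_cases)
    then show "at_cell [Z First] \<theta> \<alpha> \<in> Words None" "at_cell [Z First] \<theta>' \<alpha> \<in> Words None"
    "at_cell [Z First] \<theta>' (at_cell [Z First] \<theta> \<alpha>) = \<alpha>" "at_cell [Z First] \<theta> (at_cell [Z First] \<theta>' \<alpha>) = \<alpha>"
      using O inv by simp_all
  qed
  show "eqv (at_cell [Z First] \<theta> (vertex_address e x)) (at_cell [Z First] \<theta> (vertex_address e y))"
    "eqv (at_cell [Z First] \<theta>' (vertex_address e x)) (at_cell [Z First] \<theta>' (vertex_address e y))"
    if "valid None (e @ [x])" "valid None (e @ [y])" for e x y
    using at_eqv[OF Z1_LL k fw(1) that] at_eqv[OF Z1_LL k' fw(2) that] by blast+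
  fix w assume w: "w \<in> LL" "Suc N \<le> length w"
  obtain i u where u: "w = Z i # u" "valid (Some Red) u" using w(1) LL_Cons by auto
  show "\<exists>v u v'. w = v @ u \<and> v \<in> LL \<and> acts_on_cell (at_cell [Z First] \<theta>) v v'"
  proof (cases "i = First")
    case True
    have "N \<le> length u" using u w by simp
    from lc[OF u(2) this] obtain v u' v' where v: "u = v @ u'" "acts_on_cell (at_cell [Z First] \<theta>) (Z First # v) v'" by blast
    have "w = (Z First # v) @ u'" "Z First # v \<in> LL" using u v True by (simp_all add: LL_Cons)
    then show ?thesis using v(2) by blast
  next
    case False
    have "acts_on_cell (at_cell [Z First] \<theta>) w w" by (rule acts_on_cell_replace) (use w False in \<open>simp_all add: u(1)\<close>)
    then show ?thesis using w(1) by (metis append_Nil2)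
  qed
qed

lemma at_GG_gluing_maps:
  assumes "l \<in> GG Red" shows "at_cell [Z First] l \<in> gluing_maps"
proof -
  obtain l' where l': "l' \<in> GG Red" "\<forall>\<alpha>\<in>Words (Some Red). l' (l \<alpha>) = \<alpha> \<and> l (l' \<alpha>) = \<alpha>"
    using GG_inverse[OF assms] by blast
  show ?thesis
  proof (rule at_gluing_maps[where \<theta>' = l' and N = 0])
    show "eqv (l (vertex_address e x)) (l (vertex_address e y))" "eqv (l' (vertex_address e x)) (l' (vertex_address e y))"
      if "valid (Some Red) (e @ [x])" "valid (Some Red) (e @ [y])" for e x y
      using GG_eqv[OF assms] GG_eqv[OF l'(1)] that eqv_adrs by simp_all
    have "acts_on_cell (at_cell [Z First] l) [Z First] [Z First]"
      unfolding acts_on_cell_def using Z1_LL assms by (auto intro!: bexI[of _ l])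
    then show "\<exists>v u' v'. u = v @ u' \<and> acts_on_cell (at_cell [Z First] l) (Z First # v) v'" for u by (metis append_Nil)
  qed (use assms l' GG_initial_address in auto)
qed

lemma cell_shift_Words [simp]: "\<alpha> \<in> Words (Some Red) \<Longrightarrow> cell_shift \<alpha> \<in> Words (Some Red)"
  by (erule Words_Red_cases; (erule Words_Blue_cases)?) simp_all

lemma cell_shift_initial_address [simp]: "cell_shift (initial_address Red) = initial_address Red"
  using cell_shift_simps(1)[of I3w] by (simp add: initial_address_simps)

lemma at_cell_shift_acts_on_cell:
  assumes z: "z \<in> LL" "color_of z = Red"
  shows "valid (Some Blue) u \<Longrightarrow> acts_on_cell (at_cell z cell_shift) (z @ E First # I Third # u) (z @ E First # u)"
  "valid (Some Red) u \<Longrightarrow> acts_on_cell (at_cell z cell_shift) (z @ E First # I Second # u) (z @ E Third # u)"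
  "acts_on_cell (at_cell z cell_shift) (z @ [E First, I First]) (z @ [E Second, E First])"
  "valid (Some Red) u \<Longrightarrow> acts_on_cell (at_cell z cell_shift) (z @ E Second # u) (z @ E Second # E Second # u)"
  "valid (Some Red) u \<Longrightarrow> acts_on_cell (at_cell z cell_shift) (z @ E Third # u) (z @ E Second # E Third # u)"
proof -
  have L: "z @ v \<in> LL \<longleftrightarrow> valid (Some Red) v" for v using LL_append[OF z(1)] z(2) by simp
  have col: "color_of (z @ v) = lcol (last v)" if "valid (Some Red) v" "v \<noteq> []" for v
    using color_of_last[of "z @ v"] that by (simp add: L)
  have at: "at_cell z cell_shift ((z @ v) \<frown> \<alpha>) = z \<frown> cell_shift (v \<frown> \<alpha>)" for v \<alpha>
    using at_same[of z cell_shift "v \<frown> \<alpha>"] by (simp only: conc_conc)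
  have rep: "acts_on_cell (at_cell z cell_shift) (z @ v) (z @ v')"
    if h: "valid (Some Red) v" "valid (Some Red) v'" "v \<noteq> []" "v' \<noteq> []" "lcol (last v') = lcol (last v)"
      "\<And>\<alpha>. cell_shift (v \<frown> \<alpha>) = v' \<frown> \<alpha>" for v v'
  proof -
    have "color_of (z @ v') = color_of (z @ v)" using col[OF h(1,3)] col[OF h(2,4)] h(5) by simp
    then show ?thesis by (intro acts_on_cell_replace) (use h in \<open>simp_all only: L at conc_conc\<close>)
  qed
  show "valid (Some Blue) u \<Longrightarrow> acts_on_cell (at_cell z cell_shift) (z @ E First # I Third # u) (z @ E First # u)"
    "valid (Some Red) u \<Longrightarrow> acts_on_cell (at_cell z cell_shift) (z @ E First # I Second # u) (z @ E Third # u)"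
    "valid (Some Red) u \<Longrightarrow> acts_on_cell (at_cell z cell_shift) (z @ E Second # u) (z @ E Second # E Second # u)"
    "valid (Some Red) u \<Longrightarrow> acts_on_cell (at_cell z cell_shift) (z @ E Third # u) (z @ E Second # E Third # u)"
    by (rule rep; simp)+
  show "acts_on_cell (at_cell z cell_shift) (z @ [E First, I First]) (z @ [E Second, E First])"
    unfolding acts_on_cell_def
  proof (intro conjI)
    show "\<exists>l\<in>GG (color_of (z @ [E First, I First])). \<forall>\<alpha>\<in>Words (Some (color_of (z @ [E First, I First]))).
        at_cell z cell_shift ((z @ [E First, I First]) \<frown> \<alpha>) = (z @ [E Second, E First]) \<frown> l \<alpha>"
    proof (intro bexI ballI)
      show "phi3 \<in> GG (color_of (z @ [E First, I First]))" using phi3_GG by (simp add: col)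
      show "at_cell z cell_shift ((z @ [E First, I First]) \<frown> \<alpha>) = (z @ [E Second, E First]) \<frown> phi3 \<alpha>" for \<alpha>
        unfolding at conc_conc[symmetric] by simp
    qed
  qed (simp_all add: L col)
qed

lemma at_cell_shift_gluing_maps: "at_cell [Z First] cell_shift \<in> gluing_maps"
proof (rule at_gluing_maps[where \<theta>' = cell_shift_inv and N = 2])
  show "cell_shift_inv \<alpha> \<in> Words (Some Red)" "cell_shift_inv (cell_shift \<alpha>) = \<alpha>" "cell_shift (cell_shift_inv \<alpha>) = \<alpha>" if "\<alpha> \<in> Words (Some Red)" for \<alpha>
  proof -
    have 1: "cell_shift_inv \<alpha> \<in> Words (Some Red) \<and> cell_shift (cell_shift_inv \<alpha>) = \<alpha>" if "\<alpha> \<in> Words (Some Red)" for \<alpha>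
      using that
    proof (cases rule: Words_Red_cases)
      case (2 \<beta>)
      from 2(2) show ?thesis by (cases rule: Words_Red_cases) (simp_all add: 2(1))
    qed simp_all
    have 2: "cell_shift_inv (cell_shift \<alpha>) = \<alpha>" if "\<alpha> \<in> Words (Some Red)" for \<alpha>
      using that
    proof (cases rule: Words_Red_cases)
      case (1 \<beta>)
      from 1(2) show ?thesis by (cases rule: Words_Blue_cases) (simp_all add: 1(1))
    qed simp_all
    show "cell_shift_inv \<alpha> \<in> Words (Some Red)" "cell_shift_inv (cell_shift \<alpha>) = \<alpha>" "cell_shift (cell_shift_inv \<alpha>) = \<alpha>" using 1 2 that by auto
  qed
  fix u assume u: "valid (Some Red) u" "2 \<le> length u"
  obtain x y w where w: "u = x # y # w" using u(2) by (cases u; cases "tl u") auto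
  have x: "allowed (Some Red) x" using u w by simp
  then show "\<exists>v u' v'. u = v @ u' \<and> acts_on_cell (at_cell [Z First] cell_shift) (Z First # v) v'"
  proof (cases rule: allowed_Red_cases)
    case 1
    then have "allowed (Some Blue) y" using u w by simp
    then show ?thesis
    proof (cases rule: allowed_Blue_cases)
      case a: 1
      have "u = [E First, I First] @ w" using w 1 a by simp
      then show ?thesis using at_cell_shift_acts_on_cell(3)[OF Z1_LL] by (metis append_Cons append_Nil)
    next
      case a: 2
      have "u = [E First, I Second] @ w" using w 1 a by simp
      then show ?thesis using at_cell_shift_acts_on_cell(2)[OF Z1_LL, of "[]"] by (metis append_Cons append_Nil valid.simps(1))
    next
      case a: 3
      have "u = [E First, I Third] @ w" using w 1 a by simp
      then show ?thesis using at_cell_shift_acts_on_cell(1)[OF Z1_LL, of "[]"] by (metis append_Cons append_Nil valid.simps(1))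
    qed
  next
    case 2
    have "u = [E Second] @ y # w" using w 2 by simp
    then show ?thesis using at_cell_shift_acts_on_cell(4)[OF Z1_LL, of "[]"] by (metis append_Cons append_Nil valid.simps(1))
  next
    case 3
    have "u = [E Third] @ y # w" using w 3 by simp
    then show ?thesis using at_cell_shift_acts_on_cell(5)[OF Z1_LL, of "[]"] by (metis append_Cons append_Nil valid.simps(1))
  qed
qed (use cell_shift_eqv cell_shift_inv_eqv in auto)

section \<open>Finite generation\<close>

definition gens :: "(iword \<Rightarrow> iword) set" where
  "gens = base_perm ` {\<sigma>. bij \<sigma>} \<union> {root_swap, at_cell [Z First] cell_shift} \<union> (\<lambda>f. at_cell [Z First] (tree_act Red f)) ` wgens Red"

text \<open>The subgroup generated by \<open>gens\<close>, on the level of infinite words. The rule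
  \<open>inv\<close> admits every left inverse on \<open>Words None\<close>, so membership depends
  only on the values there.\<close>

inductive_set gen_maps :: "(iword \<Rightarrow> iword) set" where
  gen: "\<Phi> \<in> gens \<Longrightarrow> \<Phi> \<in> gen_maps"
| id: "id \<in> gen_maps"
| comp: "\<Phi> \<in> gen_maps \<Longrightarrow> \<Psi> \<in> gen_maps \<Longrightarrow> \<Phi> \<circ> \<Psi> \<in> gen_maps"
| inv: "\<Phi> \<in> gen_maps \<Longrightarrow> (\<And>\<alpha>. \<alpha> \<in> Words None \<Longrightarrow> \<Psi> (\<Phi> \<alpha>) = \<alpha>) \<Longrightarrow> \<Psi> \<in> gen_maps"

lemma gens_gluing_maps: "gens \<subseteq> gluing_maps"
  unfolding gens_def using base_perm_gluing_maps root_swap_gluing_maps at_cell_shift_gluing_maps at_GG_gluing_maps[OF GG_tree_act_in] by auto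

lemma gen_maps_gluing_maps: "\<Phi> \<in> gen_maps \<Longrightarrow> \<Phi> \<in> gluing_maps"
proof (induction rule: gen_maps.induct)
  case (gen \<Phi>)
  then show ?case using gens_gluing_maps by blast
next
  case id
  then show ?case by (rule gluing_maps_id)
next
  case (comp \<Phi> \<Psi>)
  then show ?case by (intro gluing_maps_compose)
next
  case (inv \<Phi> \<Psi>)
  show ?case by (rule gluing_maps_inverse[OF inv.IH inv.hyps(2)])
qed

lemma gen_maps_cong:
  assumes "\<Phi> \<in> gen_maps" "\<And>\<alpha>. \<alpha> \<in> Words None \<Longrightarrow> \<Psi> \<alpha> = \<Phi> \<alpha>" shows "\<Psi> \<in> gen_maps"
proof -
  obtain \<Theta> where t: "\<Theta> \<in> gluing_maps" "\<And>\<alpha>. \<alpha> \<in> Words None \<Longrightarrow> \<Theta> (\<Phi> \<alpha>) = \<alpha>" "\<And>\<alpha>. \<alpha> \<in> Words None \<Longrightarrow> \<Phi> (\<Theta> \<alpha>) = \<alpha>"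
    using gluing_maps_has_inverse[OF gen_maps_gluing_maps[OF assms(1)]] by blast
  have "\<Theta> \<in> gen_maps" by (rule gen_maps.inv[OF assms(1) t(2)])
  then show ?thesis by (rule gen_maps.inv) (simp add: assms(2) t(3) gluing_maps_Words[OF t(1)])
qed

lemma gen_maps_inverse:
  assumes "\<Phi> \<in> gen_maps"
  shows "\<exists>\<Psi>\<in>gen_maps. (\<forall>\<alpha>\<in>Words None. \<Psi> (\<Phi> \<alpha>) = \<alpha> \<and> \<Phi> (\<Psi> \<alpha>) = \<alpha>)"
proof -
  obtain \<Theta> where t: "\<Theta> \<in> gluing_maps" "\<And>\<alpha>. \<alpha> \<in> Words None \<Longrightarrow> \<Theta> (\<Phi> \<alpha>) = \<alpha>" "\<And>\<alpha>. \<alpha> \<in> Words None \<Longrightarrow> \<Phi> (\<Theta> \<alpha>) = \<alpha>"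
    using gluing_maps_has_inverse[OF gen_maps_gluing_maps[OF assms(1)]] by blast
  have "\<Theta> \<in> gen_maps" by (rule gen_maps.inv[OF assms(1) t(2)])
  then show ?thesis using t(2,3) by blast
qed

lemma base_perm_gen_maps: "bij \<sigma> \<Longrightarrow> base_perm \<sigma> \<in> gen_maps"
  and root_swap_gen_maps: "root_swap \<in> gen_maps"
  and at_cell_shift_gen_maps: "at_cell [Z First] cell_shift \<in> gen_maps"
  by (rule gen_maps.gen, simp add: gens_def)+

lemma finite_gens: "finite gens"
proof -
  have "finite (PiE (UNIV :: idx set) (\<lambda>_. UNIV :: idx set))" using finite_idx by (intro finite_PiE)
  moreover have "PiE (UNIV :: idx set) (\<lambda>_. UNIV :: idx set) = UNIV" by auto
  ultimately have "finite (UNIV :: (idx \<Rightarrow> idx) set)" by simp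
  then have "finite {\<sigma> :: idx \<Rightarrow> idx. bij \<sigma>}" by (rule rev_finite_subset) simp
  then show ?thesis by (simp add: gens_def wgens_def)
qed

section \<open>Moving red cells onto the first base cell\<close>

definition red_word :: "fword \<Rightarrow> bool" where
  "red_word z \<longleftrightarrow> valid None z \<and> end_state None z = Some Red"

lemma red_word_LL: "red_word z \<Longrightarrow> z \<in> LL" "red_word z \<Longrightarrow> color_of z = Red"
proof -
  show L: "z \<in> LL" if "red_word z" using that by (cases z) (auto simp: red_word_def LL_iff)
  show "color_of z = Red" if h: "red_word z" using color_of_end_state[OF L[OF h]] h by (simp add: red_word_def)
qed

lemma LL_red_word: "z \<in> LL \<Longrightarrow> color_of z = Red \<Longrightarrow> red_word z"
  using color_of_end_state[of z] by (auto simp: red_word_def LL_iff)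

lemma red_word_Words: "red_word z \<Longrightarrow> z \<frown> \<alpha> \<in> Words None \<longleftrightarrow> \<alpha> \<in> Words (Some Red)"
  by (simp add: red_word_def)

lemma red_word_snoc:
  assumes "red_word z" obtains p x where "z = p @ [x]" "z \<frown> initial_address Red = vertex_address p x"
proof (cases z rule: rev_cases)
  case Nil
  then show ?thesis using assms by (simp add: red_word_def)
next
  case (snoc p x)
  then have "lcol x = Red" using assms by (simp add: red_word_def)
  then have "z \<frown> initial_address Red = vertex_address p x" unfolding snoc vertex_address_def by simp
  then show ?thesis using snoc that by blast
qed

text \<open>The last letter of a red word is the letter by which the address enters from the branch
  point, so the normal form of the address recovers the word.\<close>

lemma red_word_initial_address:
  assumes "red_word z" "red_word w" "z \<frown> initial_address Red = w \<frown> initial_address Red" shows "z = w"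
proof -
  obtain p x where z: "z = p @ [x]" "z \<frown> initial_address Red = vertex_address p x" by (rule red_word_snoc[OF assms(1)])
  obtain q y where w: "w = q @ [y]" "w \<frown> initial_address Red = vertex_address q y" by (rule red_word_snoc[OF assms(2)])
  have "vertex_address p x = vertex_address q y" using assms(3) unfolding z(2) w(2) .
  then have "p = q \<and> x = y" unfolding vertex_address_inj .
  then show ?thesis using z(1) w(1) by simp
qed

text \<open>The change of prefix carries no label, so conjugation transports \<open>at_cell\<close>
  with \<theta> unchanged.\<close>

definition moves_to :: "fword \<Rightarrow> fword \<Rightarrow> bool" where
  "moves_to z z' \<longleftrightarrow> (\<exists>k\<in>gen_maps. \<forall>\<alpha>\<in>Words (Some Red). k (z \<frown> \<alpha>) = z' \<frown> \<alpha>)"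

lemma moves_to_trans: "moves_to z z' \<Longrightarrow> moves_to z' z'' \<Longrightarrow> moves_to z z''"
  unfolding moves_to_def by (metis gen_maps.comp comp_apply)

lemma mvI: "k \<in> gen_maps \<Longrightarrow> (\<And>\<alpha>. \<alpha> \<in> Words (Some Red) \<Longrightarrow> k (z \<frown> \<alpha>) = z' \<frown> \<alpha>) \<Longrightarrow> moves_to z z'"
  unfolding moves_to_def by blast

definition swap_first :: "idx \<Rightarrow> idx \<Rightarrow> idx" where
  "swap_first i j = (if j = i then First else if j = First then i else j)"

lemma swap_first: "bij (swap_first i)" "swap_first i i = First"
proof -
  have "swap_first i \<circ> swap_first i = id" by (auto simp: swap_first_def fun_eq_iff)
  then show "bij (swap_first i)" using o_bij by blast
qed (simp add: swap_first_def)

text \<open>A word leading from a blue to a red edge is nonempty, and the states of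
  \<open>phi3\<close> at its first letter are trivial. So \<open>phi3\<close> amounts to a change of
  prefix on this cell.\<close>

lemma phi3_word:
  assumes "valid (Some Blue) v" "end_state (Some Blue) v = Some Red"
  shows "\<exists>v'. length v' = length v \<and> valid (Some Blue) v' \<and> end_state (Some Blue) v' = Some Red \<and>
    (\<forall>\<alpha>\<in>Words (Some Red). phi3 (v \<frown> \<alpha>) = v' \<frown> \<alpha>)"
proof -
  obtain x u where v: "v = x # u" using assms by (cases v) auto
  then have x: "allowed (Some Blue) x" "valid (Some (lcol x)) u" using assms by auto
  obtain y l' where y: "allowed (Some Blue) y" "lcol y = lcol x" "l' = idc (lcol x)"
    "\<forall>\<alpha>\<in>Words (Some (lcol x)). phi3 (x ## \<alpha>) = y ## l' \<alpha>" using GG_step[OF phi3_GG x(1)] by auto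
  show ?thesis
    by (rule exI[of _ "y # u"]) (use v x y assms in simp)
qed

text \<open>With \<open>Z First\<close> in front, \<open>root_swap\<close> removes a following
  \<open>E Second\<close> or \<open>E Third\<close>. After \<open>E First\<close> the next letter
  decides: \<open>cell_shift\<close> shortens the word at \<open>I Second\<close> and
  \<open>I Third\<close>, and at \<open>I First\<close> it makes \<open>root_swap\<close>
  applicable.\<close>

lemma moves_to_Z1: "red_word z \<Longrightarrow> moves_to z [Z First]"
proof (induction "length z" arbitrary: z rule: less_induct)
  case less
  obtain i u where z: "z = Z i # u" using less.prems by (cases z) (auto simp: red_word_def allowed_None)
  have u: "valid (Some Red) u" "end_state (Some Red) u = Some Red" using less.prems z by (simp_all add: red_word_def)
  have s0: "moves_to z (Z First # u)"
    by (rule mvI[OF base_perm_gen_maps[OF swap_first(1)[of i]]]) (simp add: z swap_first(2))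
  show ?case
  proof (cases u)
    case Nil
    then show ?thesis using s0 by simp
  next
    case (Cons x v)
    then have "allowed (Some Red) x" using u by simp
    then show ?thesis
    proof (cases rule: allowed_Red_cases)
      case 2
      have "moves_to (Z First # u) (Z Second # v)" by (rule mvI[OF root_swap_gen_maps]) (simp add: Cons 2)
      moreover have "moves_to (Z Second # v) [Z First]" by (rule less.hyps) (use u z Cons 2 in \<open>simp_all add: red_word_def\<close>)
      ultimately show ?thesis using s0 moves_to_trans by blast
    next
      case 3
      have "moves_to (Z First # u) (Z Third # v)" by (rule mvI[OF root_swap_gen_maps]) (simp add: Cons 3)
      moreover have "moves_to (Z Third # v) [Z First]" by (rule less.hyps) (use u z Cons 3 in \<open>simp_all add: red_word_def\<close>)
      ultimately show ?thesis using s0 moves_to_trans by blast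
    next
      case 1
      then obtain y w where v: "v = y # w" "allowed (Some Blue) y" using u Cons by (cases v) auto
      from v(2) show ?thesis
      proof (cases rule: allowed_Blue_cases)
        case y: 2
        have "moves_to (Z First # u) (Z First # E Third # w)" by (rule mvI[OF at_cell_shift_gen_maps]) (simp add: Cons 1 v y)
        moreover have "moves_to (Z First # E Third # w) [Z First]"
          by (rule less.hyps) (use u z Cons 1 v y in \<open>simp_all add: red_word_def\<close>)
        ultimately show ?thesis using s0 moves_to_trans by blast
      next
        case y: 3
        have "moves_to (Z First # u) (Z First # E First # w)" by (rule mvI[OF at_cell_shift_gen_maps]) (simp add: Cons 1 v y)
        moreover have "moves_to (Z First # E First # w) [Z First]"
          by (rule less.hyps) (use u z Cons 1 v y in \<open>simp_all add: red_word_def\<close>)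
        ultimately show ?thesis using s0 moves_to_trans by blast
      next
        case y: 1
        have w: "valid (Some Blue) w" "end_state (Some Blue) w = Some Red" using u Cons 1 v y by simp_all
        obtain w' where w': "length w' = length w" "valid (Some Blue) w'" "end_state (Some Blue) w' = Some Red"
          "\<forall>\<alpha>\<in>Words (Some Red). phi3 (w \<frown> \<alpha>) = w' \<frown> \<alpha>" using phi3_word[OF w] by blast
        \<comment> \<open>This move keeps the length; only the following \<open>root_swap\<close>
          makes the word shorter than \<open>z\<close>.\<close>
        have "moves_to (Z First # u) (Z First # E Second # E First # w')"
          by (rule mvI[OF at_cell_shift_gen_maps]) (simp add: Cons 1 v y w'(4))
        moreover have "moves_to (Z First # E Second # E First # w') (Z Second # E First # w')" by (rule mvI[OF root_swap_gen_maps]) simp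
        moreover have "moves_to (Z Second # E First # w') [Z First]"
          by (rule less.hyps) (use u z Cons 1 v y w' in \<open>simp_all add: red_word_def\<close>)
        ultimately show ?thesis using s0 moves_to_trans by blast
      qed
    qed
  qed
qed

section \<open>Maps that can be performed inside red cells\<close>

definition red_maps :: "(iword \<Rightarrow> iword) set" where
  "red_maps = {\<theta>. (\<forall>\<alpha>\<in>Words (Some Red). \<theta> \<alpha> \<in> Words (Some Red)) \<and> at_cell [Z First] \<theta> \<in> gen_maps}"

lemma red_maps_Words: "\<theta> \<in> red_maps \<Longrightarrow> \<alpha> \<in> Words (Some Red) \<Longrightarrow> \<theta> \<alpha> \<in> Words (Some Red)"
  by (simp add: red_maps_def)

text \<open>Conjugate the copy in the first base cell by an element \<open>k\<close> moving
  \<open>z\<close> there without a label. Words outside the cell of \<open>z\<close> avoid the first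
  base cell after \<open>k\<close> and are left fixed.\<close>

lemma at_gen_maps:
  assumes z: "red_word z" and t: "\<theta> \<in> red_maps" shows "at_cell z \<theta> \<in> gen_maps"
proof -
  obtain k where k: "k \<in> gen_maps" "\<And>\<alpha>. \<alpha> \<in> Words (Some Red) \<Longrightarrow> k (z \<frown> \<alpha>) = Z First ## \<alpha>"
    using moves_to_Z1[OF z] unfolding moves_to_def by auto
  obtain k' where k': "k' \<in> gen_maps" "\<And>\<alpha>. \<alpha> \<in> Words None \<Longrightarrow> k' (k \<alpha>) = \<alpha>" "\<And>\<alpha>. \<alpha> \<in> Words None \<Longrightarrow> k (k' \<alpha>) = \<alpha>"
    using gen_maps_inverse[OF k(1)] by blast
  have "k' \<circ> (at_cell [Z First] \<theta> \<circ> k) \<in> gen_maps" using k(1) k'(1) t by (intro gen_maps.comp) (simp_all add: red_maps_def)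
  then show ?thesis
  proof (rule gen_maps_cong)
    fix \<alpha> assume a: "\<alpha> \<in> Words None"
    show "at_cell z \<theta> \<alpha> = (k' \<circ> (at_cell [Z First] \<theta> \<circ> k)) \<alpha>"
    proof (cases "\<exists>\<beta>. \<alpha> = z \<frown> \<beta>")
      case True
      then obtain \<beta> where b: "\<alpha> = z \<frown> \<beta>" by blast
      then have B: "\<beta> \<in> Words (Some Red)" using a red_word_Words[OF z] by blast
      have tB: "\<theta> \<beta> \<in> Words (Some Red)" by (rule red_maps_Words[OF t B])
      then have "z \<frown> \<theta> \<beta> \<in> Words None" using red_word_Words[OF z] by blast
      then have "k' (Z First ## \<theta> \<beta>) = z \<frown> \<theta> \<beta>" using k'(2) k(2)[OF tB] by metis
      then show ?thesis by (simp add: b k(2)[OF B])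
    next
      case False
      obtain i \<gamma> where g: "k \<alpha> = Z i ## \<gamma>" "\<gamma> \<in> Words (Some Red)" using gluing_maps_Words[OF gen_maps_gluing_maps[OF k(1)] a] by (rule Words_None_cases)
      \<comment> \<open>The cell of \<open>z\<close> already fills the first base cell under
        \<open>k\<close>, and \<open>k\<close> is injective.\<close>
      have "i \<noteq> First"
      proof
        assume "i = First"
        then have "k \<alpha> = k (z \<frown> \<gamma>)" using k(2)[OF g(2)] g(1) by simp
        then have "\<alpha> = z \<frown> \<gamma>" using k'(2)[OF a] k'(2)[of "z \<frown> \<gamma>"] red_word_Words[OF z] g(2) by metis
        then show False using False by blast
      qed
      then have "at_cell [Z First] \<theta> (k \<alpha>) = k \<alpha>" by (simp add: g(1))
      then show ?thesis using at_other[of \<alpha> z \<theta>] False k'(2)[OF a] by (metis comp_apply)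
    qed
  qed
qed

lemma red_word_Z: "red_word [Z i]" by (simp add: red_word_def)

lemma red_maps_cong:
  assumes "\<theta> \<in> red_maps" "\<And>\<alpha>. \<alpha> \<in> Words (Some Red) \<Longrightarrow> \<theta>' \<alpha> = \<theta> \<alpha>" shows "\<theta>' \<in> red_maps"
proof -
  have "at_cell [Z First] \<theta>' \<in> gen_maps"
    by (rule gen_maps_cong[of "at_cell [Z First] \<theta>"]) (use assms in \<open>auto simp: red_maps_def elim!: Words_None_cases\<close>)
  then show ?thesis using assms by (simp add: red_maps_def)
qed

lemma red_maps_comp:
  assumes "\<theta> \<in> red_maps" "\<theta>' \<in> red_maps" shows "\<theta> \<circ> \<theta>' \<in> red_maps"
proof -
  have "at_cell [Z First] (\<theta> \<circ> \<theta>') \<in> gen_maps"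
    by (rule gen_maps_cong[of "at_cell [Z First] \<theta> \<circ> at_cell [Z First] \<theta>'"])
       (use assms in \<open>auto simp: red_maps_def gen_maps.comp elim!: Words_None_cases\<close>)
  then show ?thesis using assms by (simp add: red_maps_def)
qed

lemma red_maps_id: "id \<in> red_maps"
proof -
  have "at_cell [Z First] id \<in> gen_maps"
    by (rule gen_maps_cong[OF gen_maps.id]) (auto elim!: Words_None_cases)
  then show ?thesis by (simp add: red_maps_def)
qed

lemma red_maps_GG: "l \<in> GG Red \<Longrightarrow> l \<in> red_maps"
proof (induction rule: GG_induct)
  case one
  show ?case by (rule red_maps_cong[OF red_maps_id]) simp
next
  case (gen f)
  then have "at_cell [Z First] (tree_act Red f) \<in> gen_maps" by (intro gen_maps.gen) (simp add: gens_def)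
  then show ?case using GG_Words[OF GG_tree_act_in[OF gen]] by (simp add: red_maps_def)
next
  case (comp f g)
  show ?case by (rule red_maps_cong[OF red_maps_comp[OF comp.IH]]) (simp add: compose_eq OM_c_Words)
qed

lemma red_maps_cell_shift: "cell_shift \<in> red_maps"
  using at_cell_shift_gen_maps by (simp add: red_maps_def)

text \<open>Acting in the child \<open>E j\<close> of the first base cell is acting in the red cell
  of \<open>[Z First, E j]\<close>, which \<open>at_gen_maps\<close> allows.\<close>

lemma red_maps_at:
  assumes "\<theta> \<in> red_maps" "j \<noteq> First" shows "at_cell [E j] \<theta> \<in> red_maps"
proof -
  have "red_word [Z First, E j]" using assms(2) by (simp add: red_word_def)
  from at_gen_maps[OF this assms(1)] have "at_cell [Z First] (at_cell [E j] \<theta>) \<in> gen_maps"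
  proof (rule gen_maps_cong)
    fix \<alpha> assume "\<alpha> \<in> Words None"
    then obtain i \<beta> where b: "\<alpha> = Z i ## \<beta>" "\<beta> \<in> Words (Some Red)" by (rule Words_None_cases)
    from b(2) show "at_cell [Z First] (at_cell [E j] \<theta>) \<alpha> = at_cell [Z First, E j] \<theta> \<alpha>"
      by (cases rule: Words_Red_cases) (simp_all add: b(1))
  qed
  moreover have "at_cell [E j] \<theta> \<alpha> \<in> Words (Some Red)" if "\<alpha> \<in> Words (Some Red)" for \<alpha>
    using that assms by (cases rule: Words_Red_cases) (auto simp: red_maps_Words)
  ultimately show ?thesis by (simp add: red_maps_def)
qed

section \<open>Removing expanded blue edges\<close>

lemma acts_on_cell_step:
  assumes "acts_on_cell \<Phi> y y'" "y \<in> LL" "allowed (Some (color_of y)) x"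
  shows "\<exists>x'. acts_on_cell \<Phi> (y @ [x]) (y' @ [x']) \<and> allowed (Some (color_of y)) x' \<and> (x = E First \<longrightarrow> x' = E First) \<and> y @ [x] \<in> LL"
proof -
  obtain l where l: "y' \<in> LL" "color_of y' = color_of y" "l \<in> GG (color_of y)"
    "\<forall>\<alpha>\<in>Words (Some (color_of y)). \<Phi> (y \<frown> \<alpha>) = y' \<frown> l \<alpha>" using assms(1) by (auto simp: acts_on_cell_def)
  obtain x' l' where s: "allowed (Some (color_of y)) x'" "lcol x' = lcol x" "l' \<in> GG (lcol x)" "x = E First \<longrightarrow> x' = E First"
    "\<forall>\<alpha>\<in>Words (Some (lcol x)). l (x ## \<alpha>) = x' ## l' \<alpha>" using GG_step[OF l(3) assms(3)] by blast
  have L: "y @ [x] \<in> LL" "y' @ [x'] \<in> LL" using LL_append[OF assms(2), of "[x]"] LL_append[OF l(1), of "[x']"] assms(3) s(1) l(2) by auto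
  have c: "color_of (y @ [x]) = lcol x" "color_of (y' @ [x']) = lcol x" using color_of_last L s(2) by auto
  have "\<Phi> ((y @ [x]) \<frown> \<alpha>) = (y' @ [x']) \<frown> l' \<alpha>" if "\<alpha> \<in> Words (Some (lcol x))" for \<alpha>
    using l(4) s(5) that assms(3) by simp
  then have "acts_on_cell \<Phi> (y @ [x]) (y' @ [x'])" unfolding acts_on_cell_def c using L s(3) by blast
  then show ?thesis using s L by blast
qed

lemma acts_on_cell_surj:
  assumes "acts_on_cell \<Phi> w w'" "\<beta> \<in> Words (Some (color_of w))"
  shows "\<exists>\<alpha>\<in>Words (Some (color_of w)). \<Phi> (w \<frown> \<alpha>) = w' \<frown> \<beta>"
proof -
  obtain l where l: "l \<in> GG (color_of w)" "\<forall>\<alpha>\<in>Words (Some (color_of w)). \<Phi> (w \<frown> \<alpha>) = w' \<frown> l \<alpha>"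
    using assms(1) by (auto simp: acts_on_cell_def)
  obtain l' where "l' \<in> GG (color_of w)" "\<forall>\<alpha>\<in>Words (Some (color_of w)). l' (l \<alpha>) = \<alpha> \<and> l (l' \<alpha>) = \<alpha>"
    using GG_inverse[OF l(1)] by blast
  then show ?thesis using l(2) assms(2) GG_Words by metis
qed

text \<open>Nested image cells have a common word, and injectivity pulls it back to both cells. Used
  contrapositively, different edges of an expansion have incomparable images.\<close>

lemma acts_on_cell_comparable:
  assumes k: "k \<in> gluing_maps" and w: "w \<in> LL" "acts_on_cell k w v" and e: "e \<in> LL" "acts_on_cell k e (v @ t)"
  shows "\<exists>\<alpha> \<beta>. e \<frown> \<alpha> = w \<frown> \<beta>"
proof -
  obtain \<delta> where d: "\<delta> \<in> Words (Some (color_of e))" using Words_nonempty by blast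
  obtain \<alpha> where a: "\<alpha> \<in> Words (Some (color_of e))" "k (e \<frown> \<alpha>) = (v @ t) \<frown> \<delta>" using acts_on_cell_surj[OF e(2) d] by blast
  have v: "v \<in> LL" "v @ t \<in> LL" "color_of (v @ t) = color_of e" "color_of v = color_of w" using w(2) e(2) by (auto simp: acts_on_cell_def)
  have "t \<frown> \<delta> \<in> Words (Some (color_of w))"
    using d v LL_append[OF v(1), of t] color_append[OF v(1,2)] by simp
  then obtain \<beta> where b: "\<beta> \<in> Words (Some (color_of w))" "k (w \<frown> \<beta>) = v \<frown> t \<frown> \<delta>" using acts_on_cell_surj[OF w(2)] by blast
  have eq: "k (e \<frown> \<alpha>) = k (w \<frown> \<beta>)" unfolding a(2) b(2) conc_conc ..
  have "e \<frown> \<alpha> \<in> Words None" "w \<frown> \<beta> \<in> Words None" using a(1) b(1) LL_conc[OF e(1)] LL_conc[OF w(1)] by blast+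
  then have "e \<frown> \<alpha> = w \<frown> \<beta>" using k eq unfolding gluing_maps_def bij_betw_def by (auto dest: inj_onD)
  then show ?thesis by blast
qed

text \<open>The children of \<open>z @ [E First]\<close> become \<open>z @ [E First]\<close>,
  \<open>z @ [E Third]\<close> and \<open>z @ [E Second, E First]\<close>, so the two blue ones end
  in \<open>E First\<close> again.\<close>

lemma at_cell_shift_blue:
  assumes k: "acts_on_cell k w (z @ [E First])" and w: "w \<in> LL" "color_of w = Blue" and z: "red_word z" and x: "allowed (Some Blue) x"
  shows "\<exists>y. acts_on_cell (at_cell z cell_shift \<circ> k) (w @ [x]) y \<and> (lcol x = Blue \<longrightarrow> last y = E First)"
proof -
  obtain x' where x': "acts_on_cell k (w @ [x]) ((z @ [E First]) @ [x'])" "allowed (Some Blue) x'" "w @ [x] \<in> LL"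
    using acts_on_cell_step[OF k w(1)] x w(2) by auto
  have c: "color_of (w @ [x]) = lcol x" using color_of_last[OF x'(3)] by simp
  note sl = at_cell_shift_acts_on_cell[OF red_word_LL[OF z]]
  have "\<exists>y. acts_on_cell (at_cell z cell_shift) ((z @ [E First]) @ [x']) y \<and> (color_of y = Blue \<longrightarrow> last y = E First)"
    using x'(2)
  proof (cases rule: allowed_Blue_cases)
    case 1
    then show ?thesis using sl(3) by (intro exI[of _ "z @ [E Second, E First]"]) simp
  next
    case 2
    have "z @ [E Third] \<in> LL" using sl(2)[of "[]"] by (simp add: acts_on_cell_def)
    from color_of_last[OF this] have "color_of (z @ [E Third]) = Red" by simp
    then show ?thesis using 2 sl(2)[of "[]"] by (intro exI[of _ "z @ [E Third]"]) simp
  next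
    case 3
    then show ?thesis using sl(1)[of "[]"] by (intro exI[of _ "z @ [E First]"]) simp
  qed
  then obtain y where y: "acts_on_cell (at_cell z cell_shift) ((z @ [E First]) @ [x']) y" "color_of y = Blue \<longrightarrow> last y = E First" by blast
  have "acts_on_cell (at_cell z cell_shift \<circ> k) (w @ [x]) y" by (rule acts_on_cell_compose[OF x'(1) y(1)])
  moreover from this have "color_of y = lcol x" using c by (simp add: acts_on_cell_def)
  ultimately show ?thesis using y(2) by auto
qed

text \<open>Such a cell either lies below \<open>z @ [E Second]\<close> or
  \<open>z @ [E Third]\<close>, where \<open>E Second\<close> is inserted after \<open>z\<close> and
  the last letter stays, or it is disjoint from the cell of \<open>z\<close> and does not
  move.\<close>

lemma at_cell_shift_other:
  assumes z: "red_word z" and y: "y \<in> LL" "\<And>t. y \<noteq> (z @ [E First]) @ t" "\<And>t. z @ [E First] \<noteq> y @ t"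
  shows "\<exists>y'. acts_on_cell (at_cell z cell_shift) y y' \<and> (last y = E First \<longrightarrow> last y' = E First)"
proof (cases "\<exists>u. y = z @ u")
  case True
  then obtain u where u: "y = z @ u" by blast
  have "u \<noteq> []" using y(3)[of "[E First]"] u by auto
  then obtain x v where x: "u = x # v" by (cases u) auto
  have "valid (Some Red) u" using y(1) LL_append[OF red_word_LL(1)[OF z]] red_word_LL(2)[OF z] unfolding u by simp
  then have v: "allowed (Some Red) x" "valid (Some (lcol x)) v" using x by simp_all
  note sl = at_cell_shift_acts_on_cell[OF red_word_LL[OF z]]
  from v(1) show ?thesis
  proof (cases rule: allowed_Red_cases)
    case 1
    then show ?thesis using y(2)[of v] u x by simp
  next
    case 2
    then show ?thesis using sl(4)[of v] v u x by (intro exI[of _ "z @ E Second # E Second # v"]) auto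
  next
    case 3
    then show ?thesis using sl(5)[of v] v u x by (intro exI[of _ "z @ E Second # E Third # v"]) auto
  qed
next
  case False
  have "at_cell z cell_shift (y \<frown> \<alpha>) = y \<frown> \<alpha>" for \<alpha>
  proof (rule at_other)
    fix \<beta>
    show "y \<frown> \<alpha> \<noteq> z \<frown> \<beta>"
    proof
      assume a: "y \<frown> \<alpha> = z \<frown> \<beta>"
      show False
      proof (cases "length y \<le> length z")
        case True
        obtain t where "z = y @ t" by (rule conc_comparable[OF a True])
        then show False using y(3)[of "t @ [E First]"] by simp
      next
        case f: False
        then have "length z \<le> length y" by simp
        then obtain t where "y = z @ t" by (rule conc_comparable[OF a[symmetric]])
        then show False using False by blast
      qed
    qed
  qed
  then have "acts_on_cell (at_cell z cell_shift) y y" using y(1) by (intro acts_on_cell_replace) auto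
  then show ?thesis by blast
qed

text \<open>Expanding a red edge creates the blue child \<open>E First\<close>, a letter which
  labels fix. The image of a blue edge to be expanded has the form \<open>z @ [E First]\<close> with
  \<open>z\<close> red, and a \<open>cell_shift\<close> inside the cell of \<open>z\<close> restores
  the condition for its children without spoiling it for the other edges.\<close>

lemma normalize_expansion:
  "G \<in> expansions base_graph \<Longrightarrow>
    \<exists>k\<in>gen_maps. \<forall>e\<in>edges G. \<exists>y. acts_on_cell k e y \<and> (color_of e = Blue \<longrightarrow> last y = E First)"
proof (induction rule: expansions.induct)
  case base
  have "acts_on_cell id e e" if "e \<in> LL" for e by (rule acts_on_cell_replace) (use that in auto)
  moreover have "e \<in> LL" "color_of e = Red" if "e \<in> edges base_graph" for e
  proof -
    show "e \<in> LL" using that expansions.base by (auto simp: lang_def)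
    have "ecolor base_graph e = Red" by (simp add: base_graph_def)
    then show "color_of e = Red" using word_color_bdry_base(1)[OF expansions.base that] by simp
  qed
  ultimately show ?case by (intro bexI[OF _ gen_maps.id]) fastforce
next
  case (step G w)
  obtain k where k: "k \<in> gen_maps" and nice: "\<And>e. e \<in> edges G \<Longrightarrow> \<exists>y. acts_on_cell k e y \<and> (color_of e = Blue \<longrightarrow> last y = E First)"
    using step.IH by blast
  have P: "prefix_code (edges G)" by (rule expansion_prefix_code[OF step.hyps(1)])
  then have LG: "\<And>e. e \<in> edges G \<Longrightarrow> e \<in> LL" by (auto simp: prefix_code_def)
  have w: "w \<in> LL" using LG step.hyps by blast
  have E: "edges (expand G w) = (edges G - {w}) \<union> {w @ [x] |x. allowed (Some (color_of w)) x}"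
    using word_color_bdry_base(1)[OF step.hyps] by (simp add: edges_expand)
  have colx: "color_of (w @ [x]) = lcol x" if "allowed (Some (color_of w)) x" for x
    using color_of_last[of "w @ [x]"] LL_append[OF w, of "[x]"] that by simp
  obtain y0 where y0: "acts_on_cell k w y0" "color_of w = Blue \<longrightarrow> last y0 = E First" using nice[OF step.hyps(2)] by blast
  show ?case
  proof (cases "color_of w")
    case Red
    have "\<exists>y. acts_on_cell k e y \<and> (color_of e = Blue \<longrightarrow> last y = E First)" if e: "e \<in> edges (expand G w)" for e
    proof -
      from e consider "e \<in> edges G" | x where "e = w @ [x]" "allowed (Some (color_of w)) x" unfolding E by blast
      then show ?thesis
      proof cases
        case 2
        obtain x' where x': "acts_on_cell k (w @ [x]) (y0 @ [x'])" "x = E First \<longrightarrow> x' = E First" using acts_on_cell_step[OF y0(1) w 2(2)] by blast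
        have "x = E First" if "color_of e = Blue" using 2 colx[OF 2(2)] that Red by (auto simp: allowed_Red split: if_splits)
        then show ?thesis using x' 2(1) by auto
      qed (rule nice)
    qed
    then show ?thesis using k by blast
  next
    case Blue
    have yL: "y0 \<in> LL" "color_of y0 = Blue" using y0(1) Blue by (auto simp: acts_on_cell_def)
    define z where "z = butlast y0"
    have yz: "y0 = z @ [E First]"
      using y0(2) Blue yL(1) length_LL[of y0] unfolding z_def by (metis append_butlast_last_id list.size(3) not_one_le_zero)
    have z: "red_word z"
    proof -
      have "valid None z" "allowed (end_state None z) (E First)" using yL(1) unfolding yz by (simp_all add: LL_iff)
      moreover from this have "end_state None z = Some Red" by (cases "end_state None z" rule: option.exhaust; metis allowed.simps color.exhaust option.exhaust)
      ultimately show ?thesis by (simp add: red_word_def)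
    qed
    let ?k = "at_cell z cell_shift \<circ> k"
    have "\<exists>y. acts_on_cell ?k e y \<and> (color_of e = Blue \<longrightarrow> last y = E First)" if e: "e \<in> edges (expand G w)" for e
    proof -
      from e consider "e \<in> edges G" "e \<noteq> w" | x where "e = w @ [x]" "allowed (Some (color_of w)) x" unfolding E by blast
      then show ?thesis
      proof cases
        case 1
        obtain y where y: "acts_on_cell k e y" "color_of e = Blue \<longrightarrow> last y = E First" using nice[OF 1(1)] by blast
        have ne: "e \<frown> \<alpha> \<noteq> w \<frown> \<beta>" for \<alpha> \<beta> using prefix_code_unique[OF P 1(1) step.hyps(2)] 1(2) by blast
        have "y \<noteq> (z @ [E First]) @ t" for t
          using acts_on_cell_comparable[OF gen_maps_gluing_maps[OF k] w y0(1) LG[OF 1(1)], of t] y(1) ne unfolding yz by blast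
        moreover have "z @ [E First] \<noteq> y @ t" for t
          using acts_on_cell_comparable[OF gen_maps_gluing_maps[OF k] LG[OF 1(1)] y(1) w, of t] y0(1) ne unfolding yz by metis
        moreover have "y \<in> LL" using y(1) by (simp add: acts_on_cell_def)
        ultimately obtain y' where "acts_on_cell (at_cell z cell_shift) y y'" "last y = E First \<longrightarrow> last y' = E First"
          using at_cell_shift_other[OF z] by blast
        then show ?thesis using acts_on_cell_compose[OF y(1)] y(2) by blast
      next
        case 2
        then show ?thesis using at_cell_shift_blue[OF y0(1)[unfolded yz] w Blue z] colx[OF 2(2)] Blue by auto
      qed
    qed
    moreover have "?k \<in> gen_maps" by (rule gen_maps.comp[OF at_gen_maps[OF z red_maps_cell_shift] k])
    ultimately show ?thesis by blast
  qed
qed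

section \<open>Rigidity of normalized maps\<close>

text \<open>A blue edge whose last letter is \<open>E First\<close> comes from expanding a red edge; in a partition all
  of whose blue edges are of this kind, no blue edge has been expanded.\<close>

definition normalized :: "(iword \<Rightarrow> iword) \<Rightarrow> nat \<Rightarrow> bool" where
  "normalized \<Phi> N \<longleftrightarrow> (\<forall>\<alpha>\<in>Words None. \<exists>y y'. y \<in> LL \<and> (\<exists>\<beta>. \<alpha> = y \<frown> \<beta>) \<and> length y \<le> N \<and> acts_on_cell \<Phi> y y' \<and>
    (color_of y = Blue \<longrightarrow> last y = E First \<and> last y' = E First))"

lemma gdE:
  assumes "normalized \<Phi> N" "\<alpha> \<in> Words None"
  obtains y y' \<beta> where "y \<in> LL" "\<alpha> = y \<frown> \<beta>" "length y \<le> N" "acts_on_cell \<Phi> y y'"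
    "color_of y = Blue \<longrightarrow> last y = E First" "color_of y = Blue \<longrightarrow> last y' = E First"
  using assms unfolding normalized_def by blast

lemma locE:
  assumes "acts_on_cell \<Phi> y y'"
  obtains l where "y' \<in> LL" "color_of y' = color_of y" "l \<in> GG (color_of y)"
    "\<forall>\<alpha>\<in>Words (Some (color_of y)). \<Phi> (y \<frown> \<alpha>) = y' \<frown> l \<alpha>"
  using assms unfolding acts_on_cell_def by blast

lemma gluing_maps_inj: "\<Phi> \<in> gluing_maps \<Longrightarrow> \<alpha> \<in> Words None \<Longrightarrow> \<beta> \<in> Words None \<Longrightarrow> \<Phi> \<alpha> = \<Phi> \<beta> \<Longrightarrow> \<alpha> = \<beta>"
  unfolding gluing_maps_def bij_betw_def by (auto dest: inj_onD)

text \<open>Gluing classes go to gluing classes, so the addresses of one branch point are carried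
  injectively to addresses of one branch point.\<close>

lemma gluing_maps_vertex_address:
  assumes P: "\<Phi> \<in> gluing_maps" and v: "valid None (e @ [x])" "valid None (e @ [y])" and a: "\<Phi> (vertex_address e x) = vertex_address e' x'"
  shows "\<exists>y'. \<Phi> (vertex_address e y) = vertex_address e' y' \<and> valid None (e' @ [y']) \<and> (y' = x' \<longrightarrow> y = x)"
proof -
  have "eqv (\<Phi> (vertex_address e x)) (\<Phi> (vertex_address e y))" using gluing_maps_eqv[OF P, of "vertex_address e x" "vertex_address e y"] v eqv_adrs by simp
  then obtain y' where y: "\<Phi> (vertex_address e y) = vertex_address e' y'" unfolding a eqv_vertex_address by blast
  have "vertex_address e' y' \<in> Words None" unfolding y[symmetric] by (rule gluing_maps_Words[OF P]) (use v in simp)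
  moreover have "y = x" if "y' = x'"
    using gluing_maps_inj[OF P, of "vertex_address e y" "vertex_address e x"] v a y that vertex_address_inj by simp
  ultimately show ?thesis using y by auto
qed

text \<open>A cell on the way of an initial address is named by a blue letter followed by letters
  \<open>I Third\<close>. If its word ends in \<open>E First\<close>, no \<open>I Third\<close>
  occurs and the cell is as large as possible.\<close>

lemma blue_last:
  assumes "I3w = v \<frown> \<beta>" "z @ x # v \<in> LL" "lcol x = Blue"
  shows "color_of (z @ x # v) = Blue" "last (z @ x # v) = E First \<Longrightarrow> v = []"
proof -
  have s: "set v \<subseteq> {I Third}" using I3w_suffix[OF assms(1)] by blast
  have v: "last v = I Third" if "v \<noteq> []" using s last_in_set[OF that] by blast
  show "color_of (z @ x # v) = Blue" using color_of_last[OF assms(2)] v assms(3) by (cases "v = []") simp_all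
  show "v = []" if "last (z @ x # v) = E First" using v that by (cases "v = []") simp_all
qed

text \<open>Consider the piece of the partition containing the initial address of \<open>z\<close>.
  If it contains the whole cell, \<Phi> acts there by a label. Otherwise normalization forces it to
  be \<open>z @ [E First]\<close> with image \<open>z' @ [E First]\<close> and trivial label; then
  centre goes to centre, the two red children are kept or interchanged, and the argument descends
  into them.\<close>

lemma rigid:
  assumes P: "\<Phi> \<in> gluing_maps" and g: "normalized \<Phi> N"
  shows "red_word z \<Longrightarrow> red_word z' \<Longrightarrow> \<Phi> (z \<frown> initial_address Red) = z' \<frown> initial_address Red \<Longrightarrow>
    \<exists>\<theta>\<in>red_maps. \<forall>\<alpha>\<in>Words (Some Red). \<Phi> (z \<frown> \<alpha>) = z' \<frown> \<theta> \<alpha>"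
proof (induction "N - length z" arbitrary: z z' rule: less_induct)
  case less
  note z = less.prems(1) and z' = less.prems(2) and k = less.prems(3)
  have "z \<frown> initial_address Red \<in> Words None" using red_word_Words[OF z] by simp
  then obtain y y' \<beta> where y: "y \<in> LL" "z \<frown> initial_address Red = y \<frown> \<beta>" "length y \<le> N" "acts_on_cell \<Phi> y y'"
    "color_of y = Blue \<longrightarrow> last y = E First" "color_of y = Blue \<longrightarrow> last y' = E First" by (rule gdE[OF g])
  show ?case
  proof (cases "length y \<le> length z")
    case True
    obtain u where u: "z = y @ u" by (rule conc_comparable[OF y(2)[symmetric] True])
    obtain u' where u': "acts_on_cell \<Phi> z (y' @ u')"
      using acts_on_cell_append[OF y(4,1), of u] red_word_LL(1)[OF z] unfolding u by blast
    obtain l where l: "y' @ u' \<in> LL" "color_of (y' @ u') = Red" "l \<in> GG Red"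
      "\<forall>\<alpha>\<in>Words (Some Red). \<Phi> (z \<frown> \<alpha>) = (y' @ u') \<frown> l \<alpha>"
      by (rule locE[OF u', unfolded red_word_LL(2)[OF z]])
    have "(y' @ u') \<frown> initial_address Red = z' \<frown> initial_address Red" using bspec[OF l(4) initial_address_Words] GG_initial_address[OF l(3)] k by simp
    then have "y' @ u' = z'" by (rule red_word_initial_address[OF LL_red_word[OF l(1,2)] z'])
    then show ?thesis using l(4) red_maps_GG[OF l(3)] by blast
  next
    case False
    then have "length z \<le> length y" by simp
    then obtain u where u: "y = z @ u" "initial_address Red = u \<frown> \<beta>" by (rule conc_comparable[OF y(2)])
    then obtain x v where x: "u = x # v" using False by (cases u) auto
    have "E First ## I3w = x ## v \<frown> \<beta>" using u(2) unfolding x initial_address_simps build_cons .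
    then have xv: "x = E First" "I3w = v \<frown> \<beta>" unfolding build_eq by simp_all
    have yx: "y = z @ E First # v" using u(1) x xv(1) by simp
    have yv: "z @ E First # v \<in> LL" using y(1) unfolding yx .
    have bl: "color_of y = Blue" using blue_last(1)[OF xv(2) yv] unfolding yx by simp
    \<comment> \<open>Here the normalization of the domain enters: a blue piece ending in
      \<open>I Third\<close> would come from an expanded blue edge.\<close>
    have "v = []" using blue_last(2)[OF xv(2) yv] mp[OF y(5) bl] unfolding yx by simp
    then have yz: "y = z @ [E First]" using yx by simp
    obtain l where l: "y' \<in> LL" "color_of y' = Blue" "l \<in> GG Blue"
      "\<forall>\<alpha>\<in>Words (Some Blue). \<Phi> (y \<frown> \<alpha>) = y' \<frown> l \<alpha>"
      by (rule locE[OF y(4), unfolded bl])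
    define t where "t = butlast y'"
    have yt: "y' = t @ [E First]"
    proof -
      have "y' \<noteq> []" using l(1) by (simp add: LL_iff)
      from append_butlast_last_id[OF this] show ?thesis unfolding t_def mp[OF y(6) bl] by simp
    qed
    have "\<Phi> (y \<frown> I3w) = y' \<frown> l I3w" by (rule bspec[OF l(4) I3w_Words])
    moreover have "y \<frown> I3w = z \<frown> initial_address Red" by (simp add: yz initial_address_simps)
    ultimately have eq: "y' \<frown> l I3w = (z' @ [E First]) \<frown> I3w" using k by (simp add: initial_address_simps)
    \<comment> \<open>With \<open>phi3\<close> the image of the initial vertex would have
      \<open>I First\<close> as its last letter before the tail \<open>I3w\<close>, while the
      initial address of \<open>z'\<close> has \<open>E First\<close> there.\<close>
    have "l \<noteq> phi3"
    proof
      assume "l = phi3"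
      then have "(t @ [E First, I First]) \<frown> I3w = (z' @ [E First]) \<frown> I3w" using eq by (simp add: yt initial_address_simps)
      then have "t @ [E First, I First] = z' @ [E First]" by (rule I3w_cancel) simp_all
      then have "last (t @ [E First, I First]) = last (z' @ [E First])" by simp
      then show False by simp
    qed
    then have lid: "l = idc Blue" using GG_Blue[OF l(3)] by blast
    then have "y' \<frown> I3w = (z' @ [E First]) \<frown> I3w" using eq by simp
    then have "y' = z' @ [E First]" by (rule I3w_cancel) (simp_all add: yt)
    then have b: "\<Phi> (z \<frown> E First ## \<alpha>) = z' \<frown> E First ## \<alpha>" if "\<alpha> \<in> Words (Some Blue)" for \<alpha>
      using bspec[OF l(4) that] that lid by (simp add: yz)
    have valid: "valid None (z @ [E i])" for i using z by (simp add: red_word_def)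
    \<comment> \<open>The other end of the blue edge is now fixed too: the centre of
      \<open>z\<close> goes to the centre of \<open>z'\<close>, so its two remaining addresses go to
      \<open>E Second\<close> and \<open>E Third\<close> in some order.\<close>
    have a1: "\<Phi> (vertex_address z (E First)) = vertex_address z' (E First)" using b[of "initial_address Blue"] by (simp add: vertex_address_def)
    obtain x2 where x2: "\<Phi> (vertex_address z (E Second)) = vertex_address z' x2" "valid None (z' @ [x2])" "x2 \<noteq> E First"
      using gluing_maps_vertex_address[OF P valid valid a1, of Second] by auto
    obtain x3 where x3: "\<Phi> (vertex_address z (E Third)) = vertex_address z' x3" "valid None (z' @ [x3])" "x3 \<noteq> E First"
      using gluing_maps_vertex_address[OF P valid valid a1, of Third] by auto
    have ne: "x2 \<noteq> x3" using gluing_maps_vertex_address[OF P valid valid x2(1), of Third] x3(1) vertex_address_inj by auto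
    have "allowed (Some Red) x2" "allowed (Some Red) x3" using x2(2) x3(2) z' by (simp_all add: red_word_def)
    then consider "x2 = E Second" "x3 = E Third" | "x2 = E Third" "x3 = E Second"
      using x2(3) x3(3) ne by (auto elim!: allowed_Red_cases)
    moreover have sub: "\<exists>\<theta>\<in>red_maps. \<forall>\<alpha>\<in>Words (Some Red). \<Phi> (z \<frown> E i ## \<alpha>) = z' \<frown> E j ## \<theta> \<alpha>"
      if h: "i \<noteq> First" "j \<noteq> First" "\<Phi> (vertex_address z (E i)) = vertex_address z' (E j)" for i j
    proof -
      \<comment> \<open>The piece \<open>z @ [E First]\<close> has length at most \<open>N\<close>,
        so \<open>z\<close> is strictly shorter than \<open>N\<close> and the difference really
        decreases.\<close>
      have "N - length (z @ [E i]) < N - length z" using y(3) yz by simp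
      moreover have "red_word (z @ [E i])" "red_word (z' @ [E j])" using z z' h by (simp_all add: red_word_def)
      moreover have "\<Phi> ((z @ [E i]) \<frown> initial_address Red) = (z' @ [E j]) \<frown> initial_address Red" using h by (simp add: vertex_address_def)
      ultimately have "\<exists>\<theta>\<in>red_maps. \<forall>\<alpha>\<in>Words (Some Red). \<Phi> ((z @ [E i]) \<frown> \<alpha>) = (z' @ [E j]) \<frown> \<theta> \<alpha>" by (rule less.hyps)
      then show ?thesis by simp
    qed
    ultimately show ?thesis
    proof cases
      case 1
      obtain \<theta>2 where t2: "\<theta>2 \<in> red_maps" "\<forall>\<alpha>\<in>Words (Some Red). \<Phi> (z \<frown> E Second ## \<alpha>) = z' \<frown> E Second ## \<theta>2 \<alpha>"
        using sub[of Second Second] x2(1) 1 by auto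
      obtain \<theta>3 where t3: "\<theta>3 \<in> red_maps" "\<forall>\<alpha>\<in>Words (Some Red). \<Phi> (z \<frown> E Third ## \<alpha>) = z' \<frown> E Third ## \<theta>3 \<alpha>"
        using sub[of Third Third] x3(1) 1 by auto
      let ?\<theta> = "at_cell [E Second] \<theta>2 \<circ> at_cell [E Third] \<theta>3"
      have "?\<theta> \<in> red_maps" by (intro red_maps_comp red_maps_at t2 t3) simp_all
      moreover have "\<Phi> (z \<frown> \<alpha>) = z' \<frown> ?\<theta> \<alpha>" if "\<alpha> \<in> Words (Some Red)" for \<alpha>
        using that by (cases rule: Words_Red_cases) (simp_all add: b t2 t3)
      ultimately show ?thesis by blast
    next
      case 2
      obtain \<theta>2 where t2: "\<theta>2 \<in> red_maps" "\<forall>\<alpha>\<in>Words (Some Red). \<Phi> (z \<frown> E Second ## \<alpha>) = z' \<frown> E Third ## \<theta>2 \<alpha>"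
        using sub[of Second Third] x2(1) 2 by auto
      obtain \<theta>3 where t3: "\<theta>3 \<in> red_maps" "\<forall>\<alpha>\<in>Words (Some Red). \<Phi> (z \<frown> E Third ## \<alpha>) = z' \<frown> E Second ## \<theta>3 \<alpha>"
        using sub[of Third Second] x3(1) 2 by auto
      \<comment> \<open>The interchange of the two red children is the generator
        \<open>a\<close>.\<close>
      let ?\<theta> = "tree_act Red wa \<circ> (at_cell [E Second] \<theta>2 \<circ> at_cell [E Third] \<theta>3)"
      have "tree_act Red wa \<in> red_maps" by (intro red_maps_GG GG_tree_act_in) (simp add: wgens_def)
      then have "?\<theta> \<in> red_maps" by (intro red_maps_comp red_maps_at t2 t3) simp_all
      moreover have "\<Phi> (z \<frown> \<alpha>) = z' \<frown> ?\<theta> \<alpha>" if "\<alpha> \<in> Words (Some Red)" for \<alpha>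
        using that by (cases rule: Words_Red_cases)
          (simp_all add: b t2 t3 tree_act_eq red_maps_Words[OF t2(1)] red_maps_Words[OF t3(1)] generator_recursion[simplified])
      ultimately show ?thesis by blast
    qed
  qed
qed

section \<open>Moving the image of the root back\<close>

text \<open>If the second map fails to act on an image cell, the piece must be red and is split into
  its three children. The only blue child is \<open>E First\<close>, so the condition on endings
  survives, and the length bound grows by one.\<close>

lemma normalized_post:
  assumes g: "normalized \<Phi> N"
    and h: "\<And>y y'. y \<in> LL \<Longrightarrow> acts_on_cell \<Phi> y y' \<Longrightarrow> (color_of y = Blue \<longrightarrow> last y = E First \<and> last y' = E First) \<Longrightarrow>
      (\<exists>y''. acts_on_cell \<Psi> y' y'' \<and> (last y' = E First \<longrightarrow> last y'' = E First)) \<or>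
      (color_of y = Red \<and> (\<forall>x. allowed (Some Red) x \<longrightarrow> (\<exists>y''. acts_on_cell \<Psi> (y' @ [x]) y'' \<and> (x = E First \<longrightarrow> last y'' = E First))))"
  shows "normalized (\<Psi> \<circ> \<Phi>) (Suc N)"
  unfolding normalized_def
proof
  fix \<alpha> assume a: "\<alpha> \<in> Words None"
  let ?C = "\<lambda>y y'. y \<in> LL \<and> (\<exists>\<beta>. \<alpha> = y \<frown> \<beta>) \<and> length y \<le> Suc N \<and> acts_on_cell (\<Psi> \<circ> \<Phi>) y y' \<and>
    (color_of y = Blue \<longrightarrow> last y = E First \<and> last y' = E First)"
  obtain y y' \<beta> where y: "y \<in> LL" "\<alpha> = y \<frown> \<beta>" "length y \<le> N" "acts_on_cell \<Phi> y y'"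
    "color_of y = Blue \<longrightarrow> last y = E First" "color_of y = Blue \<longrightarrow> last y' = E First" using a by (rule gdE[OF g])
  from h[OF y(1,4)] y(5,6)
  consider y'' where "acts_on_cell \<Psi> y' y''" "last y' = E First \<longrightarrow> last y'' = E First"
    | "color_of y = Red" "\<And>x. allowed (Some Red) x \<Longrightarrow> \<exists>y''. acts_on_cell \<Psi> (y' @ [x]) y'' \<and> (x = E First \<longrightarrow> last y'' = E First)" by blast
  then show "\<exists>y y'. ?C y y'"
  proof cases
    case 1
    have "?C y y''" using y 1 acts_on_cell_compose[OF y(4) 1(1)] by auto
    then show ?thesis by blast
  next
    case 2
    have "\<beta> \<in> Words (Some Red)" using a y(2) LL_conc[OF y(1), of \<beta>] 2(1) by simp
    then obtain x \<gamma> where x: "\<beta> = x ## \<gamma>" "allowed (Some Red) x" by (rule Words_cases)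
    obtain x' where x': "acts_on_cell \<Phi> (y @ [x]) (y' @ [x'])" "allowed (Some Red) x'" "x = E First \<longrightarrow> x' = E First" "y @ [x] \<in> LL"
      using acts_on_cell_step[OF y(4,1)] x(2) 2(1) by auto
    obtain y'' where y'': "acts_on_cell \<Psi> (y' @ [x']) y''" "x' = E First \<longrightarrow> last y'' = E First" using 2(2)[OF x'(2)] by blast
    have "color_of (y @ [x]) = Blue \<Longrightarrow> x = E First"
      using color_of_last[OF x'(4)] x(2) by (auto simp: allowed_Red split: if_splits)
    then have "?C (y @ [x]) y''" using x'(3,4) y''(2) acts_on_cell_compose[OF x'(1) y''(1)] y(2,3) x(1) by auto
    then show ?thesis by blast
  qed
qed

lemma normalized_base_perm: "normalized \<Phi> N \<Longrightarrow> normalized (base_perm \<sigma> \<circ> \<Phi>) (Suc N)"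
proof (rule normalized_post)
  fix y y' assume "acts_on_cell \<Phi> y y'"
  then have "y' \<in> LL" by (simp add: acts_on_cell_def)
  then obtain i u where u: "y' = Z i # u" "y' \<in> LL" unfolding LL_Cons by auto
  then have "acts_on_cell (base_perm \<sigma>) y' (Z (\<sigma> i) # u)" using base_perm_acts_on_cell by blast
  moreover have "last y' = E First \<longrightarrow> last (Z (\<sigma> i) # u) = E First" by (simp add: u(1))
  ultimately show "(\<exists>y''. acts_on_cell (base_perm \<sigma>) y' y'' \<and> (last y' = E First \<longrightarrow> last y'' = E First)) \<or>
      (color_of y = Red \<and> (\<forall>x. allowed (Some Red) x \<longrightarrow> (\<exists>y''. acts_on_cell (base_perm \<sigma>) (y' @ [x]) y'' \<and> (x = E First \<longrightarrow> last y'' = E First))))"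
    by blast
qed

text \<open>Only a piece with image \<open>[Z First]\<close> has to be split; on every other cell
  \<open>root_swap\<close> acts and keeps the ending \<open>E First\<close>.\<close>

lemma normalized_root_swap: "normalized \<Phi> N \<Longrightarrow> normalized (root_swap \<circ> \<Phi>) (Suc N)"
proof (rule normalized_post)
  fix y y' assume l: "acts_on_cell \<Phi> y y'"
  then have y': "y' \<in> LL" "color_of y' = color_of y" by (simp_all add: acts_on_cell_def)
  show "(\<exists>y''. acts_on_cell root_swap y' y'' \<and> (last y' = E First \<longrightarrow> last y'' = E First)) \<or>
      (color_of y = Red \<and> (\<forall>x. allowed (Some Red) x \<longrightarrow> (\<exists>y''. acts_on_cell root_swap (y' @ [x]) y'' \<and> (x = E First \<longrightarrow> last y'' = E First))))"
  proof (cases "y' = [Z First]")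
    case False
    then show ?thesis using root_swap_acts_on_cell_last[OF y'(1)] by blast
  next
    case True
    then have "color_of y = Red" using y'(2) Z1_LL(2) by simp
    moreover have "\<exists>y''. acts_on_cell root_swap (y' @ [x]) y'' \<and> (x = E First \<longrightarrow> last y'' = E First)" if "allowed (Some Red) x" for x
    proof -
      have "y' @ [x] \<in> LL" using that True by (simp add: LL_iff)
      then show ?thesis using root_swap_acts_on_cell_last[of "y' @ [x]"] True by auto
    qed
    ultimately show ?thesis by blast
  qed
qed

text \<open>The range partition expands no blue edge, so some piece of it contains the whole cell of
  \<open>b\<close>. Then all three addresses of the root would come from one piece of the domain,
  though they differ in their first letter.\<close>

lemma no_blue_prefix:
  assumes P: "\<Phi> \<in> gluing_maps" and g: "normalized \<Phi> N"
    and t: "\<And>i. \<Phi> (vertex_address [] (Z i)) = vertex_address t (x i)"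
    and b: "b \<in> LL" "color_of b = Blue" "t = b @ s"
  shows False
proof -
  \<comment> \<open>The terminal corner of \<open>b\<close> is a probe: every proper subcell of
    \<open>b\<close> containing it has a word ending in \<open>I Third\<close>, which normalization
    forbids.\<close>
  have bO: "b \<frown> I3w \<in> Words None" using LL_conc[OF b(1)] b(2) by simp
  have "b \<frown> I3w \<in> \<Phi> ` Words None" using P bO by (auto simp: gluing_maps_def bij_betw_def)
  then obtain \<alpha> where a: "\<alpha> \<in> Words None" "\<Phi> \<alpha> = b \<frown> I3w" by auto
  obtain y y' \<beta> where y: "y \<in> LL" "\<alpha> = y \<frown> \<beta>" "length y \<le> N" "acts_on_cell \<Phi> y y'"
    "color_of y = Blue \<longrightarrow> last y = E First" "color_of y = Blue \<longrightarrow> last y' = E First" using a(1) by (rule gdE[OF g])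
  obtain l where l: "y' \<in> LL" "color_of y' = color_of y" "l \<in> GG (color_of y)"
    "\<forall>\<alpha>\<in>Words (Some (color_of y)). \<Phi> (y \<frown> \<alpha>) = y' \<frown> l \<alpha>" using y(4) by (rule locE)
  have "\<beta> \<in> Words (Some (color_of y))" using a(1) y(2) LL_conc[OF y(1)] by simp
  then have eq: "y' \<frown> l \<beta> = b \<frown> I3w" using l(4) a(2) y(2) by simp
  show False
  proof (cases "length y' \<le> length b")
    case True
    obtain u where u: "b = y' @ u" by (rule conc_comparable[OF eq True])
    have tu: "t = y' @ u @ s" using b(3) u by simp
    have one: "\<exists>\<delta>. vertex_address [] (Z i) = y \<frown> \<delta>" for i
    proof -
      have Oi: "vertex_address [] (Z i) \<in> Words None" by simp
      have "vertex_address t (x i) \<in> Words None" unfolding t[symmetric] by (rule gluing_maps_Words[OF P Oi])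
      then have "y' \<frown> vertex_address (u @ s) (x i) \<in> Words None" by (simp only: tu vertex_address_conc)
      then have "vertex_address (u @ s) (x i) \<in> Words (Some (color_of y))" using LL_conc[OF l(1)] unfolding l(2) by blast
      then obtain \<delta> where d: "\<delta> \<in> Words (Some (color_of y))" "\<Phi> (y \<frown> \<delta>) = y' \<frown> vertex_address (u @ s) (x i)"
        using acts_on_cell_surj[OF y(4)] by blast
      then have "\<Phi> (y \<frown> \<delta>) = \<Phi> (vertex_address [] (Z i))" unfolding t tu vertex_address_conc by simp
      moreover have "y \<frown> \<delta> \<in> Words None" using LL_conc[OF y(1)] d(1) by blast
      ultimately have "y \<frown> \<delta> = vertex_address [] (Z i)" using gluing_maps_inj[OF P _ Oi] by blast
      then show ?thesis by (intro exI[of _ \<delta>]) (rule sym)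
    qed
    obtain j v where j: "y = Z j # v" using y(1) LL_Cons by auto
    have "j = i" for i using one[of i] j by (auto simp: vertex_address_def)
    from this[of First] this[of Second] show False by simp
  next
    case False
    then have "length b \<le> length y'" by simp
    then obtain v where v: "y' = b @ v" "I3w = v \<frown> l \<beta>" by (rule conc_comparable[OF eq[symmetric]])
    then have "v \<noteq> []" using False by auto
    moreover have "set v \<subseteq> {I Third}" using I3w_suffix[OF v(2)] by blast
    ultimately have "last v = I Third" using last_in_set by blast
    then have "last y' = I Third" using v(1) \<open>v \<noteq> []\<close> by simp
    moreover from this have "color_of y = Blue" using color_of_last[OF l(1)] l(2) by simp
    ultimately show False using y(6) by simp
  qed
qed

lemma swap_first_swap_first: "swap_first i (swap_first i j) = j"
  by (simp add: swap_first_def)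

lemma Z_vertex_address: "[Z i] \<frown> initial_address Red = vertex_address [] (Z i)"
  by (simp add: vertex_address_def)

text \<open>The length of \<open>t\<close>, the position of the image of the root, measures the
  distance to a map fixing the root. Bringing \<open>t\<close> into the first base cell and applying
  \<open>root_swap\<close> shortens it; once \<open>t\<close> is empty, \<open>rigid\<close> applies
  to the three base cells separately.\<close>

lemma normalized_gen_maps:
  "\<Phi> \<in> gluing_maps \<Longrightarrow> normalized \<Phi> N \<Longrightarrow> (\<And>i. \<Phi> (vertex_address [] (Z i)) = vertex_address t (x i)) \<Longrightarrow> \<Phi> \<in> gen_maps"
proof (induction "length t" arbitrary: t x \<Phi> N rule: less_induct)
  case less
  note P = less.prems(1) and g = less.prems(2) and t = less.prems(3)
  have v: "valid None (t @ [x i])" for i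
  proof -
    have "vertex_address t (x i) \<in> Words None" unfolding t[symmetric] by (rule gluing_maps_Words[OF P]) simp
    then show ?thesis by simp
  qed
  show ?case
  proof (cases t)
    case Nil
    have "\<exists>j. x i = Z j" for i using v[of i] Nil by (simp add: allowed_None)
    then obtain \<sigma> where s: "\<And>i. x i = Z (\<sigma> i)" by metis
    have inj: "inj \<sigma>"
    proof (rule injI)
      fix i j assume "\<sigma> i = \<sigma> j"
      then have "\<Phi> (vertex_address [] (Z i)) = \<Phi> (vertex_address [] (Z j))" by (simp add: t s)
      then have "vertex_address [] (Z i) = vertex_address [] (Z j)" by (rule gluing_maps_inj[OF P, rotated 2]) simp_all
      then show "i = j" unfolding vertex_address_inj by simp
    qed
    then have bij: "bij \<sigma>" using finite_idx by (simp add: bij_def finite_UNIV_inj_surj)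
    have "\<exists>\<theta>\<in>red_maps. \<forall>\<alpha>\<in>Words (Some Red). \<Phi> ([Z i] \<frown> \<alpha>) = [Z (\<sigma> i)] \<frown> \<theta> \<alpha>" for i
      by (rule rigid[OF P g red_word_Z red_word_Z]) (simp only: Z_vertex_address t Nil s)
    then have "\<exists>\<theta>. \<theta> \<in> red_maps \<and> (\<forall>\<alpha>\<in>Words (Some Red). \<Phi> (Z i ## \<alpha>) = Z (\<sigma> i) ## \<theta> \<alpha>)" for i by auto
    then have "\<forall>i. \<exists>\<theta>. \<theta> \<in> red_maps \<and> (\<forall>\<alpha>\<in>Words (Some Red). \<Phi> (Z i ## \<alpha>) = Z (\<sigma> i) ## \<theta> \<alpha>)" by blast
    from choice[OF this] obtain \<theta> where th: "\<And>i. \<theta> i \<in> red_maps"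
      "\<And>i \<alpha>. \<alpha> \<in> Words (Some Red) \<Longrightarrow> \<Phi> (Z i ## \<alpha>) = Z (\<sigma> i) ## \<theta> i \<alpha>" by blast
    let ?k = "base_perm \<sigma> \<circ> (at_cell [Z First] (\<theta> First) \<circ> (at_cell [Z Second] (\<theta> Second) \<circ> at_cell [Z Third] (\<theta> Third)))"
    have "?k \<in> gen_maps" by (intro gen_maps.comp base_perm_gen_maps[OF bij] at_gen_maps red_word_Z th)
    then show ?thesis
    proof (rule gen_maps_cong)
      fix \<alpha> assume "\<alpha> \<in> Words None"
      then obtain i \<beta> where b: "\<alpha> = Z i ## \<beta>" "\<beta> \<in> Words (Some Red)" by (rule Words_None_cases)
      show "\<Phi> \<alpha> = ?k \<alpha>" unfolding b(1) th(2)[OF b(2)] by (cases i) simp_all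
    qed
  next
    case (Cons z u)
    have "allowed None z" using v[of First] Cons by simp
    then obtain j where z: "z = Z j" by (auto simp: allowed_None)
    let ?\<Psi> = "root_swap \<circ> (base_perm (swap_first j) \<circ> \<Phi>)"
    have H: "?\<Psi> \<in> gluing_maps" by (intro gluing_maps_compose root_swap_gluing_maps base_perm_gluing_maps swap_first P)
    have G: "normalized ?\<Psi> (Suc (Suc N))" by (intro normalized_root_swap normalized_base_perm g)
    have e: "?\<Psi> (vertex_address [] (Z i)) = root_swap (Z First ## vertex_address u (x i))" for i
      by (simp add: t Cons z swap_first(2) flip: vertex_address_build)
    have "\<exists>t' x'. length t' < length t \<and> (\<forall>i. ?\<Psi> (vertex_address [] (Z i)) = vertex_address t' (x' i))"
    proof (cases u)
      case Nil
      have "\<exists>y. root_swap (Z First ## vertex_address u (x i)) = vertex_address [] y" for i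
      proof -
        have "allowed (Some Red) (x i)" using v[of i] Cons Nil z by simp
        then show ?thesis by (rule allowed_Red_cases) (auto simp: Nil vertex_address_def initial_address_simps)
      qed
      then have "\<forall>i. \<exists>y. ?\<Psi> (vertex_address [] (Z i)) = vertex_address [] y" unfolding e by blast
      from choice[OF this] obtain x' where "\<forall>i. ?\<Psi> (vertex_address [] (Z i)) = vertex_address [] (x' i)" by blast
      then show ?thesis using Cons by (intro exI[of _ "[]"] exI[of _ x']) simp
    next
      case c: (Cons w u')
      have "allowed (Some Red) w" using v[of First] Cons c z by simp
      then show ?thesis
      proof (cases rule: allowed_Red_cases)
        case 1
        \<comment> \<open>In this direction \<open>root_swap\<close> would not shorten
          \<open>t\<close>, but the image of the root cannot lie inside a blue cell.\<close>
        have "[Z j, E First] \<in> LL" by (simp add: LL_iff)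
        moreover from this have "color_of [Z j, E First] = Blue" by (simp add: color_of_last)
        ultimately have False using no_blue_prefix[OF P g t, of "[Z j, E First]" u'] Cons c z 1 by simp
        then show ?thesis ..
      next
        case 2
        have "?\<Psi> (vertex_address [] (Z i)) = vertex_address (Z Second # u') (x i)" for i unfolding e c 2 by (simp flip: vertex_address_build)
        then show ?thesis using Cons c by (intro exI[of _ "Z Second # u'"] exI[of _ x]) simp
      next
        case 3
        have "?\<Psi> (vertex_address [] (Z i)) = vertex_address (Z Third # u') (x i)" for i unfolding e c 3 by (simp flip: vertex_address_build)
        then show ?thesis using Cons c by (intro exI[of _ "Z Third # u'"] exI[of _ x]) simp
      qed
    qed
    then obtain t' x' where t': "length t' < length t" "\<And>i. ?\<Psi> (vertex_address [] (Z i)) = vertex_address t' (x' i)" by blast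
    have K: "?\<Psi> \<in> gen_maps" by (rule less.hyps[OF t'(1) H G t'(2)])
    have "base_perm (swap_first j) \<circ> (root_swap \<circ> ?\<Psi>) \<in> gen_maps" by (intro gen_maps.comp base_perm_gen_maps swap_first root_swap_gen_maps K)
    then show ?thesis
    proof (rule gen_maps_cong)
      fix \<alpha> assume a: "\<alpha> \<in> Words None"
      obtain i \<beta> where b: "\<Phi> \<alpha> = Z i ## \<beta>" "\<beta> \<in> Words (Some Red)" using gluing_maps_Words[OF P a] by (rule Words_None_cases)
      have "base_perm (swap_first j) (\<Phi> \<alpha>) \<in> Words None" using b by simp
      then have "root_swap (?\<Psi> \<alpha>) = base_perm (swap_first j) (\<Phi> \<alpha>)" using root_swap_root_swap by simp
      then show "\<Phi> \<alpha> = (base_perm (swap_first j) \<circ> (root_swap \<circ> ?\<Psi>)) \<alpha>" by (simp add: b(1) swap_first_swap_first)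
    qed
  qed
qed

section \<open>The generating set of the group\<close>

lemma EG_gen_maps:
  assumes "h \<in> carrier EG" shows "\<exists>\<Phi>\<in>gen_maps. h = limit_map \<Phi>"
proof -
  obtain \<Phi> D D' where P: "\<Phi> \<in> gluing_maps" "h = limit_map \<Phi>" and D: "D \<in> expansions base_graph" "D' \<in> expansions base_graph"
    and e: "\<And>e. e \<in> edges D \<Longrightarrow> \<exists>e'\<in>edges D'. acts_on_cell \<Phi> e e'"
    using EG_imp_gluing_maps[OF assms] by blast
  obtain k where k: "k \<in> gen_maps" "\<And>e. e \<in> edges D \<Longrightarrow> \<exists>y. acts_on_cell k e y \<and> (color_of e = Blue \<longrightarrow> last y = E First)"
    using normalize_expansion[OF D(1)] by blast
  obtain m where m: "m \<in> gen_maps" "\<And>e. e \<in> edges D' \<Longrightarrow> \<exists>y. acts_on_cell m e y \<and> (color_of e = Blue \<longrightarrow> last y = E First)"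
    using normalize_expansion[OF D(2)] by blast
  obtain k' where k': "k' \<in> gen_maps" "\<And>\<alpha>. \<alpha> \<in> Words None \<Longrightarrow> k' (k \<alpha>) = \<alpha>" "\<And>\<alpha>. \<alpha> \<in> Words None \<Longrightarrow> k (k' \<alpha>) = \<alpha>"
    using gen_maps_inverse[OF k(1)] by blast
  obtain m' where m': "m' \<in> gen_maps" "\<And>\<alpha>. \<alpha> \<in> Words None \<Longrightarrow> m' (m \<alpha>) = \<alpha>"
    using gen_maps_inverse[OF m(1)] by blast
  have C: "prefix_code (edges D)" by (rule expansion_prefix_code[OF D(1)])
  have "\<forall>e\<in>edges D. \<exists>y. acts_on_cell k e y \<and> (color_of e = Blue \<longrightarrow> last y = E First)" using k(2) by blast
  from bchoice[OF this] obtain f where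
    f: "\<forall>e\<in>edges D. acts_on_cell k e (f e) \<and> (color_of e = Blue \<longrightarrow> last (f e) = E First)" by blast
  \<comment> \<open>The pieces of the normalized domain are the images of the edges of
    \<open>D\<close> under \<open>k\<close>; \<open>N\<close> bounds their lengths.\<close>
  define N where "N = Max (length ` f ` edges D)"
  let ?\<Psi> = "m \<circ> (\<Phi> \<circ> k')"
  have H: "?\<Psi> \<in> gluing_maps" by (intro gluing_maps_compose gen_maps_gluing_maps m k' P)
  have "normalized ?\<Psi> N" unfolding normalized_def
  proof
    fix \<alpha> assume a: "\<alpha> \<in> Words None"
    obtain e \<beta> where eb: "e \<in> edges D" "k' \<alpha> = e \<frown> \<beta>" "\<beta> \<in> Words (Some (color_of e))"
      by (rule codeE[OF C gluing_maps_Words[OF gen_maps_gluing_maps[OF k'(1)] a]])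
    have eL: "e \<in> LL" using C eb(1) by (auto simp: prefix_code_def)
    have fe: "acts_on_cell k e (f e)" "color_of e = Blue \<longrightarrow> last (f e) = E First" using f eb(1) by blast+
    obtain l where l: "f e \<in> LL" "color_of (f e) = color_of e" "l \<in> GG (color_of e)"
      "\<forall>\<alpha>\<in>Words (Some (color_of e)). k (e \<frown> \<alpha>) = f e \<frown> l \<alpha>" using fe(1) by (rule locE)
    have al: "\<alpha> = f e \<frown> l \<beta>" using k'(3)[OF a] eb bspec[OF l(4) eb(3)] by simp
    have i: "acts_on_cell k' (f e) e" by (rule acts_on_cell_inverse[OF fe(1) eL k'(2)])
    obtain e' where e': "e' \<in> edges D'" "acts_on_cell \<Phi> e e'" using e[OF eb(1)] by blast
    obtain y where y: "acts_on_cell m e' y" "color_of e' = Blue \<longrightarrow> last y = E First" using m(2)[OF e'(1)] by blast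
    have "color_of e' = color_of e" using e'(2) by (simp add: acts_on_cell_def)
    moreover have "acts_on_cell ?\<Psi> (f e) y" by (intro acts_on_cell_compose[OF acts_on_cell_compose[OF i e'(2)] y(1)])
    moreover have "length (f e) \<le> N" unfolding N_def using C eb(1) by (intro Max_ge) (auto simp: prefix_code_def)
    ultimately show "\<exists>y y'. y \<in> LL \<and> (\<exists>\<beta>. \<alpha> = y \<frown> \<beta>) \<and> length y \<le> N \<and> acts_on_cell ?\<Psi> y y' \<and>
        (color_of y = Blue \<longrightarrow> last y = E First \<and> last y' = E First)"
      using l(1,2) al fe(2) y(2) by (intro exI[of _ "f e"] exI[of _ y]) auto
  qed
  moreover obtain t x where "\<And>i. ?\<Psi> (vertex_address [] (Z i)) = vertex_address t (x i)"
  proof -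
    have O: "vertex_address [] (Z i) \<in> Words None" for i by simp
    \<comment> \<open>Distinct words that are glued are addresses of a branch point, which provides
      the position \<open>t\<close> of the image of the root.\<close>
    have "eqv (?\<Psi> (vertex_address [] (Z First))) (?\<Psi> (vertex_address [] (Z Second)))"
      using gluing_maps_eqv[OF H O O] eqv_adrs by blast
    moreover have "?\<Psi> (vertex_address [] (Z First)) \<noteq> ?\<Psi> (vertex_address [] (Z Second))"
      using gluing_maps_inj[OF H O O, of First Second] unfolding vertex_address_inj by auto
    ultimately obtain t x1 where t: "?\<Psi> (vertex_address [] (Z First)) = vertex_address t x1" unfolding eqv_def same_vertex_vertex_address by blast
    have "\<forall>i. \<exists>y. ?\<Psi> (vertex_address [] (Z i)) = vertex_address t y"
    proof
      fix i
      show "\<exists>y. ?\<Psi> (vertex_address [] (Z i)) = vertex_address t y"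
        using gluing_maps_vertex_address[OF H _ _ t, of "Z i"] by auto
    qed
    from choice[OF this] that show ?thesis by blast
  qed
  ultimately have K: "?\<Psi> \<in> gen_maps" using normalized_gen_maps[OF H] by blast
  have "m' \<circ> (?\<Psi> \<circ> k) \<in> gen_maps" by (intro gen_maps.comp m' K k)
  then have "\<Phi> \<in> gen_maps"
  proof (rule gen_maps_cong)
    fix \<alpha> assume a: "\<alpha> \<in> Words None"
    show "\<Phi> \<alpha> = (m' \<circ> (?\<Psi> \<circ> k)) \<alpha>" using k'(2)[OF a] m'(2)[OF gluing_maps_Words[OF P(1) a]] by simp
  qed
  then show ?thesis using P(2) by blast
qed

lemma gen_maps_generate:
  assumes "\<Phi> \<in> gen_maps" shows "limit_map \<Phi> \<in> generate EG (limit_map ` gens)"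
  using assms
proof (induction rule: gen_maps.induct)
  case (gen \<Phi>)
  then show ?case by (intro generate.incl) simp
next
  case id
  show ?case using generate.one[of EG] unfolding EG_one .
next
  case (comp \<Phi> \<Psi>)
  show ?case using generate.eng[OF comp.IH] unfolding EG_mult[OF gen_maps_gluing_maps[OF comp.hyps(1)] gen_maps_gluing_maps[OF comp.hyps(2)]] .
next
  case (inv \<Phi> \<Psi>)
  interpret group EG by (rule group_EG)
  have H: "\<Phi> \<in> gluing_maps" "\<Psi> \<in> gluing_maps" using gen_maps_gluing_maps[OF inv.hyps(1)] gluing_maps_inverse[OF gen_maps_gluing_maps[OF inv.hyps(1)] inv.hyps(2)] by blast+
  have "limit_map (\<Psi> \<circ> \<Phi>) = limit_map id" by (rule limit_map_cong[OF gluing_maps_id]) (simp add: inv.hyps(2))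
  then have "limit_map \<Psi> \<otimes>\<^bsub>EG\<^esub> limit_map \<Phi> = \<one>\<^bsub>EG\<^esub>" unfolding EG_mult[OF H(2,1)] EG_one .
  then have "inv\<^bsub>EG\<^esub> (limit_map \<Phi>) = limit_map \<Psi>" by (rule inv_equality) (rule limit_map_carrier[OF H(1)], rule limit_map_carrier[OF H(2)])
  moreover have "limit_map ` gens \<subseteq> carrier EG" using gens_gluing_maps limit_map_carrier by blast
  ultimately show ?case using generate_m_inv_closed inv.IH by metis
qed

theorem proposition6p8:
  shows "group EG \<and> finitely_generated EG"
proof
  show "group EG" by (rule group_EG)
  have sub: "limit_map ` gens \<subseteq> carrier EG" using gens_gluing_maps limit_map_carrier by blast
  have "generate EG (limit_map ` gens) = carrier EG"
  proof
    show "generate EG (limit_map ` gens) \<subseteq> carrier EG" by (rule group.generate_incl[OF group_EG sub])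
    show "carrier EG \<subseteq> generate EG (limit_map ` gens)" using EG_gen_maps gen_maps_generate by blast
  qed
  then show "finitely_generated EG"
    unfolding finitely_generated_def using sub finite_gens by blast
qed

end
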